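(* Let $\mathrm{Jord}^{(2)}$ be the variety of Jordan metabelian algebras over a field $F$ of characteristic $0$, i.e. the variety defined by $xy=yx$, $(x^2,y,x)=0$, $(xy)(zt)=0$. Then its basic spectrum is $$\mathrm{sp}_b(\mathrm{Jord}^{(2)})=\{(0,2)\}.$$
   Context: All algebras are over a field $F$ of characteristic $0$ and are not assumed associative or unital. $(x,y,z)=(xy)z-x(yz)$ is the associator. A superalgebra is a $\mathbb Z_2$-graded algebra $\mathcal A=\mathcal A_0+\mathcal A_1$, $\mathcal A_i\mathcal A_j\subseteq\mathcal A_{i+j \bmod 2}$. $\mathrm G=\mathrm G_0+\mathrm G_1$ is the Grassmann algebra on countably many anticommuting generators $e_1,e_2,\dots$ ($\mathrm G_0$, $\mathrm G_1$ spanned by words of even, resp. odd, length). The Grassmann envelope of $\mathcal A$ is $\mathrm G(\mathcal A)=\mathrm G_0\otimes\mathcal A_0+\mathrm G_1\otimes\mathcal A_1\subseteq \mathrm G\otimes\mathcal A$. For a multilinear polynomial $f$, its superization $\tilde f$ is obtained by the Koszul sign rule (a sign $(-1)^{ij}$ whenever a variable of parity $i$ passes through one of parity $j$); $\mathcal A$ satisfies the superidentity $\tilde f=0$ if and only if $\mathrm G(\mathcal A)$ satisfies $f=0$. For a variety $\mathcal V$, a $\mathcal V$-superalgebra is a superalgebra $\mathcal A$ with $\mathrm G(\mathcal A)\in\mathcal V$; $\tilde{\mathcal V}$ is the class of all $\mathcal V$-superalgebras. The supervariety generated by a superalgebra $\mathcal B$ is the class of all superalgebras satisfying every superidentity $\tilde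 f=0$ ($f$ multilinear) satisfied by $\mathcal B$. For nonnegative integers $(r,s)\ne(0,0)$, $\mathcal V_{r,s}$ is the supervariety generated by the free $\mathcal V$-superalgebra on $r$ even and $s$ odd generators; $\mathcal V_{0,0}=\{\{0\}\}$. A pair $(r,s)$ is a basic superrank of $\mathcal V$ if $\mathcal V_{r,s}=\tilde{\mathcal V}$ and $(r,s)$ is minimal with this property, i.e. $\mathcal V_{r',s'}\ne\tilde{\mathcal V}$ for every $(r',s')\neq(r,s)$ with $r'\leqslant r$, $s'\leqslant s$. The basic spectrum $\mathrm{sp}_b(\mathcal V)$ is the set of all (finite) basic superranks of $\mathcal V$. *)

theory Defs
  imports
    "HOL-Algebra.QuotRing"
    "HOL-Algebra.Module"
    "HOL-Library.Poly_Mapping"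
    "HOL-Library.Z2"
begin

section \<open>Nonassociative algebras over a field\<close>

definition scalars :: "'f::field ring" where
  "scalars = \<lparr>carrier = UNIV, mult = (*), one = 1, zero = 0, add = (+)\<rparr>"

text \<open>
  Algebras are carried by the record type of \<^locale>\<open>module\<close>, because it already has all the
  operations needed. Algebras need not be unital: the field \<^const>\<open>one\<close> of the record is junk,
  it occurs in no axiom and no identity.
\<close>

locale nonassoc_algebra = Module.module "scalars :: 'f ring" A
  for A :: "('f::field, 'a, 'm) module_scheme" (structure) +
  assumes mult_closed: "\<lbrakk>x \<in> carrier A; y \<in> carrier A\<rbrakk> \<Longrightarrow> x \<otimes> y \<in> carrier A"
    and mult_add_left: "\<lbrakk>x \<in> carrier A; y \<in> carrier A; z \<in> carrier A\<rbrakk>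
      \<Longrightarrow> (x \<oplus> y) \<otimes> z = (x \<otimes> z) \<oplus> (y \<otimes> z)"
    and mult_add_right: "\<lbrakk>x \<in> carrier A; y \<in> carrier A; z \<in> carrier A\<rbrakk>
      \<Longrightarrow> x \<otimes> (y \<oplus> z) = (x \<otimes> y) \<oplus> (x \<otimes> z)"
    and mult_smult_left: "\<lbrakk>x \<in> carrier A; y \<in> carrier A\<rbrakk>
      \<Longrightarrow> (c \<odot> x) \<otimes> y = c \<odot> (x \<otimes> y)"
    and mult_smult_right: "\<lbrakk>x \<in> carrier A; y \<in> carrier A\<rbrakk>
      \<Longrightarrow> x \<otimes> (c \<odot> y) = c \<odot> (x \<otimes> y)"


section \<open>Nonassociative polynomials and varieties\<close>

datatype 'v word = Gen 'v | Times "'v word" "'v word"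

fun letters :: "'v word \<Rightarrow> 'v list" where
  "letters (Gen v) = [v]"
| "letters (Times u w) = letters u @ letters w"

text \<open>Elements of the free nonassociative (nonunital) algebra on \<open>'v\<close>.\<close>

type_synonym ('v, 'f) npoly = "'v word \<Rightarrow>\<^sub>0 'f"

definition var :: "'v \<Rightarrow> ('v, 'f::field) npoly" where
  "var v = Poly_Mapping.single (Gen v) 1"

definition npoly_times :: "('v, 'f::field) npoly \<Rightarrow> ('v, 'f) npoly \<Rightarrow> ('v, 'f) npoly"
  (infixl \<open>\<star>\<close> 70) where
  "f \<star> g = (\<Sum>u\<in>Poly_Mapping.keys f. \<Sum>w\<in>Poly_Mapping.keys g.
     Poly_Mapping.single (Times u w) (Poly_Mapping.lookup f u * Poly_Mapping.lookup g w))"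

definition npoly_scale :: "'f::field \<Rightarrow> ('v, 'f) npoly \<Rightarrow> ('v, 'f) npoly" where
  "npoly_scale c f = Poly_Mapping.map (\<lambda>d. c * d) f"

fun word_value :: "('f, 'a, 'm) module_scheme \<Rightarrow> ('v \<Rightarrow> 'a) \<Rightarrow> 'v word \<Rightarrow> 'a" where
  "word_value A a (Gen v) = a v"
| "word_value A a (Times u w) = word_value A a u \<otimes>\<^bsub>A\<^esub> word_value A a w"

definition npoly_value ::
  "('f::field, 'a, 'm) module_scheme \<Rightarrow> ('v \<Rightarrow> 'a) \<Rightarrow> ('v, 'f) npoly \<Rightarrow> 'a" where
  "npoly_value A a f = finsum A (\<lambda>w. Poly_Mapping.lookup f w \<odot>\<^bsub>A\<^esub> word_value A a w) (Poly_Mapping.keys f)"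

definition satisfies ::
  "('f::field, 'a, 'm) module_scheme \<Rightarrow> (nat, 'f) npoly \<Rightarrow> bool" where
  "satisfies A f \<longleftrightarrow> (\<forall>a. (\<forall>v. a v \<in> carrier A) \<longrightarrow> npoly_value A a f = \<zero>\<^bsub>A\<^esub>)"

text \<open>
  A variety is represented by a set of defining identities, so that membership makes sense for
  algebras of every type.
\<close>

definition in_variety ::
  "(nat, 'f::field) npoly set \<Rightarrow> ('f, 'a, 'm) module_scheme \<Rightarrow> bool" where
  "in_variety \<Sigma> A \<longleftrightarrow> nonassoc_algebra A \<and> (\<forall>f\<in>\<Sigma>. satisfies A f)"


section \<open>Superalgebras\<close>

record ('f, 'a) superalg = "('f, 'a) module" +
  part :: "bit \<Rightarrow> 'a set"

locale superalgebra = nonassoc_algebra A for A :: "('f::field, 'a) superalg" (structure) +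
  assumes part_submodule: "submodule (part A i) (scalars :: 'f ring) A"
    and part_sum: "part A 0 <+>\<^bsub>A\<^esub> part A 1 = carrier A"
    and part_direct: "part A 0 \<inter> part A 1 = {\<zero>}"
    and part_mult: "\<lbrakk>x \<in> part A i; y \<in> part A j\<rbrakk> \<Longrightarrow> x \<otimes> y \<in> part A (i + j)"

text \<open>
  For a finite set \<open>S = {i\<^sub>1 < \<dots> < i\<^sub>k}\<close> let \<open>e\<^sub>S = e\<^sub>i\<^sub>1 \<cdots> e\<^sub>i\<^sub>k\<close>; these words (the empty one included) are
  a basis of the Grassmann algebra, and \<open>e\<^sub>S e\<^sub>T = \<plusminus> e\<^sub>S\<^sub>\<union>\<^sub>T\<close> for disjoint \<open>S\<close>, \<open>T\<close> with the sign
  below, \<open>e\<^sub>S e\<^sub>T = 0\<close> otherwise. An element \<open>\<Sum>\<^sub>S e\<^sub>S \<otimes> x\<^sub>S\<close> of the tensor product of the Grassmann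
  algebra with \<open>A\<close> is represented by its family of coefficients \<open>S \<mapsto> x\<^sub>S\<close>; it lies in the
  Grassmann envelope iff each \<open>x\<^sub>S\<close> has the parity of \<open>card S\<close>.
\<close>

definition grassmann_sign :: "nat set \<Rightarrow> nat set \<Rightarrow> 'f::field" where
  "grassmann_sign S T = (- 1) ^ card {(i, j). i \<in> S \<and> j \<in> T \<and> j < i}"

definition grassmann_envelope :: "('f::field, 'a) superalg \<Rightarrow> ('f, nat set \<Rightarrow> 'a) module" where
  "grassmann_envelope A = \<lparr>
     carrier = {x. (\<forall>S. finite S \<longrightarrow> x S \<in> part A (of_nat (card S))) \<and>
                   (\<forall>S. infinite S \<longrightarrow> x S = \<zero>\<^bsub>A\<^esub>) \<and> finite {S. x S \<noteq> \<zero>\<^bsub>A\<^esub>}},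
     mult = (\<lambda>x y U. if finite U
       then finsum A (\<lambda>S. grassmann_sign S (U - S) \<odot>\<^bsub>A\<^esub> (x S \<otimes>\<^bsub>A\<^esub> y (U - S))) (Pow U)
       else \<zero>\<^bsub>A\<^esub>),
     one = undefined,
     zero = (\<lambda>S. \<zero>\<^bsub>A\<^esub>),
     add = (\<lambda>x y S. x S \<oplus>\<^bsub>A\<^esub> y S),
     smult = (\<lambda>c x S. c \<odot>\<^bsub>A\<^esub> x S)\<rparr>"

definition variety_superalgebra ::
  "(nat, 'f::field) npoly set \<Rightarrow> ('f, 'a) superalg \<Rightarrow> bool" where
  "variety_superalgebra \<Sigma> A \<longleftrightarrow> superalgebra A \<and> in_variety \<Sigma> (grassmann_envelope A)"


section \<open>Superidentities\<close>

definition multilinear :: "(nat, 'f::field) npoly \<Rightarrow> bool" where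
  "multilinear f \<longleftrightarrow> (\<exists>V. \<forall>w\<in>Poly_Mapping.keys f. distinct (letters w) \<and> set (letters w) = V)"

text \<open>
  Koszul sign of rearranging the variables \<open>vs\<close>, of parities \<open>p\<close>, from increasing order: one
  factor \<open>(-1)\<^sup>i\<^sup>j\<close> for each inverted pair of variables, of parities \<open>i\<close> and \<open>j\<close>.
\<close>

definition koszul_sign :: "(nat \<Rightarrow> bit) \<Rightarrow> nat list \<Rightarrow> 'f::field" where
  "koszul_sign p vs =
     (\<Prod>(k, l) \<in> {(k, l). k < l \<and> l < length vs \<and> vs ! l < vs ! k}.
        if p (vs ! k) * p (vs ! l) = 1 then - 1 else 1)"

definition superization :: "(nat \<Rightarrow> bit) \<Rightarrow> (nat, 'f::field) npoly \<Rightarrow> (nat, 'f) npoly" where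
  "superization p f = Poly_Mapping.mapp (\<lambda>w c. koszul_sign p (letters w) * c) f"

definition satisfies_super :: "('f::field, 'a) superalg \<Rightarrow> (nat, 'f) npoly \<Rightarrow> bool" where
  "satisfies_super A f \<longleftrightarrow>
     (\<forall>p a. (\<forall>v. a v \<in> part A (p v)) \<longrightarrow> npoly_value A a (superization p f) = \<zero>\<^bsub>A\<^esub>)"


section \<open>Free superalgebras of a variety\<close>

text \<open>The absolutely free superalgebra on even generators \<open>Inl i\<close>, \<open>i < r\<close>, and odd
  generators \<open>Inr j\<close>, \<open>j < s\<close>.\<close>

definition word_parity :: "(nat + nat) word \<Rightarrow> bit" where
  "word_parity w = of_nat (length (filter (\<lambda>v. \<not> isl v) (letters w)))"

definition npolys_on :: "nat \<Rightarrow> nat \<Rightarrow> (nat + nat, 'f::field) npoly set" where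
  "npolys_on r s = {f. \<forall>w\<in>Poly_Mapping.keys f. set (letters w) \<subseteq> Inl ` {..<r} \<union> Inr ` {..<s}}"

definition free_superalgebra ::
  "nat \<Rightarrow> nat \<Rightarrow> ('f::field, (nat + nat, 'f) npoly) superalg" where
  "free_superalgebra r s = \<lparr>
     carrier = npolys_on r s,
     mult = (\<star>),
     one = undefined,
     zero = 0,
     add = (+),
     smult = npoly_scale,
     part = (\<lambda>i. {f \<in> npolys_on r s. \<forall>w\<in>Poly_Mapping.keys f. word_parity w = i})\<rparr>"

definition graded_ideal :: "('f::field, 'a) superalg \<Rightarrow> 'a set \<Rightarrow> bool" where
  "graded_ideal A I \<longleftrightarrow>
     submodule I (scalars :: 'f ring) A \<and>
     (\<forall>x\<in>carrier A. \<forall>y\<in>I. x \<otimes>\<^bsub>A\<^esub> y \<in> I \<and> y \<otimes>\<^bsub>A\<^esub> x \<in> I) \<and>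
     I = (I \<inter> part A 0) <+>\<^bsub>A\<^esub> (I \<inter> part A 1)"

definition quotient_superalgebra ::
  "('f::field, 'a) superalg \<Rightarrow> 'a set \<Rightarrow> ('f, 'a set) superalg" where
  "quotient_superalgebra A I = \<lparr>
     carrier = a_rcosets\<^bsub>A\<^esub> I,
     mult = rcoset_mult A I,
     one = undefined,
     zero = I,
     add = set_add A,
     smult = (\<lambda>c X. \<Union>x\<in>X. I +>\<^bsub>A\<^esub> (c \<odot>\<^bsub>A\<^esub> x)),
     part = (\<lambda>i. (\<lambda>x. I +>\<^bsub>A\<^esub> x) ` part A i)\<rparr>"

text \<open>The smallest graded ideal with quotient in the class of superalgebras of the variety.\<close>

definition verbal_ideal ::
  "(nat, 'f::field) npoly set \<Rightarrow> ('f, 'a) superalg \<Rightarrow> 'a set" where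
  "verbal_ideal \<Sigma> A =
     \<Inter> {I. graded_ideal A I \<and> variety_superalgebra \<Sigma> (quotient_superalgebra A I)}"

definition free_variety_superalgebra ::
  "(nat, 'f::field) npoly set \<Rightarrow> nat \<Rightarrow> nat \<Rightarrow> ('f, (nat + nat, 'f) npoly set) superalg" where
  "free_variety_superalgebra \<Sigma> r s =
     quotient_superalgebra (free_superalgebra r s) (verbal_ideal \<Sigma> (free_superalgebra r s))"


section \<open>Basic superranks\<close>

text \<open>
  A class of superalgebras is rendered as the set of its members whose elements are taken from a
  type \<open>'u\<close>, which plays the role of a universe. A superalgebra satisfies the same superidentities
  as the family of its finitely generated graded subalgebras, and the latter have at most as many
  elements as the (infinite) field \<open>'f\<close>. Hence nothing is lost if \<open>'u\<close> has at least the
  cardinality of \<open>'f\<close>; for smaller \<open>'u\<close> the notions below are not meaningful.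
\<close>

definition variety_superalgebras ::
  "(nat, 'f::field) npoly set \<Rightarrow> ('f, 'u) superalg set" where
  "variety_superalgebras \<Sigma> = {A. variety_superalgebra \<Sigma> A}"

definition generated_supervariety :: "('f::field, 'b) superalg \<Rightarrow> ('f, 'u) superalg set" where
  "generated_supervariety B =
     {A. superalgebra A \<and>
         (\<forall>f. multilinear f \<longrightarrow> satisfies_super B f \<longrightarrow> satisfies_super A f)}"

definition rank_supervariety ::
  "(nat, 'f::field) npoly set \<Rightarrow> nat \<Rightarrow> nat \<Rightarrow> ('f, 'u) superalg set" where
  "rank_supervariety \<Sigma> r s =
     (if (r, s) = (0, 0) then {A. superalgebra A \<and> carrier A = {\<zero>\<^bsub>A\<^esub>}}
      else generated_supervariety (free_variety_superalgebra \<Sigma> r s))"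

definition basic_superrank ::
  "'u itself \<Rightarrow> (nat, 'f::field) npoly set \<Rightarrow> nat \<Rightarrow> nat \<Rightarrow> bool" where
  "basic_superrank _ \<Sigma> r s \<longleftrightarrow>
     (rank_supervariety \<Sigma> r s :: ('f, 'u) superalg set) = variety_superalgebras \<Sigma> \<and>
     (\<forall>r' s'. (r', s') \<noteq> (r, s) \<longrightarrow> r' \<le> r \<longrightarrow> s' \<le> s \<longrightarrow>
        (rank_supervariety \<Sigma> r' s' :: ('f, 'u) superalg set) \<noteq> variety_superalgebras \<Sigma>)"

definition basic_spectrum :: "'u itself \<Rightarrow> (nat, 'f::field) npoly set \<Rightarrow> (nat \<times> nat) set" where
  "basic_spectrum U \<Sigma> = {(r, s). basic_superrank U \<Sigma> r s}"


section \<open>Jordan metabelian algebras\<close>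

definition npoly_associator ::
  "('v, 'f::field) npoly \<Rightarrow> ('v, 'f) npoly \<Rightarrow> ('v, 'f) npoly \<Rightarrow> ('v, 'f) npoly" where
  "npoly_associator f g h = (f \<star> g) \<star> h - f \<star> (g \<star> h)"

definition jordan_metabelian :: "(nat, 'f::field) npoly set" where
  "jordan_metabelian =
     (let x = var 0; y = var 1; z = var 2; t = var 3 in
      {x \<star> y - y \<star> x,
       npoly_associator (x \<star> x) y x,
       (x \<star> y) \<star> (z \<star> t)})"

end

theory Submission
  imports Defs
begin

text \<open>
Superidentities are turned into ordinary identities: for multilinear \<open>f\<close>, a superalgebra satisfies the
superization of \<open>f\<close> iff its Grassmann envelope satisfies \<open>f\<close> (\<open>satisfies_super_iff_envelope\<close>), so the
Koszul signs disappear and the work takes place in a commutative algebra \<open>K\<close> with \<open>K\<^sup>2 K\<^sup>2 = 0\<close> and the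
linearized Jordan identity. On \<open>K\<^sup>2\<close> that identity says \<open>R\<^sub>z R\<^sub>y R\<^sub>t = - R\<^sub>t R\<^sub>y R\<^sub>z\<close> for the
multiplication operators; hence an operator word changes sign when two entries at positions of the same
parity are exchanged (\<open>operators_swap\<close>). Everything rests on this skew-symmetry.

\<^emph>\<open>Two odd generators suffice.\<close> A nonzero word of degree \<open>n\<close> is left-normed up to commutativity. For a letter
\<open>i\<close> and a set \<open>S\<close> of other letters let \<open>E(i,S)\<close> be the signed sum of words that start with \<open>i\<close> and have
the elements of \<open>S\<close> at every second place after it, one word for each letter of \<open>S\<close> standing next to \<open>i\<close>; by
skew-symmetry the remaining order is irrelevant. The Jordan identity that exchanges one of the first two
letters with a later one shows that \<open>n div 2 + 1\<close> times a left-normed word is a sum of two of these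
elements up to sign (\<open>left_normed_expansion\<close>). In characteristic 0 a multilinear \<open>f\<close> therefore vanishes on
every metabelian Jordan algebra as soon as its total coefficient at each \<open>E(i,S)\<close> is 0. One superalgebra
reads off all these coefficients: it has two odd generators \<open>x\<close>, \<open>y\<close> and basis elements \<open>m\<^sub>k\<close> with
\<open>x y = m\<^sub>0\<close>, \<open>m\<^sub>k x = m\<^sub>k\<^sub>+\<^sub>1\<close> for even \<open>k\<close>, \<open>m\<^sub>k y = m\<^sub>k\<^sub>+\<^sub>1\<close> for odd \<open>k\<close>, the products forced by
supercommutativity, and all other products 0. Substituting \<open>m\<^sub>0\<close> for \<open>i\<close>, \<open>x\<close> for the letters in \<open>S\<close> and
\<open>y\<close> for the others kills every word that does not contribute to \<open>E(i,S)\<close> (\<open>test_coefficient\<close>). This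
superalgebra is generated by two odd elements, so it satisfies all superidentities of the free superalgebra
on two odd generators.

\<^emph>\<open>Even generators and one odd generator do not suffice.\<close> Let \<open>f\<close> be \<open>x\<^sub>0 x\<^sub>1\<close> followed by \<open>m\<close> operators
\<open>R\<^sub>y R\<^sub>z + R\<^sub>z R\<^sub>y\<close> in new letters. On an algebra generated by \<open>r\<close> even elements and one odd element such a
factor is 0 if both letters become the odd generator. Otherwise each of the \<open>m\<close> factors involves an even
generator, and if \<open>m > 2 r\<close> one of the \<open>r\<close> generators occurs at two positions of the same parity, so
skew-symmetry kills the word (\<open>pairs_poly_satisfied\<close>). The superalgebra above does not satisfy \<open>f\<close>, and
a copy of it lives in every universe that is at least as large as the field.
\<close>


section \<open>Algebras, homomorphisms and values of polynomials\<close>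

lemma carrier_scalars [simp]: "carrier scalars = UNIV"
  and add_scalars [simp]: "add scalars = (+)"
  and mult_scalars [simp]: "mult scalars = (*)"
  and one_scalars [simp]: "one scalars = 1"
  and zero_scalars [simp]: "zero scalars = 0"
  by (simp_all add: scalars_def)

lemma cring_scalars: "cring (scalars :: 'f::field ring)"
proof (rule cringI)
  show "abelian_group (scalars :: 'f ring)"
    by (rule abelian_groupI) (auto simp: algebra_simps intro: exI[of _ "- _"] add.left_inverse)
  show "comm_monoid (scalars :: 'f ring)"
    by (rule comm_monoidI) (auto simp: algebra_simps)
qed (auto simp: algebra_simps)

lemma nonassoc_algebraI:
  fixes A :: "('f::field, 'a, 'm) module_scheme" (structure)
  assumes "\<zero> \<in> carrier A"
    and "\<And>x y. \<lbrakk>x \<in> carrier A; y \<in> carrier A\<rbrakk> \<Longrightarrow> x \<oplus> y \<in> carrier A"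
    and "\<And>x y z. \<lbrakk>x \<in> carrier A; y \<in> carrier A; z \<in> carrier A\<rbrakk> \<Longrightarrow> (x \<oplus> y) \<oplus> z = x \<oplus> (y \<oplus> z)"
    and "\<And>x y. \<lbrakk>x \<in> carrier A; y \<in> carrier A\<rbrakk> \<Longrightarrow> x \<oplus> y = y \<oplus> x"
    and "\<And>x. x \<in> carrier A \<Longrightarrow> \<zero> \<oplus> x = x"
    and "\<And>x. x \<in> carrier A \<Longrightarrow> (- 1 :: 'f) \<odot> x \<oplus> x = \<zero>"
    and "\<And>c x. x \<in> carrier A \<Longrightarrow> c \<odot> x \<in> carrier A"
    and "\<And>c d x. x \<in> carrier A \<Longrightarrow> (c + d) \<odot> x = c \<odot> x \<oplus> d \<odot> x"
    and "\<And>c x y. \<lbrakk>x \<in> carrier A; y \<in> carrier A\<rbrakk> \<Longrightarrow> c \<odot> (x \<oplus> y) = c \<odot> x \<oplus> c \<odot> y"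
    and "\<And>c d x. x \<in> carrier A \<Longrightarrow> (c * d) \<odot> x = c \<odot> (d \<odot> x)"
    and "\<And>x. x \<in> carrier A \<Longrightarrow> (1 :: 'f) \<odot> x = x"
    and "\<And>x y. \<lbrakk>x \<in> carrier A; y \<in> carrier A\<rbrakk> \<Longrightarrow> x \<otimes> y \<in> carrier A"
    and "\<And>x y z. \<lbrakk>x \<in> carrier A; y \<in> carrier A; z \<in> carrier A\<rbrakk> \<Longrightarrow> (x \<oplus> y) \<otimes> z = x \<otimes> z \<oplus> y \<otimes> z"
    and "\<And>x y z. \<lbrakk>x \<in> carrier A; y \<in> carrier A; z \<in> carrier A\<rbrakk> \<Longrightarrow> x \<otimes> (y \<oplus> z) = x \<otimes> y \<oplus> x \<otimes> z"
    and "\<And>c x y. \<lbrakk>x \<in> carrier A; y \<in> carrier A\<rbrakk> \<Longrightarrow> (c \<odot> x) \<otimes> y = c \<odot> (x \<otimes> y)"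
    and "\<And>c x y. \<lbrakk>x \<in> carrier A; y \<in> carrier A\<rbrakk> \<Longrightarrow> x \<otimes> (c \<odot> y) = c \<odot> (x \<otimes> y)"
  shows "nonassoc_algebra A"
proof -
  have "abelian_group A"
    using assms by (intro abelian_groupI) (auto intro!: bexI[of _ "(- 1 :: 'f) \<odot> _"])
  with cring_scalars have "Module.module (scalars :: 'f ring) A"
    by (rule moduleI) (use assms in auto)
  then show ?thesis
    by (rule nonassoc_algebra.intro) (unfold_locales, use assms in auto)
qed

context nonassoc_algebra
begin

lemma scale_closed [simp, intro]: "x \<in> carrier A \<Longrightarrow> c \<odot> x \<in> carrier A"
  by (rule smult_closed) simp_all

lemma add_scale: "x \<in> carrier A \<Longrightarrow> (c + d) \<odot> x = c \<odot> x \<oplus> d \<odot> x"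
  using smult_l_distr[of c d x] by simp

lemma scale_add: "\<lbrakk>x \<in> carrier A; y \<in> carrier A\<rbrakk> \<Longrightarrow> c \<odot> (x \<oplus> y) = c \<odot> x \<oplus> c \<odot> y"
  using smult_r_distr[of c x y] by simp

lemma scale_scale: "x \<in> carrier A \<Longrightarrow> c \<odot> (d \<odot> x) = (c * d) \<odot> x"
  using smult_assoc1[of c d x] by simp

lemma one_scale [simp]: "x \<in> carrier A \<Longrightarrow> 1 \<odot> x = x"
  using smult_one[of x] by simp

lemma zero_scale [simp]: "x \<in> carrier A \<Longrightarrow> 0 \<odot> x = \<zero>"
  using smult_l_null[of x] by simp

lemma scale_zero [simp]: "c \<odot> \<zero> = \<zero>"
  using smult_r_null[of c] by simp

lemma minus_one_scale: "x \<in> carrier A \<Longrightarrow> (- 1) \<odot> x = \<ominus> x"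
  by (rule minus_equality[symmetric]) (use add_scale[of x "- 1" 1] in simp_all)

lemma minus_scale: "x \<in> carrier A \<Longrightarrow> (- c) \<odot> x = \<ominus> (c \<odot> x)"
  using minus_one_scale[of "c \<odot> x"] by (simp add: scale_scale)

lemma scale_minus: "x \<in> carrier A \<Longrightarrow> c \<odot> (\<ominus> x) = \<ominus> (c \<odot> x)"
  by (simp flip: minus_one_scale add: scale_scale)

lemma scale_eq_zero: "\<lbrakk>x \<in> carrier A; c \<noteq> 0; c \<odot> x = \<zero>\<rbrakk> \<Longrightarrow> x = \<zero>"
  using scale_scale[of x "inverse c" c] by simp

lemma finsum_scale:
  "\<lbrakk>finite X; f \<in> X \<rightarrow> carrier A\<rbrakk> \<Longrightarrow> c \<odot> (\<Oplus>i\<in>X. f i) = (\<Oplus>i\<in>X. c \<odot> f i)"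
  using finsum_smult_ldistr[of X c f] by simp

lemma scale_finsum:
  assumes "finite X" "x \<in> carrier A"
  shows "(\<Sum>i\<in>X. c i) \<odot> x = (\<Oplus>i\<in>X. c i \<odot> x)"
  using assms(1) by induction (use assms(2) in \<open>auto simp: add_scale\<close>)

lemma mult_zero_left [simp]: "x \<in> carrier A \<Longrightarrow> \<zero> \<otimes> x = \<zero>"
  using mult_smult_left[of \<zero> x 0] mult_closed[of \<zero> x] by simp

lemma mult_zero_right [simp]: "x \<in> carrier A \<Longrightarrow> x \<otimes> \<zero> = \<zero>"
  using mult_smult_right[of x \<zero> 0] mult_closed[of x \<zero>] by simp

lemma finsum_mult_right:
  assumes "finite X" "f \<in> X \<rightarrow> carrier A" "x \<in> carrier A"
  shows "(\<Oplus>i\<in>X. f i) \<otimes> x = (\<Oplus>i\<in>X. f i \<otimes> x)"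
  using assms(1,2)
proof induction
  case (insert i X)
  then show ?case
    using assms(3) by (subst (1 2) finsum_insert) (auto simp: mult_add_left mult_closed Pi_def)
qed (use assms in simp)

lemma finsum_swap:
  assumes "finite X" "finite Y" "\<And>i j. \<lbrakk>i \<in> X; j \<in> Y\<rbrakk> \<Longrightarrow> f i j \<in> carrier A"
  shows "(\<Oplus>i\<in>X. \<Oplus>j\<in>Y. f i j) = (\<Oplus>j\<in>Y. \<Oplus>i\<in>X. f i j)"
  using assms(1,3)
proof induction
  case (insert i X)
  then have "(\<Oplus>j\<in>Y. \<Oplus>i\<in>insert i X. f i j) = (\<Oplus>j\<in>Y. f i j \<oplus> (\<Oplus>i\<in>X. f i j))"
    by (intro finsum_cong') (auto intro!: finsum_closed simp: finsum_insert)
  with insert show ?case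
    by (auto simp: finsum_addf finsum_closed Pi_def)
qed (use assms in simp)

lemma finsum_superset:
  assumes "finite Y" "X \<subseteq> Y" "f \<in> Y \<rightarrow> carrier A" "\<And>i. i \<in> Y - X \<Longrightarrow> f i = \<zero>"
  shows "(\<Oplus>i\<in>X. f i) = (\<Oplus>i\<in>Y. f i)"
  using add.finprod_mono_neutral_cong_left[OF assms(1,2), of f f] assms(3,4)
  by (auto simp: finsum_def)

lemma finsum_neutral: "(\<And>i. i \<in> X \<Longrightarrow> f i = \<zero>) \<Longrightarrow> (\<Oplus>i\<in>X. f i) = \<zero>"
  using add.finprod_one_eqI[of X f] by simp

lemma finsum_one:
  assumes "finite X" "j \<in> X" "f j \<in> carrier A" "\<And>i. \<lbrakk>i \<in> X; i \<noteq> j\<rbrakk> \<Longrightarrow> f i = \<zero>"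
  shows "(\<Oplus>i\<in>X. f i) = f j"
  using finsum_superset[of X "{j}" f] assms by (force simp: finsum_insert)

lemma word_value_closed: "(\<And>v. v \<in> set (letters w) \<Longrightarrow> a v \<in> carrier A) \<Longrightarrow> word_value A a w \<in> carrier A"
  by (induction w) (auto intro: mult_closed)

lemma word_value_cong:
  "(\<And>v. v \<in> set (letters w) \<Longrightarrow> a v = b v) \<Longrightarrow> word_value A a w = word_value A b w"
  by (induction w) auto

lemma npoly_value_closed: "(\<And>v. a v \<in> carrier A) \<Longrightarrow> npoly_value A a f \<in> carrier A"
  unfolding npoly_value_def by (auto intro!: finsum_closed word_value_closed)

lemma npoly_value_superset:
  assumes "\<And>v. a v \<in> carrier A" "finite K" "Poly_Mapping.keys f \<subseteq> K"
  shows "npoly_value A a f = (\<Oplus>w\<in>K. Poly_Mapping.lookup f w \<odot> word_value A a w)"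
  unfolding npoly_value_def
  by (rule finsum_superset) (use assms in \<open>auto simp: in_keys_iff word_value_closed\<close>)

lemma npoly_value_zero [simp]: "npoly_value A a 0 = \<zero>"
  by (simp add: npoly_value_def)

lemma npoly_value_single:
  assumes "\<And>v. a v \<in> carrier A"
  shows "npoly_value A a (Poly_Mapping.single w c) = c \<odot> word_value A a w"
  using assms by (subst npoly_value_superset[of _ "{w}"]) (auto simp: word_value_closed)

lemma npoly_value_var: "(\<And>v. a v \<in> carrier A) \<Longrightarrow> npoly_value A a (var v) = a v"
  by (simp add: var_def npoly_value_single)

lemma npoly_value_add:
  assumes a: "\<And>v. a v \<in> carrier A"
  shows "npoly_value A a (f + g) = npoly_value A a f \<oplus> npoly_value A a g"
proof -
  define K where "K = Poly_Mapping.keys f \<union> Poly_Mapping.keys g"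
  have K: "finite K" "Poly_Mapping.keys f \<subseteq> K" "Poly_Mapping.keys g \<subseteq> K" "Poly_Mapping.keys (f + g) \<subseteq> K"
    using keys_add[of f g] by (auto simp: K_def)
  have "(\<Oplus>w\<in>K. Poly_Mapping.lookup (f + g) w \<odot> word_value A a w)
      = (\<Oplus>w\<in>K. Poly_Mapping.lookup f w \<odot> word_value A a w \<oplus> Poly_Mapping.lookup g w \<odot> word_value A a w)"
    by (rule finsum_cong') (auto simp: lookup_add add_scale word_value_closed a)
  then show ?thesis
    by (simp add: npoly_value_superset[OF a K(1)] K finsum_addf word_value_closed a Pi_def)
qed

lemma npoly_value_uminus:
  assumes a: "\<And>v. a v \<in> carrier A"
  shows "npoly_value A a (- f) = \<ominus> npoly_value A a f"
  by (rule minus_equality[symmetric]) (use npoly_value_add[of a "- f" f, OF a] in \<open>simp_all add: npoly_value_closed a\<close>)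

lemma npoly_value_diff:
  assumes a: "\<And>v. a v \<in> carrier A"
  shows "npoly_value A a (f - g) = npoly_value A a f \<ominus> npoly_value A a g"
  using npoly_value_add[of a f "- g", OF a] npoly_value_uminus[of a g, OF a] by (simp add: minus_eq)

end

text \<open>The form of induction that matches additivity: bilinear statements about polynomials need to be checked on
monomials only.\<close>

lemma poly_mapping_single_induct [case_names zero single add]:
  assumes "P 0" "\<And>w c. P (Poly_Mapping.single w c)" "\<And>f g. \<lbrakk>P f; P g\<rbrakk> \<Longrightarrow> P (f + g)"
  shows "P (f :: 'w \<Rightarrow>\<^sub>0 'f::ab_group_add)"
proof (induction f rule: update_induct)
  case const
  show ?case by (fact assms(1))
next
  case (update f w c)
  then have "Poly_Mapping.update w c f = f + Poly_Mapping.single w c"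
    by (intro poly_mapping_eqI) (auto simp: lookup_update lookup_add lookup_single in_keys_iff when_def)
  with assms update show ?case by metis
qed

lemma npoly_times_superset:
  assumes "finite K" "finite L" "Poly_Mapping.keys f \<subseteq> K" "Poly_Mapping.keys g \<subseteq> L"
  shows "f \<star> g = (\<Sum>u\<in>K. \<Sum>w\<in>L.
     Poly_Mapping.single (Times u w) (Poly_Mapping.lookup f u * Poly_Mapping.lookup g w))"
proof -
  have "f \<star> g = (\<Sum>u\<in>Poly_Mapping.keys f. \<Sum>w\<in>L.
     Poly_Mapping.single (Times u w) (Poly_Mapping.lookup f u * Poly_Mapping.lookup g w))"
    unfolding npoly_times_def
    by (intro sum.cong sum.mono_neutral_left) (use assms in \<open>auto simp: in_keys_iff\<close>)
  also have "\<dots> = (\<Sum>u\<in>K. \<Sum>w\<in>L.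
     Poly_Mapping.single (Times u w) (Poly_Mapping.lookup f u * Poly_Mapping.lookup g w))"
    by (intro sum.mono_neutral_left) (use assms in \<open>auto simp: in_keys_iff\<close>)
  finally show ?thesis .
qed

lemma npoly_times_single:
  "Poly_Mapping.single u c \<star> Poly_Mapping.single w d = Poly_Mapping.single (Times u w) (c * d)"
  by (subst npoly_times_superset[of "{u}" "{w}"]) auto

lemma npoly_times_add_left: "(f + g) \<star> h = f \<star> h + g \<star> h"
proof -
  let ?K = "Poly_Mapping.keys f \<union> Poly_Mapping.keys g" and ?L = "Poly_Mapping.keys h"
  have "Poly_Mapping.keys (f + g) \<subseteq> ?K" by (rule keys_add)
  then show ?thesis
    by (simp add: npoly_times_superset[of ?K ?L] lookup_add distrib_right single_add sum.distrib)
qed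

lemma npoly_times_add_right: "f \<star> (g + h) = f \<star> g + f \<star> h"
proof -
  let ?K = "Poly_Mapping.keys f" and ?L = "Poly_Mapping.keys g \<union> Poly_Mapping.keys h"
  have "Poly_Mapping.keys (g + h) \<subseteq> ?L" by (rule keys_add)
  then show ?thesis
    by (simp add: npoly_times_superset[of ?K ?L] lookup_add distrib_left single_add sum.distrib)
qed

lemma npoly_times_zero_left [simp]: "0 \<star> f = 0"
  and npoly_times_zero_right [simp]: "f \<star> 0 = 0"
  by (simp_all add: npoly_times_def)

lemma lookup_npoly_scale: "Poly_Mapping.lookup (npoly_scale c f) w = c * Poly_Mapping.lookup f w"
  by (simp add: npoly_scale_def map.rep_eq when_def)

lemma npoly_scale_single: "npoly_scale c (Poly_Mapping.single w d) = Poly_Mapping.single w (c * d)"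
  by (rule poly_mapping_eqI) (simp add: lookup_npoly_scale lookup_single when_def)

lemma npoly_scale_add: "npoly_scale c (f + g) = npoly_scale c f + npoly_scale c g"
  by (rule poly_mapping_eqI) (simp add: lookup_npoly_scale lookup_add algebra_simps)

lemma npoly_scale_zero [simp]: "npoly_scale c 0 = 0"
  by (rule poly_mapping_eqI) (simp add: lookup_npoly_scale)

lemma npoly_times_scale_left: "npoly_scale c f \<star> g = npoly_scale c (f \<star> g)"
proof (induction f rule: poly_mapping_single_induct)
  case (single w d)
  show ?case
    by (induction g rule: poly_mapping_single_induct)
      (simp_all add: npoly_scale_single npoly_times_single npoly_times_add_right npoly_scale_add algebra_simps)
qed (simp_all add: npoly_times_add_left npoly_scale_add)

lemma npoly_times_scale_right: "f \<star> npoly_scale c g = npoly_scale c (f \<star> g)"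
proof (induction f rule: poly_mapping_single_induct)
  case (single w d)
  show ?case
    by (induction g rule: poly_mapping_single_induct)
      (simp_all add: npoly_scale_single npoly_times_single npoly_times_add_right npoly_scale_add algebra_simps)
qed (simp_all add: npoly_times_add_left npoly_scale_add)

lemma keys_npoly_times:
  "w \<in> Poly_Mapping.keys (f \<star> g) \<Longrightarrow> \<exists>u\<in>Poly_Mapping.keys f. \<exists>v\<in>Poly_Mapping.keys g. w = Times u v"
proof -
  assume "w \<in> Poly_Mapping.keys (f \<star> g)"
  then have "Poly_Mapping.lookup (f \<star> g) w \<noteq> 0" by (simp add: in_keys_iff)
  then obtain u where u: "u \<in> Poly_Mapping.keys f" and
    "(\<Sum>v\<in>Poly_Mapping.keys g. Poly_Mapping.lookup (Poly_Mapping.single (Times u v)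
       (Poly_Mapping.lookup f u * Poly_Mapping.lookup g v)) w) \<noteq> 0"
    unfolding npoly_times_def lookup_sum by (meson sum.neutral)
  then obtain v where "v \<in> Poly_Mapping.keys g" and
    "Poly_Mapping.lookup (Poly_Mapping.single (Times u v) (Poly_Mapping.lookup f u * Poly_Mapping.lookup g v)) w \<noteq> 0"
    by (meson sum.neutral)
  with u show ?thesis by (auto simp: lookup_single when_def split: if_splits)
qed

lemma keys_npoly_scale: "Poly_Mapping.keys (npoly_scale c f) \<subseteq> Poly_Mapping.keys f"
  by (auto simp: in_keys_iff lookup_npoly_scale)

context nonassoc_algebra
begin

lemma npoly_value_scale:
  assumes a: "\<And>v. a v \<in> carrier A"
  shows "npoly_value A a (npoly_scale c f) = c \<odot> npoly_value A a f"
  by (induction f rule: poly_mapping_single_induct)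
    (simp_all add: npoly_scale_single npoly_value_single npoly_scale_add npoly_value_add a
      scale_scale scale_add npoly_value_closed word_value_closed)

lemma npoly_value_times:
  assumes a: "\<And>v. a v \<in> carrier A"
  shows "npoly_value A a (f \<star> g) = npoly_value A a f \<otimes> npoly_value A a g"
proof (induction f rule: poly_mapping_single_induct)
  case (single w c)
  show ?case
    by (induction g rule: poly_mapping_single_induct)
      (simp_all add: npoly_times_single npoly_value_single a npoly_times_add_right npoly_value_add
        mult_add_right npoly_value_closed word_value_closed mult_smult_left mult_smult_right scale_scale mult_closed mult.commute)
qed (simp_all add: npoly_times_add_left npoly_value_add mult_add_left npoly_value_closed a)

end

definition algebra_hom ::
  "('f::field, 'a, 'm) module_scheme \<Rightarrow> ('f, 'b, 'n) module_scheme \<Rightarrow> ('a \<Rightarrow> 'b) \<Rightarrow> bool" where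
  "algebra_hom A B h \<longleftrightarrow> h \<in> carrier A \<rightarrow> carrier B \<and> h \<zero>\<^bsub>A\<^esub> = \<zero>\<^bsub>B\<^esub> \<and>
     (\<forall>x\<in>carrier A. \<forall>y\<in>carrier A. h (x \<oplus>\<^bsub>A\<^esub> y) = h x \<oplus>\<^bsub>B\<^esub> h y \<and> h (x \<otimes>\<^bsub>A\<^esub> y) = h x \<otimes>\<^bsub>B\<^esub> h y) \<and>
     (\<forall>c. \<forall>x\<in>carrier A. h (c \<odot>\<^bsub>A\<^esub> x) = c \<odot>\<^bsub>B\<^esub> h x)"

text \<open>All axioms of algebras are equations with existing inverses, so they pass to surjective images. Quotients and
transported copies of an algebra are both obtained in this way.\<close>

lemma algebra_hom_image:
  assumes A: "nonassoc_algebra A" and h: "algebra_hom A B h" and surj: "h ` carrier A = carrier B"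
  shows "nonassoc_algebra B"
proof -
  interpret nonassoc_algebra A by fact
  have H: "h x \<oplus>\<^bsub>B\<^esub> h y = h (x \<oplus>\<^bsub>A\<^esub> y)" "h x \<otimes>\<^bsub>B\<^esub> h y = h (x \<otimes>\<^bsub>A\<^esub> y)" "c \<odot>\<^bsub>B\<^esub> h x = h (c \<odot>\<^bsub>A\<^esub> x)"
      "\<zero>\<^bsub>B\<^esub> = h \<zero>\<^bsub>A\<^esub>" "h x \<in> carrier B"
    if "x \<in> carrier A" "y \<in> carrier A" for x y c
    using h that by (auto simp: algebra_hom_def)
  have ex: "\<exists>x\<in>carrier A. h x = y" if "y \<in> carrier B" for y
    using that unfolding surj[symmetric] by blast
  define g where "g y = (SOME x. x \<in> carrier A \<and> h x = y)" for y
  have g: "g y \<in> carrier A" "h (g y) = y" if "y \<in> carrier B" for y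
    using someI_ex[of "\<lambda>x. x \<in> carrier A \<and> h x = y"] ex[OF that] by (auto simp: g_def)
  show ?thesis
  proof (rule nonassoc_algebraI)
    fix x y z c d
    show "\<zero>\<^bsub>B\<^esub> \<in> carrier B" using H(4,5)[of "\<zero>\<^bsub>A\<^esub>" "\<zero>\<^bsub>A\<^esub>"] by simp
    assume x: "x \<in> carrier B"
    then have x': "g x \<in> carrier A" "h (g x) = x" by (simp_all add: g)
    show "\<zero>\<^bsub>B\<^esub> \<oplus>\<^bsub>B\<^esub> x = x"
      using H(1)[of "\<zero>\<^bsub>A\<^esub>" "g x"] H(4)[of "g x"] x' by simp
    show "c \<odot>\<^bsub>B\<^esub> x \<in> carrier B" using H(3)[of "g x" "g x" c] H(5)[of "c \<odot>\<^bsub>A\<^esub> g x"] x' by simp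
    show "(- 1) \<odot>\<^bsub>B\<^esub> x \<oplus>\<^bsub>B\<^esub> x = \<zero>\<^bsub>B\<^esub>"
      using H(3)[of "g x" "g x" "- 1"] H(1)[of "(- 1) \<odot>\<^bsub>A\<^esub> g x" "g x"] H(4)[of "g x"] x'
      by (simp add: minus_one_scale l_neg)
    show "1 \<odot>\<^bsub>B\<^esub> x = x"
      using H(3)[of "g x" "g x" 1] x' by simp
    show "(c + d) \<odot>\<^bsub>B\<^esub> x = c \<odot>\<^bsub>B\<^esub> x \<oplus>\<^bsub>B\<^esub> d \<odot>\<^bsub>B\<^esub> x"
      using H(3)[of "g x" "g x"] H(1)[of "c \<odot>\<^bsub>A\<^esub> g x" "d \<odot>\<^bsub>A\<^esub> g x"] x' by (simp add: add_scale)
    show "(c * d) \<odot>\<^bsub>B\<^esub> x = c \<odot>\<^bsub>B\<^esub> (d \<odot>\<^bsub>B\<^esub> x)"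
      using H(3)[of "g x" "g x"] H(3)[of "d \<odot>\<^bsub>A\<^esub> g x" "g x" c] x' by (simp add: scale_scale)
    assume y: "y \<in> carrier B"
    then have y': "g y \<in> carrier A" "h (g y) = y" by (simp_all add: g)
    note xy = H(1,2)[OF x'(1) y'(1), unfolded x'(2) y'(2)]
    show "x \<oplus>\<^bsub>B\<^esub> y \<in> carrier B" "x \<otimes>\<^bsub>B\<^esub> y \<in> carrier B"
      using xy H(5)[of "g x \<oplus>\<^bsub>A\<^esub> g y"] H(5)[of "g x \<otimes>\<^bsub>A\<^esub> g y"] x'(1) y'(1) by (simp_all add: mult_closed)
    show "x \<oplus>\<^bsub>B\<^esub> y = y \<oplus>\<^bsub>B\<^esub> x"
      using xy H(1)[OF y'(1) x'(1)] x' y' by (simp add: a_comm)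
    note cx = H(3)[OF x'(1) x'(1), unfolded x'(2), of c]
    note cy = H(3)[OF y'(1) y'(1), unfolded y'(2), of c]
    show "c \<odot>\<^bsub>B\<^esub> (x \<oplus>\<^bsub>B\<^esub> y) = c \<odot>\<^bsub>B\<^esub> x \<oplus>\<^bsub>B\<^esub> c \<odot>\<^bsub>B\<^esub> y"
      unfolding xy cx cy
      using H(3)[of "g x \<oplus>\<^bsub>A\<^esub> g y" "g x" c] H(1)[of "c \<odot>\<^bsub>A\<^esub> g x" "c \<odot>\<^bsub>A\<^esub> g y"] x'(1) y'(1) by (simp add: scale_add)
    show "(c \<odot>\<^bsub>B\<^esub> x) \<otimes>\<^bsub>B\<^esub> y = c \<odot>\<^bsub>B\<^esub> (x \<otimes>\<^bsub>B\<^esub> y)"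
      using xy cx H(3)[of "g x \<otimes>\<^bsub>A\<^esub> g y" "g x" c] H(2)[of "c \<odot>\<^bsub>A\<^esub> g x" "g y"] x'(1) y'
      by (simp add: mult_smult_left mult_closed)
    show "x \<otimes>\<^bsub>B\<^esub> (c \<odot>\<^bsub>B\<^esub> y) = c \<odot>\<^bsub>B\<^esub> (x \<otimes>\<^bsub>B\<^esub> y)"
      using xy cy H(3)[of "g x \<otimes>\<^bsub>A\<^esub> g y" "g x" c] H(2)[of "g x" "c \<odot>\<^bsub>A\<^esub> g y"] x' y'
      by (simp add: mult_smult_right mult_closed)
    assume z: "z \<in> carrier B"
    then have z': "g z \<in> carrier A" "h (g z) = z" by (simp_all add: g)
    note yz = H(1,2)[OF y'(1) z'(1), unfolded y'(2) z'(2)]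
    note xz = H(1,2)[OF x'(1) z'(1), unfolded x'(2) z'(2)]
    show "x \<oplus>\<^bsub>B\<^esub> y \<oplus>\<^bsub>B\<^esub> z = x \<oplus>\<^bsub>B\<^esub> (y \<oplus>\<^bsub>B\<^esub> z)"
      using xy yz H(1)[of "g x \<oplus>\<^bsub>A\<^esub> g y" "g z"] H(1)[of "g x" "g y \<oplus>\<^bsub>A\<^esub> g z"] x' y' z' by (simp add: a_assoc)
    show "(x \<oplus>\<^bsub>B\<^esub> y) \<otimes>\<^bsub>B\<^esub> z = x \<otimes>\<^bsub>B\<^esub> z \<oplus>\<^bsub>B\<^esub> y \<otimes>\<^bsub>B\<^esub> z"
      using xy yz xz H(2)[of "g x \<oplus>\<^bsub>A\<^esub> g y" "g z"] H(1)[of "g x \<otimes>\<^bsub>A\<^esub> g z" "g y \<otimes>\<^bsub>A\<^esub> g z"] x' y' z'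
      by (simp add: mult_add_left mult_closed)
    show "x \<otimes>\<^bsub>B\<^esub> (y \<oplus>\<^bsub>B\<^esub> z) = x \<otimes>\<^bsub>B\<^esub> y \<oplus>\<^bsub>B\<^esub> x \<otimes>\<^bsub>B\<^esub> z"
      using xy yz xz H(2)[of "g x" "g y \<oplus>\<^bsub>A\<^esub> g z"] H(1)[of "g x \<otimes>\<^bsub>A\<^esub> g y" "g x \<otimes>\<^bsub>A\<^esub> g z"] x' y' z'
      by (simp add: mult_add_right mult_closed)
  qed
qed

lemma algebra_hom_npoly_value:
  assumes A: "nonassoc_algebra A" and B: "nonassoc_algebra B" and h: "algebra_hom A B h"
    and a: "\<And>v. a v \<in> carrier A"
  shows "h (npoly_value A a f) = npoly_value B (\<lambda>v. h (a v)) f"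
proof -
  interpret A: nonassoc_algebra A by fact
  interpret B: nonassoc_algebra B by fact
  have ha: "h (a v) \<in> carrier B" for v
    using h a by (auto simp: algebra_hom_def)
  have w: "h (word_value A a w) = word_value B (\<lambda>v. h (a v)) w" for w
    by (induction w) (use h A.word_value_closed[of _ a] a in \<open>auto simp: algebra_hom_def\<close>)
  show ?thesis
    by (induction f rule: poly_mapping_single_induct)
      (use h w A.word_value_closed[of _ a] A.npoly_value_closed[of a] a ha in
        \<open>auto simp: algebra_hom_def A.npoly_value_single B.npoly_value_single A.npoly_value_add B.npoly_value_add\<close>)
qed


section \<open>Superalgebras and their Grassmann envelopes\<close>

lemma superalgebraI:
  fixes A :: "('f::field, 'a) superalg" (structure)
  assumes A: "nonassoc_algebra A"
    and sub: "\<And>i. part A i \<subseteq> carrier A" "\<And>i. \<zero> \<in> part A i"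
      "\<And>i x y. \<lbrakk>x \<in> part A i; y \<in> part A i\<rbrakk> \<Longrightarrow> x \<oplus> y \<in> part A i"
      "\<And>i c x. x \<in> part A i \<Longrightarrow> c \<odot> x \<in> part A i"
    and decomp: "\<And>x. x \<in> carrier A \<Longrightarrow> \<exists>y\<in>part A 0. \<exists>z\<in>part A 1. x = y \<oplus> z"
    and direct: "\<And>x. \<lbrakk>x \<in> part A 0; x \<in> part A 1\<rbrakk> \<Longrightarrow> x = \<zero>"
    and mult: "\<And>i j x y. \<lbrakk>x \<in> part A i; y \<in> part A j\<rbrakk> \<Longrightarrow> x \<otimes> y \<in> part A (i + j)"
  shows "superalgebra A"
proof -
  interpret nonassoc_algebra A by fact
  have "submodule (part A i) (scalars :: 'f ring) A" for i
  proof (rule submoduleI)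
    show "\<ominus> x \<in> part A i" if "x \<in> part A i" for x
      using sub(4)[OF that, of "- 1"] subsetD[OF sub(1) that] by (simp add: minus_one_scale)
  qed (use sub in auto)
  moreover have "part A 0 <+>\<^bsub>A\<^esub> part A 1 = carrier A"
  proof
    show "part A 0 <+>\<^bsub>A\<^esub> part A 1 \<subseteq> carrier A"
      using subsetD[OF sub(1)] by (auto simp: set_add_def')
    show "carrier A \<subseteq> part A 0 <+>\<^bsub>A\<^esub> part A 1"
    proof
      fix x assume "x \<in> carrier A"
      from decomp[OF this] obtain y z where "y \<in> part A 0" "z \<in> part A 1" "x = y \<oplus> z" by blast
      then show "x \<in> part A 0 <+>\<^bsub>A\<^esub> part A 1" by (auto simp: set_add_def')
    qed
  qed
  moreover have "part A 0 \<inter> part A 1 = {\<zero>}"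
    using sub(2)[of 0] sub(2)[of 1] direct by blast
  ultimately show ?thesis
    by (intro superalgebra.intro A superalgebra_axioms.intro mult)
qed

context superalgebra
begin

lemma part_carrier: "x \<in> part A i \<Longrightarrow> x \<in> carrier A"
  using submoduleE(1)[OF part_submodule] by blast

lemma part_add: "\<lbrakk>x \<in> part A i; y \<in> part A i\<rbrakk> \<Longrightarrow> x \<oplus> y \<in> part A i"
  using submoduleE(5)[OF part_submodule] by blast

lemma part_scale: "x \<in> part A i \<Longrightarrow> c \<odot> x \<in> part A i"
  using submoduleE(4)[OF part_submodule] by simp

lemma part_zero [simp, intro]: "\<zero> \<in> part A i"
proof -
  obtain x where "x \<in> part A i" using submoduleE(2)[OF part_submodule] by blast
  then show ?thesis using part_scale[of x i 0] part_carrier by simp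
qed

lemma part_finsum: "\<lbrakk>finite X; \<And>j. j \<in> X \<Longrightarrow> f j \<in> part A i\<rbrakk> \<Longrightarrow> (\<Oplus>j\<in>X. f j) \<in> part A i"
proof (induction X rule: finite_induct)
  case (insert j X)
  then have "f j \<in> part A i" "(\<Oplus>j\<in>X. f j) \<in> part A i" by auto
  moreover have "f \<in> X \<rightarrow> carrier A" "f j \<in> carrier A" using insert part_carrier by auto
  ultimately show ?case using insert(1,2) by (simp add: part_add)
qed simp

lemma decompose:
  assumes "x \<in> carrier A"
  obtains y z where "y \<in> part A 0" "z \<in> part A 1" "x = y \<oplus> z"
proof -
  have "x \<in> part A 0 <+>\<^bsub>A\<^esub> part A 1" using part_sum assms by simp
  then show thesis using that by (auto simp: set_add_def')
qed

lemma direct: "\<lbrakk>x \<in> part A 0; x \<in> part A 1\<rbrakk> \<Longrightarrow> x = \<zero>"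
  using part_direct by blast

end

subsection \<open>Signs\<close>

text \<open>The product form makes the sign multiplicative in disjoint unions, which is how it is used everywhere.\<close>

lemma grassmann_sign_prod:
  assumes "finite S" "finite T"
  shows "grassmann_sign S T = (\<Prod>i\<in>S. \<Prod>j\<in>T. if j < i then - 1 else (1 :: 'f::field))"
proof -
  have "(\<Prod>i\<in>S. \<Prod>j\<in>T. if j < i then - 1 else (1 :: 'f)) = (\<Prod>(i, j)\<in>S \<times> T. if j < i then - 1 else 1)"
    by (simp add: prod.cartesian_product)
  also have "\<dots> = (\<Prod>(i, j)\<in>{(i, j). i \<in> S \<and> j \<in> T \<and> j < i}. - 1)"
    by (rule prod.mono_neutral_cong_right) (use assms in \<open>auto split: if_splits\<close>)
  also have "\<dots> = grassmann_sign S T"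
    by (simp add: grassmann_sign_def)
  finally show ?thesis by simp
qed

lemma grassmann_sign_empty [simp]: "grassmann_sign {} T = 1" "grassmann_sign S {} = 1"
  by (simp_all add: grassmann_sign_def)

lemma grassmann_sign_union_left:
  "\<lbrakk>finite S; finite S'; finite T; S \<inter> S' = {}\<rbrakk>
    \<Longrightarrow> grassmann_sign (S \<union> S') T = grassmann_sign S T * grassmann_sign S' T"
  by (simp add: grassmann_sign_prod prod.union_disjoint)

lemma grassmann_sign_union_right:
  "\<lbrakk>finite S; finite T; finite T'; T \<inter> T' = {}\<rbrakk>
    \<Longrightarrow> grassmann_sign S (T \<union> T') = grassmann_sign S T * grassmann_sign S T'"
  by (simp add: grassmann_sign_prod prod.union_disjoint prod.distrib)

lemma grassmann_sign_swap:
  assumes "finite S" "finite T" "S \<inter> T = {}"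
  shows "grassmann_sign S T = (- 1) ^ (card S * card T) * (grassmann_sign T S :: 'f::field)"
proof -
  have "(- 1) ^ (card S * card T) = (\<Prod>i\<in>S. \<Prod>j\<in>T. - 1 :: 'f)"
    by (simp add: power_mult[symmetric] mult.commute)
  moreover have "grassmann_sign T S = (\<Prod>i\<in>S. \<Prod>j\<in>T. if i < j then - 1 else (1 :: 'f))"
    using assms(1,2) by (simp add: grassmann_sign_prod) (rule prod.swap)
  ultimately have "(- 1) ^ (card S * card T) * grassmann_sign T S
      = (\<Prod>i\<in>S. \<Prod>j\<in>T. (- 1) * (if i < j then - 1 else (1 :: 'f)))"
    by (simp only: prod.distrib)
  also have "\<dots> = grassmann_sign S T"
    using assms by (auto simp: grassmann_sign_prod intro!: prod.cong)
  finally show ?thesis by simp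
qed

lemma grassmann_sign_nonzero [simp]: "grassmann_sign S T \<noteq> 0"
  by (simp add: grassmann_sign_def)

subsection \<open>The envelope\<close>

text \<open>The elementary tensor \<open>e\<^sub>S \<otimes> a\<close>.\<close>

definition homog :: "('f, 'a, 'm) module_scheme \<Rightarrow> nat set \<Rightarrow> 'a \<Rightarrow> nat set \<Rightarrow> 'a" where
  "homog A S a = (\<lambda>U. if U = S then a else \<zero>\<^bsub>A\<^esub>)"

lemma envelope_simps [simp]:
  "zero (grassmann_envelope A) = (\<lambda>S. \<zero>\<^bsub>A\<^esub>)"
  "add (grassmann_envelope A) = (\<lambda>x y S. x S \<oplus>\<^bsub>A\<^esub> y S)"
  "smult (grassmann_envelope A) = (\<lambda>c x S. c \<odot>\<^bsub>A\<^esub> x S)"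
  by (simp_all add: grassmann_envelope_def)

lemma envelope_mult:
  "(x \<otimes>\<^bsub>grassmann_envelope A\<^esub> y) U = (if finite U
     then \<Oplus>\<^bsub>A\<^esub>S\<in>Pow U. grassmann_sign S (U - S) \<odot>\<^bsub>A\<^esub> (x S \<otimes>\<^bsub>A\<^esub> y (U - S)) else \<zero>\<^bsub>A\<^esub>)"
  by (simp add: grassmann_envelope_def)

lemma carrier_envelope:
  "x \<in> carrier (grassmann_envelope A) \<longleftrightarrow>
     (\<forall>S. finite S \<longrightarrow> x S \<in> part A (of_nat (card S))) \<and>
     (\<forall>S. infinite S \<longrightarrow> x S = \<zero>\<^bsub>A\<^esub>) \<and> finite {S. x S \<noteq> \<zero>\<^bsub>A\<^esub>}"
  by (simp add: grassmann_envelope_def)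

context superalgebra
begin

abbreviation "GA \<equiv> grassmann_envelope A"

lemma envelope_coeff: "x \<in> carrier GA \<Longrightarrow> x S \<in> carrier A"
  using part_carrier[of "x S"] by (cases "finite S") (auto simp: carrier_envelope)

lemma envelope_mult_closed:
  assumes x: "x \<in> carrier GA" and y: "y \<in> carrier GA"
  shows "x \<otimes>\<^bsub>GA\<^esub> y \<in> carrier GA"
  unfolding carrier_envelope
proof (intro conjI allI impI)
  fix U :: "nat set" assume U: "finite U"
  have "x S \<otimes> y (U - S) \<in> part A (of_nat (card U))" if "S \<subseteq> U" for S
  proof -
    have fin: "finite S" "finite (U - S)" using U that finite_subset by auto
    have "card U = card S + card (U - S)"
      using U that by (metis card_Un_disjoint fin Diff_disjoint Un_Diff_cancel sup.absorb2)
    then show ?thesis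
      using part_mult[of "x S" "of_nat (card S)" "y (U - S)" "of_nat (card (U - S))"] x y fin
      by (simp add: carrier_envelope)
  qed
  then show "(x \<otimes>\<^bsub>GA\<^esub> y) U \<in> part A (of_nat (card U))"
    using U by (auto simp: envelope_mult intro!: part_finsum part_scale)
next
  show "(x \<otimes>\<^bsub>GA\<^esub> y) U = \<zero>" if "infinite U" for U
    using that by (simp add: envelope_mult)
next
  have "{U. (x \<otimes>\<^bsub>GA\<^esub> y) U \<noteq> \<zero>} \<subseteq> (\<lambda>(S, T). S \<union> T) ` ({S. x S \<noteq> \<zero>} \<times> {S. y S \<noteq> \<zero>})"
  proof
    fix U assume "U \<in> {U. (x \<otimes>\<^bsub>GA\<^esub> y) U \<noteq> \<zero>}"
    then have U: "(x \<otimes>\<^bsub>GA\<^esub> y) U \<noteq> \<zero>" by simp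
    have "\<exists>S\<in>Pow U. x S \<noteq> \<zero> \<and> y (U - S) \<noteq> \<zero>"
    proof (rule ccontr)
      assume "\<not> ?thesis"
      then have "grassmann_sign S (U - S) \<odot> (x S \<otimes> y (U - S)) = \<zero>" if "S \<in> Pow U" for S
        using that envelope_coeff[OF x, of S] envelope_coeff[OF y, of "U - S"] by (metis mult_zero_left mult_zero_right scale_zero)
      then have "(\<Oplus>S\<in>Pow U. grassmann_sign S (U - S) \<odot> (x S \<otimes> y (U - S))) = \<zero>"
        by (rule finsum_neutral)
      then show False
        using U by (simp add: envelope_mult split: if_splits)
    qed
    then obtain S where "S \<subseteq> U" "x S \<noteq> \<zero>" "y (U - S) \<noteq> \<zero>" by blast
    then show "U \<in> (\<lambda>(S, T). S \<union> T) ` ({S. x S \<noteq> \<zero>} \<times> {S. y S \<noteq> \<zero>})"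
      by (intro image_eqI[of _ _ "(S, U - S)"]) auto
  qed
  then show "finite {U. (x \<otimes>\<^bsub>GA\<^esub> y) U \<noteq> \<zero>}"
    by (rule finite_subset) (use x y in \<open>auto simp: carrier_envelope\<close>)
qed

lemma envelope_algebra: "nonassoc_algebra GA"
proof (rule nonassoc_algebraI)
  note c = envelope_coeff
  fix x y z c d
  show "\<zero>\<^bsub>GA\<^esub> \<in> carrier GA" by (simp add: carrier_envelope)
  assume x: "x \<in> carrier GA"
  show "\<zero>\<^bsub>GA\<^esub> \<oplus>\<^bsub>GA\<^esub> x = x" "(- 1) \<odot>\<^bsub>GA\<^esub> x \<oplus>\<^bsub>GA\<^esub> x = \<zero>\<^bsub>GA\<^esub>" "1 \<odot>\<^bsub>GA\<^esub> x = x"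
    "(c + d) \<odot>\<^bsub>GA\<^esub> x = c \<odot>\<^bsub>GA\<^esub> x \<oplus>\<^bsub>GA\<^esub> d \<odot>\<^bsub>GA\<^esub> x" "(c * d) \<odot>\<^bsub>GA\<^esub> x = c \<odot>\<^bsub>GA\<^esub> (d \<odot>\<^bsub>GA\<^esub> x)"
    by (simp_all add: c[OF x] minus_one_scale l_neg add_scale scale_scale)
  have "finite {S. c \<odot> x S \<noteq> \<zero>}"
    by (rule finite_subset[of _ "{S. x S \<noteq> \<zero>}"]) (use x in \<open>auto simp: carrier_envelope\<close>)
  then show "c \<odot>\<^bsub>GA\<^esub> x \<in> carrier GA"
    using x by (auto simp: carrier_envelope part_scale)
  assume y: "y \<in> carrier GA"
  have "finite {S. x S \<oplus> y S \<noteq> \<zero>}"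
    by (rule finite_subset[of _ "{S. x S \<noteq> \<zero>} \<union> {S. y S \<noteq> \<zero>}"]) (use x y in \<open>auto simp: carrier_envelope\<close>)
  then show "x \<oplus>\<^bsub>GA\<^esub> y \<in> carrier GA"
    using x y by (auto simp: carrier_envelope part_add)
  show "x \<oplus>\<^bsub>GA\<^esub> y = y \<oplus>\<^bsub>GA\<^esub> x"
    by (simp add: c[OF x] c[OF y] a_comm)
  show "c \<odot>\<^bsub>GA\<^esub> (x \<oplus>\<^bsub>GA\<^esub> y) = c \<odot>\<^bsub>GA\<^esub> x \<oplus>\<^bsub>GA\<^esub> c \<odot>\<^bsub>GA\<^esub> y"
    by (simp add: c[OF x] c[OF y] scale_add)
  show "x \<otimes>\<^bsub>GA\<^esub> y \<in> carrier GA"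
    using x y by (rule envelope_mult_closed)
  show "(c \<odot>\<^bsub>GA\<^esub> x) \<otimes>\<^bsub>GA\<^esub> y = c \<odot>\<^bsub>GA\<^esub> (x \<otimes>\<^bsub>GA\<^esub> y)"
  proof
    fix U
    have "(\<Oplus>S\<in>Pow U. grassmann_sign S (U - S) \<odot> ((c \<odot> x S) \<otimes> y (U - S))) =
      (\<Oplus>S\<in>Pow U. c \<odot> (grassmann_sign S (U - S) \<odot> (x S \<otimes> y (U - S))))"
      by (rule finsum_cong') (auto simp: c[OF x] c[OF y] mult_closed mult_smult_left scale_scale mult.commute)
    also have "\<dots> = c \<odot> (\<Oplus>S\<in>Pow U. grassmann_sign S (U - S) \<odot> (x S \<otimes> y (U - S)))" if "finite U"
      using that by (intro finsum_scale[symmetric]) (auto simp: c[OF x] c[OF y] mult_closed)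
    finally show "((c \<odot>\<^bsub>GA\<^esub> x) \<otimes>\<^bsub>GA\<^esub> y) U = (c \<odot>\<^bsub>GA\<^esub> (x \<otimes>\<^bsub>GA\<^esub> y)) U"
      by (simp add: envelope_mult)
  qed
  show "x \<otimes>\<^bsub>GA\<^esub> (c \<odot>\<^bsub>GA\<^esub> y) = c \<odot>\<^bsub>GA\<^esub> (x \<otimes>\<^bsub>GA\<^esub> y)"
  proof
    fix U
    have "(\<Oplus>S\<in>Pow U. grassmann_sign S (U - S) \<odot> (x S \<otimes> (c \<odot> y (U - S)))) =
      (\<Oplus>S\<in>Pow U. c \<odot> (grassmann_sign S (U - S) \<odot> (x S \<otimes> y (U - S))))"
      by (rule finsum_cong') (auto simp: c[OF x] c[OF y] mult_closed mult_smult_right scale_scale mult.commute)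
    also have "\<dots> = c \<odot> (\<Oplus>S\<in>Pow U. grassmann_sign S (U - S) \<odot> (x S \<otimes> y (U - S)))" if "finite U"
      using that by (intro finsum_scale[symmetric]) (auto simp: c[OF x] c[OF y] mult_closed)
    finally show "(x \<otimes>\<^bsub>GA\<^esub> (c \<odot>\<^bsub>GA\<^esub> y)) U = (c \<odot>\<^bsub>GA\<^esub> (x \<otimes>\<^bsub>GA\<^esub> y)) U"
      by (simp add: envelope_mult)
  qed
  assume z: "z \<in> carrier GA"
  show "x \<oplus>\<^bsub>GA\<^esub> y \<oplus>\<^bsub>GA\<^esub> z = x \<oplus>\<^bsub>GA\<^esub> (y \<oplus>\<^bsub>GA\<^esub> z)"
    by (simp add: c[OF x] c[OF y] c[OF z] a_assoc)
  show "(x \<oplus>\<^bsub>GA\<^esub> y) \<otimes>\<^bsub>GA\<^esub> z = x \<otimes>\<^bsub>GA\<^esub> z \<oplus>\<^bsub>GA\<^esub> y \<otimes>\<^bsub>GA\<^esub> z"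
  proof
    fix U
    have "(\<Oplus>S\<in>Pow U. grassmann_sign S (U - S) \<odot> ((x S \<oplus> y S) \<otimes> z (U - S))) =
      (\<Oplus>S\<in>Pow U. grassmann_sign S (U - S) \<odot> (x S \<otimes> z (U - S)) \<oplus> grassmann_sign S (U - S) \<odot> (y S \<otimes> z (U - S)))"
      by (rule finsum_cong') (auto simp: c[OF x] c[OF y] c[OF z] mult_add_left mult_closed scale_add)
    then show "((x \<oplus>\<^bsub>GA\<^esub> y) \<otimes>\<^bsub>GA\<^esub> z) U = (x \<otimes>\<^bsub>GA\<^esub> z \<oplus>\<^bsub>GA\<^esub> y \<otimes>\<^bsub>GA\<^esub> z) U"
      by (auto simp: envelope_mult finsum_addf c[OF x] c[OF y] c[OF z] mult_closed Pi_def)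
  qed
  show "x \<otimes>\<^bsub>GA\<^esub> (y \<oplus>\<^bsub>GA\<^esub> z) = x \<otimes>\<^bsub>GA\<^esub> y \<oplus>\<^bsub>GA\<^esub> x \<otimes>\<^bsub>GA\<^esub> z"
  proof
    fix U
    have "(\<Oplus>S\<in>Pow U. grassmann_sign S (U - S) \<odot> (x S \<otimes> (y (U - S) \<oplus> z (U - S)))) =
      (\<Oplus>S\<in>Pow U. grassmann_sign S (U - S) \<odot> (x S \<otimes> y (U - S)) \<oplus> grassmann_sign S (U - S) \<odot> (x S \<otimes> z (U - S)))"
      by (rule finsum_cong') (auto simp: c[OF x] c[OF y] c[OF z] mult_add_right mult_closed scale_add)
    then show "(x \<otimes>\<^bsub>GA\<^esub> (y \<oplus>\<^bsub>GA\<^esub> z)) U = (x \<otimes>\<^bsub>GA\<^esub> y \<oplus>\<^bsub>GA\<^esub> x \<otimes>\<^bsub>GA\<^esub> z) U"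
      by (auto simp: envelope_mult finsum_addf c[OF x] c[OF y] c[OF z] mult_closed Pi_def)
  qed
qed

lemma homog_closed: "\<lbrakk>finite S; a \<in> part A (of_nat (card S))\<rbrakk> \<Longrightarrow> homog A S a \<in> carrier GA"
  by (auto simp: carrier_envelope homog_def intro: finite_subset[of _ "{S}"])

lemma homog_add: "\<lbrakk>a \<in> carrier A; b \<in> carrier A\<rbrakk> \<Longrightarrow> homog A S (a \<oplus> b) = homog A S a \<oplus>\<^bsub>GA\<^esub> homog A S b"
  by (auto simp: homog_def)

lemma homog_scale: "a \<in> carrier A \<Longrightarrow> homog A S (c \<odot> a) = c \<odot>\<^bsub>GA\<^esub> homog A S a"
  by (auto simp: homog_def)

lemma homog_zero [simp]: "homog A S \<zero> = \<zero>\<^bsub>GA\<^esub>"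
  by (auto simp: homog_def)

text \<open>In the convolution that defines the product only the summand indexed by \<open>S\<close> survives, and this one only at
\<open>U = S \<union> T\<close>.\<close>

lemma homog_mult:
  assumes "finite S" "finite T" and a: "a \<in> carrier A" and b: "b \<in> carrier A"
  shows "homog A S a \<otimes>\<^bsub>GA\<^esub> homog A T b =
    (if S \<inter> T = {} then homog A (S \<union> T) (grassmann_sign S T \<odot> (a \<otimes> b)) else \<zero>\<^bsub>GA\<^esub>)"
proof
  fix U
  let ?t = "\<lambda>V. grassmann_sign V (U - V) \<odot> (homog A S a V \<otimes> homog A T b (U - V))"
  have closed: "?t V \<in> carrier A" for V
    using a b by (simp add: homog_def mult_closed)
  have vanish: "?t V = \<zero>" if "V \<noteq> S \<or> U - S \<noteq> T" for V
  proof (cases "V = S")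
    case True
    then have "homog A T b (U - V) = \<zero>" using that by (simp add: homog_def)
    then show ?thesis using a by (simp add: homog_def)
  next
    case False
    then have "homog A S a V = \<zero>" by (simp add: homog_def)
    then show ?thesis using b by (simp add: homog_def)
  qed
  show "(homog A S a \<otimes>\<^bsub>GA\<^esub> homog A T b) U =
    (if S \<inter> T = {} then homog A (S \<union> T) (grassmann_sign S T \<odot> (a \<otimes> b)) else \<zero>\<^bsub>GA\<^esub>) U"
  proof (cases "S \<inter> T = {} \<and> U = S \<union> T")
    case True
    then have U: "U - S = T" "S \<in> Pow U" "finite U" using assms by auto
    then have "(\<Oplus>V\<in>Pow U. ?t V) = ?t S"
      by (intro finsum_one closed vanish) auto
    then have "(homog A S a \<otimes>\<^bsub>GA\<^esub> homog A T b) U = ?t S"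
      using U(3) by (simp only: envelope_mult if_True)
    also have "?t S = (if S \<inter> T = {} then homog A (S \<union> T) (grassmann_sign S T \<odot> (a \<otimes> b)) else \<zero>\<^bsub>GA\<^esub>) U"
      using True U(1) by (simp add: homog_def)
    finally show ?thesis .
  next
    case False
    have "(\<Oplus>V\<in>Pow U. ?t V) = \<zero>"
    proof (rule finsum_neutral)
      fix V assume "V \<in> Pow U"
      then have "V \<noteq> S \<or> U - S \<noteq> T" using False by (cases "V = S") (simp_all, blast)
      then show "?t V = \<zero>" by (rule vanish)
    qed
    then have "(homog A S a \<otimes>\<^bsub>GA\<^esub> homog A T b) U = \<zero>"
      by (simp only: envelope_mult if_cancel)
    then show ?thesis
      using False by (auto simp: homog_def)
  qed
qed

end


section \<open>Multilinear polynomials on Grassmann envelopes\<close>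

lemma of_nat_bit_eq_one: "(of_nat n :: bit) = 1 \<longleftrightarrow> odd n"
  by (induction n) auto

lemma bit_cases: "(x :: bit) = 0 \<or> x = 1"
  by (cases x) auto

text \<open>The product of \<open>g u v\<close> over all pairs of entries with \<open>u\<close> before \<open>v\<close>: the shape shared by Koszul signs and by
signs of products of Grassmann words.\<close>

fun pair_prod :: "('v \<Rightarrow> 'v \<Rightarrow> 'f::comm_monoid_mult) \<Rightarrow> 'v list \<Rightarrow> 'f" where
  "pair_prod g [] = 1"
| "pair_prod g (v # vs) = (\<Prod>u\<leftarrow>vs. g v u) * pair_prod g vs"

lemma pair_prod_append:
  "pair_prod g (us @ vs) = pair_prod g us * pair_prod g vs * (\<Prod>u\<leftarrow>us. \<Prod>v\<leftarrow>vs. g u v)"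
  by (induction us) (simp_all add: mult_ac)

lemma prod_list_mult:
  "(\<Prod>u\<leftarrow>us. g u * h u) = (\<Prod>u\<leftarrow>us. g u) * (\<Prod>u\<leftarrow>us. h u :: 'f::comm_monoid_mult)"
  by (induction us) (simp_all add: mult_ac)

lemma prod_indices_conv_pair_prod:
  "(\<Prod>(k, l)\<in>{(k, l). k < l \<and> l < length vs}. g (vs ! k) (vs ! l)) = pair_prod g vs"
proof (induction vs)
  case (Cons v vs)
  let ?P = "\<lambda>vs. {(k, l). k < l \<and> l < length vs}"
  have fin: "finite (?P ws)" for ws
    by (rule finite_subset[of _ "{..<length ws} \<times> {..<length ws}"]) auto
  have fin': "finite ((\<lambda>(k, l). (Suc k, Suc l)) ` ?P vs)" by (rule finite_imageI, rule fin)
  have split: "?P (v # vs) = (\<lambda>l. (0, Suc l)) ` {..<length vs} \<union> (\<lambda>(k, l). (Suc k, Suc l)) ` ?P vs"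
  proof (intro subset_antisym subsetI)
    fix x assume "x \<in> ?P (v # vs)"
    then obtain k l where x: "x = (k, l)" "k < l" "l < Suc (length vs)" by auto
    then obtain l' where l: "l = Suc l'" by (cases l) auto
    show "x \<in> (\<lambda>l. (0, Suc l)) ` {..<length vs} \<union> (\<lambda>(k, l). (Suc k, Suc l)) ` ?P vs"
      using x l by (cases k) auto
  qed auto
  have "(\<Prod>(k, l)\<in>?P (v # vs). g ((v # vs) ! k) ((v # vs) ! l)) =
    (\<Prod>l<length vs. g v (vs ! l)) * (\<Prod>(k, l)\<in>?P vs. g (vs ! k) (vs ! l))"
    unfolding split
    using fin' by (subst prod.union_disjoint)
      (auto simp: prod.reindex inj_on_def case_prod_unfold)
  also have "(\<Prod>l<length vs. g v (vs ! l)) = (\<Prod>u\<leftarrow>vs. g v u)"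
    using prod.list_conv_set_nth[of "map (g v) vs"] by (simp add: atLeast0LessThan)
  finally show ?case
    using Cons by simp
qed simp

lemma koszul_sign_conv_pair_prod:
  "koszul_sign p vs = pair_prod (\<lambda>u v. if v < u \<and> p u * p v = 1 then - 1 else 1) vs"
proof -
  have "finite {(k, l). k < l \<and> l < length vs}"
    by (rule finite_subset[of _ "{..<length vs} \<times> {..<length vs}"]) auto
  then show ?thesis
    unfolding koszul_sign_def prod_indices_conv_pair_prod[symmetric]
    by (intro prod.mono_neutral_cong_left) (auto split: if_splits)
qed

text \<open>Hence superization does not change which words occur.\<close>

lemma koszul_sign_nonzero: "koszul_sign p vs \<noteq> (0 :: 'f::field)"
proof -
  have "pair_prod (\<lambda>u v. if v < u \<and> p u * p v = 1 then - 1 else (1 :: 'f)) vs \<noteq> 0"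
    by (induction vs) (auto simp: prod_list_zero_iff)
  then show ?thesis by (simp add: koszul_sign_conv_pair_prod)
qed

text \<open>Sorting a list multiplies \<open>pair_prod g\<close> by one factor for each inverted pair, and these factors make up the
Koszul sign. The other factor depends on the set of entries only, so it is common to all words of a
multilinear polynomial.\<close>

lemma pair_prod_reorder:
  fixes g :: "nat \<Rightarrow> nat \<Rightarrow> 'f::field"
  assumes "distinct vs"
    and "\<And>u v. \<lbrakk>u \<in> set vs; v \<in> set vs; u < v\<rbrakk> \<Longrightarrow> g v u = (if p u * p v = 1 then - 1 else 1) * g u v"
  shows "pair_prod g vs = koszul_sign p vs * (\<Prod>v\<in>set vs. \<Prod>u\<in>{u\<in>set vs. u < v}. g u v)"
  using assms
proof (induction vs)
  case (Cons v vs)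
  let ?k = "\<lambda>u v. if v < u \<and> p u * p v = 1 then - 1 else (1 :: 'f)"
  let ?h = "\<lambda>u. if u < v then g u v else g v u"
  have v: "v \<notin> set vs" "distinct vs" using Cons.prems by auto
  have "(\<Prod>u\<leftarrow>vs. g v u) = (\<Prod>u\<leftarrow>vs. ?k v u * ?h u)"
  proof (rule arg_cong[where f = prod_list], rule map_cong[OF refl])
    fix u assume "u \<in> set vs"
    then show "g v u = ?k v u * ?h u"
      using v(1) Cons.prems(2)[of u v] by (auto simp: mult.commute)
  qed
  also have "\<dots> = (\<Prod>u\<leftarrow>vs. ?k v u) * (\<Prod>u\<in>set vs. ?h u)"
    using v(2) by (simp add: prod.distinct_set_conv_list prod_list_mult)
  finally have 1: "(\<Prod>u\<leftarrow>vs. g v u) = (\<Prod>u\<leftarrow>vs. ?k v u) * (\<Prod>u\<in>set vs. ?h u)" .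
  have "(\<Prod>u\<in>set vs. ?h u) = (\<Prod>u\<in>{u\<in>set vs. u < v}. g u v) * (\<Prod>u\<in>{u\<in>set vs. v < u}. g v u)"
  proof -
    have "u < v \<or> v < u" if "u \<in> set vs" for u using v(1) that by (metis linorder_neqE_nat)
    then have "set vs = {u\<in>set vs. u < v} \<union> {u\<in>set vs. v < u}" by blast
    then have "(\<Prod>u\<in>set vs. ?h u) = (\<Prod>u\<in>{u\<in>set vs. u < v} \<union> {u\<in>set vs. v < u}. ?h u)" by simp
    also have "\<dots> = (\<Prod>u\<in>{u\<in>set vs. u < v}. ?h u) * (\<Prod>u\<in>{u\<in>set vs. v < u}. ?h u)"
      by (rule prod.union_disjoint) auto
    finally show ?thesis by auto
  qed
  moreover have "(\<Prod>w\<in>set (v # vs). \<Prod>u\<in>{u\<in>set (v # vs). u < w}. g u w) =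
     (\<Prod>u\<in>{u\<in>set vs. u < v}. g u v) * (\<Prod>w\<in>set vs. (if v < w then g v w else 1) * (\<Prod>u\<in>{u\<in>set vs. u < w}. g u w))"
  proof -
    have "{u \<in> set (v # vs). u < w} = (if v < w then insert v {u\<in>set vs. u < w} else {u\<in>set vs. u < w})" for w
      by auto
    then show ?thesis
      using v(1) by (auto intro!: prod.cong)
  qed
  moreover have "(\<Prod>w\<in>set vs. if v < w then g v w else 1) = (\<Prod>u\<in>{u\<in>set vs. v < u}. g v u)"
    by (rule prod.mono_neutral_cong_right) auto
  moreover have "pair_prod g vs = koszul_sign p vs * (\<Prod>v\<in>set vs. \<Prod>u\<in>{u\<in>set vs. u < v}. g u v)"
    using Cons v by auto
  ultimately show ?case
    using 1 by (simp add: koszul_sign_conv_pair_prod prod.distrib mult_ac)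
qed (simp add: koszul_sign_def)

lemma grassmann_sign_lists:
  assumes S: "\<And>v. finite (S v)"
    and us: "sorted_wrt (\<lambda>u v. S u \<inter> S v = {}) us" and vs: "sorted_wrt (\<lambda>u v. S u \<inter> S v = {}) vs"
  shows "grassmann_sign (\<Union>u\<in>set us. S u) (\<Union>v\<in>set vs. S v) = (\<Prod>u\<leftarrow>us. \<Prod>v\<leftarrow>vs. grassmann_sign (S u) (S v) :: 'f::field)"
  using us
proof (induction us)
  case (Cons u us)
  have "grassmann_sign (S u) (\<Union>v\<in>set vs. S v) = (\<Prod>v\<leftarrow>vs. grassmann_sign (S u) (S v) :: 'f)"
    using vs
  proof (induction vs)
    case (Cons v vs)
    then have "grassmann_sign (S u) (S v \<union> (\<Union>v\<in>set vs. S v)) =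
        grassmann_sign (S u) (S v) * (grassmann_sign (S u) (\<Union>v\<in>set vs. S v) :: 'f)"
      using S by (intro grassmann_sign_union_right) auto
    with Cons show ?case by simp
  qed simp
  moreover have "grassmann_sign (S u \<union> (\<Union>u\<in>set us. S u)) (\<Union>v\<in>set vs. S v) =
      grassmann_sign (S u) (\<Union>v\<in>set vs. S v) * (grassmann_sign (\<Union>u\<in>set us. S u) (\<Union>v\<in>set vs. S v) :: 'f)"
    using Cons.prems S by (intro grassmann_sign_union_left) auto
  ultimately show ?case using Cons by simp
qed simp

lemma lookup_superization:
  "Poly_Mapping.lookup (superization p f) w = koszul_sign p (letters w) * Poly_Mapping.lookup f w"
  by (simp add: superization_def lookup_mapp when_def in_keys_iff)

lemma keys_superization: "Poly_Mapping.keys (superization p f) = Poly_Mapping.keys f"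
  by (auto simp: in_keys_iff lookup_superization koszul_sign_nonzero)

context superalgebra
begin

text \<open>A word in elementary tensors is the product of the Grassmann words times the word in the superalgebra; the former
vanishes as soon as two of the index sets meet.\<close>

lemma word_value_envelope:
  assumes S: "\<And>v. finite (S v)" and a: "\<And>v. a v \<in> carrier A"
  shows "word_value GA (\<lambda>v. homog A (S v) (a v)) w =
    (if sorted_wrt (\<lambda>u v. S u \<inter> S v = {}) (letters w)
     then homog A (\<Union>v\<in>set (letters w). S v)
       (pair_prod (\<lambda>u v. grassmann_sign (S u) (S v)) (letters w) \<odot> word_value A a w)
     else \<zero>\<^bsub>GA\<^esub>)"
proof (induction w)
  case (Gen v)
  then show ?case using a by simp
next
  case (Times u w)
  let ?d = "sorted_wrt (\<lambda>u v. S u \<inter> S v = {})"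
  let ?U = "\<Union>v\<in>set (letters u). S v" and ?W = "\<Union>v\<in>set (letters w). S v"
  let ?g = "\<lambda>u v. grassmann_sign (S u) (S v) :: 'f"
  have fin: "finite ?U" "finite ?W" using S by auto
  have c: "word_value A a u \<in> carrier A" "word_value A a w \<in> carrier A"
    using a by (auto intro: word_value_closed)
  have homog0: "\<zero>\<^bsub>GA\<^esub> = homog A {} \<zero>" by (simp add: homog_def)
  have z: "homog A T x \<otimes>\<^bsub>GA\<^esub> \<zero>\<^bsub>GA\<^esub> = \<zero>\<^bsub>GA\<^esub>" "\<zero>\<^bsub>GA\<^esub> \<otimes>\<^bsub>GA\<^esub> homog A T x = \<zero>\<^bsub>GA\<^esub>"
    if "finite T" "x \<in> carrier A" for T x
    unfolding homog0 using that by (subst homog_mult; simp)+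
  have z0: "\<zero>\<^bsub>GA\<^esub> \<otimes>\<^bsub>GA\<^esub> \<zero>\<^bsub>GA\<^esub> = \<zero>\<^bsub>GA\<^esub>"
    unfolding homog0 by (subst homog_mult; simp)
  have d: "?d (letters u @ letters w) \<longleftrightarrow> ?d (letters u) \<and> ?d (letters w) \<and> ?U \<inter> ?W = {}"
    by (auto simp: sorted_wrt_append)
  show ?case
  proof (cases "?d (letters u) \<and> ?d (letters w)")
    case True
    then have "grassmann_sign ?U ?W = (\<Prod>u\<leftarrow>letters u. \<Prod>v\<leftarrow>letters w. ?g u v)"
      by (intro grassmann_sign_lists S) auto
    moreover have "?U \<union> ?W = (\<Union>v\<in>set (letters (Times u w)). S v)" by auto
    ultimately show ?thesis
      using True Times d
      by (simp add: homog_mult fin c mult_smult_left mult_smult_right mult_closed scale_scale pair_prod_append mult_ac)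
  next
    case False
    then show ?thesis
      using Times d z z0 fin c by auto
  qed
qed

text \<open>The definition of superization in one formula: on elementary tensors, \<open>f\<close> takes the value of its superization up to
a scalar that does not depend on the word.\<close>

theorem envelope_value_multilinear:
  assumes f: "\<And>w. w \<in> Poly_Mapping.keys f \<Longrightarrow> distinct (letters w) \<and> set (letters w) = V"
    and S: "\<And>v. finite (S v)" and a: "\<And>v. a v \<in> part A (of_nat (card (S v)))"
  shows "\<exists>c. ((\<forall>u\<in>V. \<forall>v\<in>V. u \<noteq> v \<longrightarrow> S u \<inter> S v = {}) \<longrightarrow> c \<noteq> 0) \<and>
    npoly_value GA (\<lambda>v. homog A (S v) (a v)) f =
    homog A (\<Union>v\<in>V. S v) (c \<odot> npoly_value A a (superization (\<lambda>v. of_nat (card (S v))) f))"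
proof -
  interpret G: nonassoc_algebra GA by (rule envelope_algebra)
  let ?h = "\<lambda>v. homog A (S v) (a v)" and ?K = "Poly_Mapping.keys f"
  let ?p = "\<lambda>v. of_nat (card (S v)) :: bit"
  let ?g = "\<lambda>u v. grassmann_sign (S u) (S v) :: 'f"
  have ca: "a v \<in> carrier A" for v using a part_carrier by blast
  have ch: "?h v \<in> carrier GA" for v using S a by (rule homog_closed)
  have wc: "word_value A a w \<in> carrier A" for w using ca by (auto intro: word_value_closed)
  have dis: "sorted_wrt (\<lambda>u v. S u \<inter> S v = {}) (letters w) \<longleftrightarrow> (\<forall>u\<in>V. \<forall>v\<in>V. u \<noteq> v \<longrightarrow> S u \<inter> S v = {})"
    if "w \<in> ?K" for w
  proof -
    have "sorted_wrt (\<lambda>u v. S u \<inter> S v = {}) vs \<longleftrightarrow> (\<forall>u\<in>set vs. \<forall>v\<in>set vs. u \<noteq> v \<longrightarrow> S u \<inter> S v = {})"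
      if "distinct vs" for vs
      using that by (induction vs) (auto, blast+)
    then show ?thesis using f[OF that] by auto
  qed
  show ?thesis
  proof (cases "\<forall>u\<in>V. \<forall>v\<in>V. u \<noteq> v \<longrightarrow> S u \<inter> S v = {}")
    case False
    have "npoly_value GA ?h f = \<zero>\<^bsub>GA\<^esub>"
      unfolding npoly_value_def
    proof (rule G.finsum_neutral)
      show "Poly_Mapping.lookup f w \<odot>\<^bsub>GA\<^esub> word_value GA ?h w = \<zero>\<^bsub>GA\<^esub>" if "w \<in> ?K" for w
      proof -
        have "word_value GA ?h w = \<zero>\<^bsub>GA\<^esub>"
          using word_value_envelope[of S a w, OF S ca] dis[OF that] False by simp
        then show ?thesis by (simp only: G.scale_zero)
      qed
    qed
    moreover have "npoly_value A a (superization ?p f) \<in> carrier A"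
      using ca by (rule npoly_value_closed)
    ultimately have "npoly_value GA ?h f = homog A (\<Union>v\<in>V. S v) (0 \<odot> npoly_value A a (superization ?p f))"
      by (simp only: zero_scale homog_zero)
    with False show ?thesis by blast
  next
    case True
    define c where "c = (\<Prod>v\<in>V. \<Prod>u\<in>{u\<in>V. u < v}. ?g u v)"
    have sign: "pair_prod ?g (letters w) = c * koszul_sign ?p (letters w)" if "w \<in> ?K" for w
    proof -
      have "?g v u = (if ?p u * ?p v = 1 then - 1 else 1) * ?g u v" if "u \<in> V" "v \<in> V" "u < v" for u v
        using grassmann_sign_swap[OF S S, of v u] True that
        by (auto simp: of_nat_bit_eq_one minus_one_power_iff simp flip: of_nat_mult)
      then show ?thesis
        using pair_prod_reorder[of "letters w" ?g ?p] f[OF that] by (simp add: c_def)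
    qed
    have fin: "finite ?K" by simp
    have homog_sum: "homog A U (\<Oplus>w\<in>X. t w) = (\<Oplus>\<^bsub>GA\<^esub>w\<in>X. homog A U (t w))"
      if "finite X" "\<And>w. w \<in> X \<Longrightarrow> homog A U (t w) \<in> carrier GA \<and> t w \<in> carrier A" for U X and t :: "nat word \<Rightarrow> 'a"
      using that
    proof induction
      case (insert w X)
      then have 1: "t \<in> X \<rightarrow> carrier A" "(\<lambda>w. homog A U (t w)) \<in> X \<rightarrow> carrier GA" by auto
      have 2: "homog A U (\<Oplus>w\<in>X. t w) = (\<Oplus>\<^bsub>GA\<^esub>w\<in>X. homog A U (t w))"
        using insert by blast
      have 3: "t w \<in> carrier A" "homog A U (t w) \<in> carrier GA" using insert.prems by auto
      have "homog A U (\<Oplus>w\<in>insert w X. t w) = homog A U (t w) \<oplus>\<^bsub>GA\<^esub> homog A U (\<Oplus>w\<in>X. t w)"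
        using insert.hyps 1(1) 3(1) by (simp add: homog_add del: envelope_simps)
      also have "\<dots> = (\<Oplus>\<^bsub>GA\<^esub>w\<in>insert w X. homog A U (t w))"
        unfolding 2 using insert.hyps 1(2) 3(2) by (rule G.finsum_insert[symmetric])
      finally show ?case .
    qed (simp only: finsum_empty G.finsum_empty homog_zero)
    let ?s = "\<lambda>w. (c * (koszul_sign ?p (letters w) * Poly_Mapping.lookup f w)) \<odot> word_value A a w"
    have t: "Poly_Mapping.lookup f w \<odot>\<^bsub>GA\<^esub> word_value GA ?h w = homog A (\<Union>v\<in>V. S v) (?s w)" if "w \<in> ?K" for w
    proof -
      have "word_value GA ?h w = homog A (\<Union>v\<in>V. S v) ((c * koszul_sign ?p (letters w)) \<odot> word_value A a w)"
        using word_value_envelope[of S a w, OF S ca] dis[OF that] True sign[OF that] f[OF that] by simp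
      then show ?thesis
        by (simp only: homog_scale[symmetric] scale_closed wc scale_scale) (simp add: mult_ac)
    qed
    have tc: "homog A (\<Union>v\<in>V. S v) (?s w) \<in> carrier GA \<and> ?s w \<in> carrier A" if "w \<in> ?K" for w
      using t[OF that, symmetric] G.word_value_closed[of w ?h] ch by (simp only: G.scale_closed scale_closed wc)
    have "npoly_value GA ?h f = (\<Oplus>\<^bsub>GA\<^esub>w\<in>?K. homog A (\<Union>v\<in>V. S v) (?s w))"
      unfolding npoly_value_def using t tc by (intro G.finsum_cong') auto
    also have "\<dots> = homog A (\<Union>v\<in>V. S v) (\<Oplus>w\<in>?K. ?s w)"
      using tc by (intro homog_sum[symmetric] fin)
    also have "(\<Oplus>w\<in>?K. ?s w) = (\<Oplus>w\<in>?K. c \<odot> (Poly_Mapping.lookup (superization ?p f) w \<odot> word_value A a w))"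
      by (rule finsum_cong') (auto simp: lookup_superization scale_scale wc)
    also have "\<dots> = c \<odot> npoly_value A a (superization ?p f)"
      unfolding npoly_value_def keys_superization by (rule finsum_scale[symmetric]) (auto simp: wc)
    finally have eq: "npoly_value GA ?h f = homog A (\<Union>v\<in>V. S v) (c \<odot> npoly_value A a (superization ?p f))" .
    have "c \<noteq> 0"
    proof (cases "finite V")
      case True
      then show ?thesis by (simp add: c_def)
    qed (simp add: c_def)
    with eq show ?thesis by blast
  qed
qed

end

subsection \<open>Multilinear polynomials and additive generators\<close>

text \<open>Closure under addition only; a multilinear polynomial that vanishes on a generating set vanishes on this span,
and homogeneous generators are not closed under addition.\<close>

inductive_set addspan :: "('f, 'a, 'm) module_scheme \<Rightarrow> 'a set \<Rightarrow> 'a set" for A X where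
  zero: "\<zero>\<^bsub>A\<^esub> \<in> addspan A X"
| gen: "x \<in> X \<Longrightarrow> x \<in> addspan A X"
| add: "\<lbrakk>x \<in> addspan A X; y \<in> addspan A X\<rbrakk> \<Longrightarrow> x \<oplus>\<^bsub>A\<^esub> y \<in> addspan A X"

context nonassoc_algebra
begin

lemma addspan_closed: "\<lbrakk>x \<in> addspan A X; X \<subseteq> carrier A\<rbrakk> \<Longrightarrow> x \<in> carrier A"
  by (induction rule: addspan.induct) auto

lemma word_value_update_add:
  assumes a: "\<And>u. a u \<in> carrier A" and xy: "x \<in> carrier A" "y \<in> carrier A"
    and "distinct (letters w)" "v \<in> set (letters w)"
  shows "word_value A (a(v := x \<oplus> y)) w = word_value A (a(v := x)) w \<oplus> word_value A (a(v := y)) w"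
  using assms(4,5)
proof (induction w)
  case (Times u w)
  have c: "word_value A (a(v := z)) t \<in> carrier A" if "z \<in> carrier A" for z t
    using a that by (auto intro: word_value_closed)
  have same: "word_value A (a(v := z)) t = word_value A (a(v := x)) t" if "v \<notin> set (letters t)" for z t
    using that by (auto intro: word_value_cong)
  consider "v \<in> set (letters u)" "v \<notin> set (letters w)" | "v \<in> set (letters w)" "v \<notin> set (letters u)"
    using Times.prems by auto
  then show ?case
  proof cases
    case 1
    then show ?thesis
      using Times same[of w "x \<oplus> y"] same[of w y] xy by (simp add: mult_add_left c del: fun_upd_apply)
  next
    case 2
    then show ?thesis
      using Times same[of u "x \<oplus> y"] same[of u y] xy by (simp add: mult_add_right c del: fun_upd_apply)
  qed
qed simp

lemma npoly_value_update_add: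
  assumes a: "\<And>u. a u \<in> carrier A" and xy: "x \<in> carrier A" "y \<in> carrier A"
    and f: "\<And>w. w \<in> Poly_Mapping.keys f \<Longrightarrow> distinct (letters w) \<and> v \<in> set (letters w)"
  shows "npoly_value A (a(v := x \<oplus> y)) f = npoly_value A (a(v := x)) f \<oplus> npoly_value A (a(v := y)) f"
proof -
  have c: "word_value A (a(v := z)) t \<in> carrier A" if "z \<in> carrier A" for z t
    using a that by (auto intro: word_value_closed)
  have "npoly_value A (a(v := x \<oplus> y)) f = (\<Oplus>w\<in>Poly_Mapping.keys f.
      Poly_Mapping.lookup f w \<odot> word_value A (a(v := x)) w \<oplus> Poly_Mapping.lookup f w \<odot> word_value A (a(v := y)) w)"
    unfolding npoly_value_def
    using word_value_update_add[of a x y, OF a xy] f xy by (intro finsum_cong') (auto simp: c scale_add)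
  then show ?thesis
    using xy by (simp add: npoly_value_def finsum_addf c)
qed

text \<open>By induction on the number of variables whose values are allowed to be sums.\<close>

lemma multilinear_zero_on_span:
  assumes f: "\<And>w. w \<in> Poly_Mapping.keys f \<Longrightarrow> distinct (letters w) \<and> set (letters w) = V"
    and Q: "\<And>v. Q v \<subseteq> carrier A"
    and zero: "\<And>a. \<lbrakk>\<And>v. a v \<in> carrier A; \<And>v. v \<in> V \<Longrightarrow> a v \<in> Q v\<rbrakk> \<Longrightarrow> npoly_value A a f = \<zero>"
    and a: "\<And>v. a v \<in> carrier A" "\<And>v. v \<in> V \<Longrightarrow> a v \<in> addspan A (Q v)"
  shows "npoly_value A a f = \<zero>"
proof (cases "Poly_Mapping.keys f = {}")
  case False
  then have "finite V" using f by fastforce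
  have "npoly_value A a f = \<zero>"
    if "X \<subseteq> V" "\<And>v. a v \<in> carrier A" "\<And>v. v \<in> X \<Longrightarrow> a v \<in> addspan A (Q v)" "\<And>v. v \<in> V - X \<Longrightarrow> a v \<in> Q v" for X a
    using finite_subset[OF that(1) \<open>finite V\<close>] that
  proof (induction X arbitrary: a rule: finite_induct)
    case empty
    then show ?case using zero by simp
  next
    case (insert v X)
    have f': "distinct (letters w) \<and> v \<in> set (letters w)" if "w \<in> Poly_Mapping.keys f" for w
      using f[OF that] insert.prems(1) by simp
    note add = npoly_value_update_add[of a _ _ f v, OF insert.prems(2) _ _ f']
    have cl: "npoly_value A (a(v := x)) f \<in> carrier A" if "x \<in> carrier A" for x
      using that insert.prems(2) by (auto intro: npoly_value_closed)
    have "npoly_value A (a(v := x)) f = \<zero>" if "x \<in> addspan A (Q v)" for x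
      using that
    proof induction
      case zero
      show ?case using add[of \<zero> \<zero>] cl[of \<zero>] by (simp del: fun_upd_apply)
    next
      case (gen x)
      show ?case
        by (rule insert.IH) (use insert gen subsetD[OF Q gen] in auto)
    next
      case (add x y)
      then show ?case
        using npoly_value_update_add[of a x y f v, OF insert.prems(2) _ _ f'] addspan_closed[OF _ Q]
        by (simp del: fun_upd_apply)
    qed
    from this[of "a v"] show ?case using insert.prems(3) by simp
  qed
  from this[of V a] show ?thesis using a by simp
qed (simp add: npoly_value_def)

end

text \<open>Index sets for elementary tensors of prescribed parities that are pairwise disjoint, so that no value is lost by
multiplying the Grassmann words.\<close>

definition odd_set :: "(nat \<Rightarrow> bit) \<Rightarrow> nat \<Rightarrow> nat set" where
  "odd_set p v = (if p v = 1 then {v} else {})"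

lemma finite_odd_set [simp]: "finite (odd_set p v)"
  by (simp add: odd_set_def)

lemma card_odd_set [simp]: "of_nat (card (odd_set p v)) = p v"
  using bit_cases[of "p v"] by (auto simp: odd_set_def)

context superalgebra
begin

lemma envelope_span:
  assumes "x \<in> carrier GA"
  shows "x \<in> addspan GA {homog A S a | S a. finite S \<and> a \<in> part A (of_nat (card S))}" (is "_ \<in> addspan GA ?H")
proof -
  have "finite {S. x S \<noteq> \<zero>}" using assms by (simp add: carrier_envelope)
  then show ?thesis using assms
  proof (induction "{S. x S \<noteq> \<zero>}" arbitrary: x rule: finite_induct)
    case empty
    then have "x = \<zero>\<^bsub>GA\<^esub>" by auto
    then show ?case by (simp only: addspan.zero)
  next
    case (insert S F)
    have S: "finite S" "x S \<in> part A (of_nat (card S))"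
      using insert.hyps insert.prems by (auto simp: carrier_envelope)
    let ?y = "x(S := \<zero>)"
    have F: "F = {T. ?y T \<noteq> \<zero>}"
    proof (intro subset_antisym subsetI)
      fix T assume "T \<in> F"
      then have "T \<in> insert S F" "T \<noteq> S" using insert.hyps(2) by auto
      then show "T \<in> {T. ?y T \<noteq> \<zero>}" unfolding insert.hyps(4) by simp
    next
      fix T assume "T \<in> {T. ?y T \<noteq> \<zero>}"
      then have "T \<in> {T. x T \<noteq> \<zero>}" "T \<noteq> S" by (auto split: if_splits)
      then show "T \<in> F" unfolding insert.hyps(4)[symmetric] by simp
    qed
    have "finite {T. ?y T \<noteq> \<zero>}" using insert.hyps(1) F by simp
    then have "?y \<in> carrier GA"
      using insert.prems unfolding carrier_envelope by (simp del: fun_upd_apply) (simp add: fun_upd_def)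
    then have "?y \<in> addspan GA ?H" using insert.hyps(3)[OF F] by blast
    moreover have "homog A S (x S) \<in> addspan GA ?H" using S by (auto intro: addspan.gen)
    ultimately have "?y \<oplus>\<^bsub>GA\<^esub> homog A S (x S) \<in> addspan GA ?H" by (rule addspan.add)
    moreover have "?y \<oplus>\<^bsub>GA\<^esub> homog A S (x S) = x"
      using envelope_coeff[OF insert.prems] by (simp add: homog_def fun_eq_iff)
    ultimately show ?case by simp
  qed
qed

lemma homog_eq_zero: "homog A U x = \<zero>\<^bsub>GA\<^esub> \<longleftrightarrow> x = \<zero>"
  by (auto simp: homog_def fun_eq_iff)

lemma superidentity_on_homog:
  assumes f: "\<And>w. w \<in> Poly_Mapping.keys f \<Longrightarrow> distinct (letters w) \<and> set (letters w) = V"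
    and S: "\<And>v. finite (S v)" and a: "\<And>v. a v \<in> part A (of_nat (card (S v)))"
    and zero: "npoly_value A a (superization (\<lambda>v. of_nat (card (S v))) f) = \<zero>"
  shows "npoly_value GA (\<lambda>v. homog A (S v) (a v)) f = \<zero>\<^bsub>GA\<^esub>"
  using envelope_value_multilinear[of f V S a, OF f S a] zero by auto

lemma homog_superidentity:
  assumes f: "\<And>w. w \<in> Poly_Mapping.keys f \<Longrightarrow> distinct (letters w) \<and> set (letters w) = V"
    and a: "\<And>v. a v \<in> part A (p v)"
    and zero: "npoly_value GA (\<lambda>v. homog A (odd_set p v) (a v)) f = \<zero>\<^bsub>GA\<^esub>"
  shows "npoly_value A a (superization p f) = \<zero>"
proof -
  have a': "a v \<in> part A (of_nat (card (odd_set p v)))" for v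
    using a by simp
  obtain c where c: "(\<forall>u\<in>V. \<forall>v\<in>V. u \<noteq> v \<longrightarrow> odd_set p u \<inter> odd_set p v = {}) \<longrightarrow> c \<noteq> 0"
    and eq: "npoly_value GA (\<lambda>v. homog A (odd_set p v) (a v)) f = homog A (\<Union>v\<in>V. odd_set p v) (c \<odot> npoly_value A a (superization p f))"
    using envelope_value_multilinear[of f V "odd_set p" a, OF f finite_odd_set a'] by auto
  have "c \<noteq> 0" using c by (auto simp: odd_set_def)
  moreover have "npoly_value A a (superization p f) \<in> carrier A"
    using a part_carrier by (auto intro: npoly_value_closed)
  moreover have "c \<odot> npoly_value A a (superization p f) = \<zero>"
    using zero eq homog_eq_zero by metis
  ultimately show ?thesis using scale_eq_zero by blast
qed

text \<open>Elementary tensors span the envelope, and on them \<open>f\<close> and its superization have the same zeros; conversely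
each homogeneous substitution is visible on the tensors with index sets \<^const>\<open>odd_set\<close>.\<close>

theorem satisfies_super_iff_envelope:
  assumes "multilinear f"
  shows "satisfies_super A f \<longleftrightarrow> satisfies GA f"
proof -
  interpret G: nonassoc_algebra GA by (rule envelope_algebra)
  obtain V where f: "\<And>w. w \<in> Poly_Mapping.keys f \<Longrightarrow> distinct (letters w) \<and> set (letters w) = V"
    using assms by (auto simp: multilinear_def)
  show ?thesis
  proof
    assume super: "satisfies_super A f"
    show "satisfies GA f"
      unfolding satisfies_def
    proof (intro allI impI)
      fix a :: "nat \<Rightarrow> nat set \<Rightarrow> 'a" assume a: "\<forall>v. a v \<in> carrier GA"
      show "npoly_value GA a f = \<zero>\<^bsub>GA\<^esub>"
      proof (rule G.multilinear_zero_on_span[where Q = "\<lambda>_. {homog A S a | S a. finite S \<and> a \<in> part A (of_nat (card S))}" and V = V])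
        fix b :: "nat \<Rightarrow> nat set \<Rightarrow> 'a" assume b: "\<And>v. v \<in> V \<Longrightarrow> b v \<in> {homog A S a | S a. finite S \<and> a \<in> part A (of_nat (card S))}"
          "\<And>v. b v \<in> carrier GA"
        define S where "S v = (SOME S. \<exists>a. b v = homog A S a \<and> finite S \<and> a \<in> part A (of_nat (card S)))" for v
        have "\<exists>a. b v = homog A (S v) a \<and> finite (S v) \<and> a \<in> part A (of_nat (card (S v)))" if "v \<in> V" for v
          unfolding S_def by (rule someI_ex) (use b(1)[OF that] in auto)
        then obtain d where d: "\<And>v. v \<in> V \<Longrightarrow> b v = homog A (S v) (d v) \<and> finite (S v) \<and> d v \<in> part A (of_nat (card (S v)))"
          by metis
        define S' where "S' v = (if v \<in> V then S v else {})" for v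
        define d' where "d' v = (if v \<in> V then d v else \<zero>)" for v
        have "npoly_value GA (\<lambda>v. homog A (S' v) (d' v)) f = \<zero>\<^bsub>GA\<^esub>"
        proof (rule superidentity_on_homog[where V = V])
          show "finite (S' v)" for v using d[of v] by (auto simp: S'_def)
          show d'part: "d' v \<in> part A (of_nat (card (S' v)))" for v using d[of v] by (auto simp: S'_def d'_def)
          show "npoly_value A d' (superization (\<lambda>v. of_nat (card (S' v))) f) = \<zero>"
            using super d'part by (simp add: satisfies_super_def)
        qed (use f in auto)
        moreover have "word_value GA b w = word_value GA (\<lambda>v. homog A (S' v) (d' v)) w" if "w \<in> Poly_Mapping.keys f" for w
          by (rule G.word_value_cong) (use f[OF that] d in \<open>auto simp: S'_def d'_def\<close>)
        moreover have "(\<lambda>w. Poly_Mapping.lookup f w \<odot>\<^bsub>GA\<^esub> word_value GA b w) \<in> Poly_Mapping.keys f \<rightarrow> carrier GA"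
          using b(2) by (intro Pi_I G.scale_closed G.word_value_closed)
        ultimately show "npoly_value GA b f = \<zero>\<^bsub>GA\<^esub>"
          unfolding npoly_value_def by (subst G.finsum_cong'[OF refl]) (simp_all add: Pi_iff)
      qed (use f a envelope_span homog_closed in auto)
    qed
  next
    assume ord: "satisfies GA f"
    show "satisfies_super A f"
      unfolding satisfies_super_def
    proof (intro allI impI)
      fix p :: "nat \<Rightarrow> bit" and a assume a: "\<forall>v. a v \<in> part A (p v)"
      show "npoly_value A a (superization p f) = \<zero>"
      proof (rule homog_superidentity[where V = V])
        have "homog A (odd_set p v) (a v) \<in> carrier GA" for v
          using a by (intro homog_closed) simp_all
        then show "npoly_value GA (\<lambda>v. homog A (odd_set p v) (a v)) f = \<zero>\<^bsub>GA\<^esub>"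
          using ord by (simp add: satisfies_def)
      qed (use f a in auto)
    qed
  qed
qed

end


section \<open>Metabelian Jordan algebras\<close>

text \<open>The three multilinear identities to which the definition of \<^const>\<open>jordan_metabelian\<close> is equivalent in
characteristic 0. In the full linearization of the Jordan identity the terms \<open>(xy)(zt)\<close> are 0.\<close>

locale metabelian_jordan = nonassoc_algebra A
  for A :: "('f::field, 'a, 'm) module_scheme" (structure) +
  assumes comm: "\<lbrakk>x \<in> carrier A; y \<in> carrier A\<rbrakk> \<Longrightarrow> x \<otimes> y = y \<otimes> x"
    and metabelian: "\<lbrakk>x \<in> carrier A; y \<in> carrier A; z \<in> carrier A; t \<in> carrier A\<rbrakk>
      \<Longrightarrow> (x \<otimes> y) \<otimes> (z \<otimes> t) = \<zero>"
    and jordan: "\<lbrakk>x \<in> carrier A; y \<in> carrier A; z \<in> carrier A; t \<in> carrier A\<rbrakk>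
      \<Longrightarrow> ((x \<otimes> z) \<otimes> y) \<otimes> t \<oplus> ((z \<otimes> t) \<otimes> y) \<otimes> x \<oplus> ((t \<otimes> x) \<otimes> y) \<otimes> z = \<zero>"

definition commutator_poly :: "(nat, 'f::field) npoly" where
  "commutator_poly = Poly_Mapping.single (Times (Gen 0) (Gen 1)) 1 + Poly_Mapping.single (Times (Gen 1) (Gen 0)) (- 1)"

definition metabelian_poly :: "(nat, 'f::field) npoly" where
  "metabelian_poly = Poly_Mapping.single (Times (Times (Gen 0) (Gen 1)) (Times (Gen 2) (Gen 3))) 1"

definition jordan_poly :: "(nat, 'f::field) npoly" where
  "jordan_poly = Poly_Mapping.single (Times (Times (Times (Gen 0) (Gen 2)) (Gen 1)) (Gen 3)) 1
     + Poly_Mapping.single (Times (Times (Times (Gen 2) (Gen 3)) (Gen 1)) (Gen 0)) 1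
     + Poly_Mapping.single (Times (Times (Times (Gen 3) (Gen 0)) (Gen 1)) (Gen 2)) 1"

lemma multilinear_commutator: "multilinear (commutator_poly :: (nat, 'f::field) npoly)"
proof -
  have "Poly_Mapping.keys (commutator_poly :: (nat, 'f::field) npoly) \<subseteq> {Times (Gen 0) (Gen 1), Times (Gen 1) (Gen 0)}"
    unfolding commutator_poly_def by (rule order.trans[OF keys_add]) (auto split: if_splits)
  then show ?thesis unfolding multilinear_def by (intro exI[of _ "{0, 1}"]) auto
qed

lemma multilinear_metabelian: "multilinear metabelian_poly"
  unfolding multilinear_def metabelian_poly_def by (intro exI[of _ "{0, 1, 2, 3}"]) auto

lemma multilinear_jordan: "multilinear (jordan_poly :: (nat, 'f::field) npoly)"
proof -
  have "Poly_Mapping.keys (jordan_poly :: (nat, 'f::field) npoly) \<subseteq>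
    {Times (Times (Times (Gen 0) (Gen 2)) (Gen 1)) (Gen 3), Times (Times (Times (Gen 2) (Gen 3)) (Gen 1)) (Gen 0),
     Times (Times (Times (Gen 3) (Gen 0)) (Gen 1)) (Gen 2)}"
    unfolding jordan_poly_def
    by (intro order.trans[OF keys_add] Un_least) (auto split: if_splits)
  then show ?thesis unfolding multilinear_def by (intro exI[of _ "{0, 1, 2, 3}"]) auto
qed

lemma (in nonassoc_algebra) difference_zero:
  "\<lbrakk>x \<in> carrier A; y \<in> carrier A\<rbrakk> \<Longrightarrow> x \<ominus> y = \<zero> \<longleftrightarrow> x = y"
  using minus_equality[of x "\<ominus> y"] by (auto simp: minus_eq r_neg)

lemma (in nonassoc_algebra) metabelian_jordan_iff_satisfies:
  "metabelian_jordan A \<longleftrightarrow>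
    satisfies A commutator_poly \<and> satisfies A metabelian_poly \<and> satisfies A jordan_poly"
proof -
  have c: "word_value A a w \<in> carrier A" if "\<And>v. a v \<in> carrier A" for a and w :: "nat word"
    using that by (auto intro: word_value_closed)
  note val = npoly_value_add npoly_value_single mult_closed
  have 1: "satisfies A commutator_poly \<longleftrightarrow> (\<forall>x\<in>carrier A. \<forall>y\<in>carrier A. x \<otimes> y = y \<otimes> x)"
  proof
    assume s: "satisfies A commutator_poly"
    show "\<forall>x\<in>carrier A. \<forall>y\<in>carrier A. x \<otimes> y = y \<otimes> x"
    proof (intro ballI)
      fix x y assume xy: "x \<in> carrier A" "y \<in> carrier A"
      define a where "a v = (if v = 0 then x else y)" for v :: nat
      have "\<And>v. a v \<in> carrier A" using xy by (simp add: a_def)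
      then have "x \<otimes> y \<oplus> (- 1) \<odot> (y \<otimes> x) = \<zero>"
        using s[unfolded satisfies_def, rule_format, of a] xy
        by (simp add: commutator_poly_def val) (simp add: a_def)
      then show "x \<otimes> y = y \<otimes> x"
        using xy by (simp add: minus_one_scale mult_closed difference_zero flip: minus_eq)
    qed
  next
    assume "\<forall>x\<in>carrier A. \<forall>y\<in>carrier A. x \<otimes> y = y \<otimes> x"
    then have c: "x \<otimes> y = y \<otimes> x" if "x \<in> carrier A" "y \<in> carrier A" for x y using that by blast
    show "satisfies A commutator_poly"
      unfolding satisfies_def
    proof (intro allI impI)
      fix a :: "nat \<Rightarrow> 'a" assume "\<forall>v. a v \<in> carrier A"
      then have a: "\<And>v. a v \<in> carrier A" by blast
      show "npoly_value A a commutator_poly = \<zero>"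
        using a by (simp add: commutator_poly_def val minus_one_scale c[of "a 0" "a (Suc 0)"] r_neg)
    qed
  qed
  have 2: "satisfies A metabelian_poly \<longleftrightarrow> (\<forall>x\<in>carrier A. \<forall>y\<in>carrier A. \<forall>z\<in>carrier A. \<forall>t\<in>carrier A.
      (x \<otimes> y) \<otimes> (z \<otimes> t) = \<zero>)"
  proof
    assume s: "satisfies A metabelian_poly"
    show "\<forall>x\<in>carrier A. \<forall>y\<in>carrier A. \<forall>z\<in>carrier A. \<forall>t\<in>carrier A. (x \<otimes> y) \<otimes> (z \<otimes> t) = \<zero>"
    proof (intro ballI)
      fix x y z t assume xy: "x \<in> carrier A" "y \<in> carrier A" "z \<in> carrier A" "t \<in> carrier A"
      define a where "a v = (if v = 0 then x else if v = 1 then y else if v = 2 then z else t)" for v :: nat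
      have "\<And>v. a v \<in> carrier A" using xy by (simp add: a_def)
      then show "(x \<otimes> y) \<otimes> (z \<otimes> t) = \<zero>"
        using s[unfolded satisfies_def, rule_format, of a] xy
        by (simp add: metabelian_poly_def val) (simp add: a_def)
    qed
  qed (simp add: satisfies_def metabelian_poly_def val)
  have 3: "satisfies A jordan_poly \<longleftrightarrow> (\<forall>x\<in>carrier A. \<forall>y\<in>carrier A. \<forall>z\<in>carrier A. \<forall>t\<in>carrier A.
      ((x \<otimes> z) \<otimes> y) \<otimes> t \<oplus> ((z \<otimes> t) \<otimes> y) \<otimes> x \<oplus> ((t \<otimes> x) \<otimes> y) \<otimes> z = \<zero>)"
  proof
    assume s: "satisfies A jordan_poly"
    show "\<forall>x\<in>carrier A. \<forall>y\<in>carrier A. \<forall>z\<in>carrier A. \<forall>t\<in>carrier A.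
      ((x \<otimes> z) \<otimes> y) \<otimes> t \<oplus> ((z \<otimes> t) \<otimes> y) \<otimes> x \<oplus> ((t \<otimes> x) \<otimes> y) \<otimes> z = \<zero>"
    proof (intro ballI)
      fix x y z t assume xy: "x \<in> carrier A" "y \<in> carrier A" "z \<in> carrier A" "t \<in> carrier A"
      define a where "a v = (if v = 0 then x else if v = 1 then y else if v = 2 then z else t)" for v :: nat
      have "\<And>v. a v \<in> carrier A" using xy by (simp add: a_def)
      then show "((x \<otimes> z) \<otimes> y) \<otimes> t \<oplus> ((z \<otimes> t) \<otimes> y) \<otimes> x \<oplus> ((t \<otimes> x) \<otimes> y) \<otimes> z = \<zero>"
        using s[unfolded satisfies_def, rule_format, of a] xy
        by (simp add: jordan_poly_def val) (simp add: a_def)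
    qed
  qed (simp add: satisfies_def jordan_poly_def val)
  show ?thesis
    unfolding metabelian_jordan_def metabelian_jordan_axioms_def 1 2 3
    by (intro iffI; elim conjE; intro conjI nonassoc_algebra_axioms; fast)
qed

lemma (in nonassoc_algebra) satisfies_jordan_metabelian:
  "(\<forall>f\<in>jordan_metabelian. satisfies A f) \<longleftrightarrow>
    (\<forall>a :: nat \<Rightarrow> 'a. (\<forall>v. a v \<in> carrier A) \<longrightarrow> a 0 \<otimes> a 1 = a 1 \<otimes> a 0 \<and>
       ((a 0 \<otimes> a 0) \<otimes> a 1) \<otimes> a 0 = (a 0 \<otimes> a 0) \<otimes> (a 1 \<otimes> a 0) \<and> (a 0 \<otimes> a 1) \<otimes> (a 2 \<otimes> a 3) = \<zero>)"
  unfolding satisfies_def jordan_metabelian_def Let_def npoly_associator_def ball_simps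
  by (simp add: npoly_value_diff npoly_value_times npoly_value_var mult_closed difference_zero) blast

text \<open>Polarization of the cubic form \<open>T x x x\<close>. Replacing \<open>z\<close> by \<open>-z\<close> separates the two mixed terms of \<open>T (x+z) (x+z) (x+z)\<close>, and
replacing \<open>x\<close> by \<open>x+t\<close> in the first of them gives the trilinear identity.\<close>

lemma (in nonassoc_algebra) polarize:
  assumes char: "(2 :: 'f) \<noteq> 0"
    and sym: "\<And>x z t. \<lbrakk>x \<in> carrier A; z \<in> carrier A; t \<in> carrier A\<rbrakk> \<Longrightarrow> T x z t = T z x t"
    and closed: "\<And>x z t. \<lbrakk>x \<in> carrier A; z \<in> carrier A; t \<in> carrier A\<rbrakk> \<Longrightarrow> T x z t \<in> carrier A"
    and add1: "\<And>x x' z t. \<lbrakk>x \<in> carrier A; x' \<in> carrier A; z \<in> carrier A; t \<in> carrier A\<rbrakk>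
      \<Longrightarrow> T (x \<oplus> x') z t = T x z t \<oplus> T x' z t"
    and add3: "\<And>x z t t'. \<lbrakk>x \<in> carrier A; z \<in> carrier A; t \<in> carrier A; t' \<in> carrier A\<rbrakk>
      \<Longrightarrow> T x z (t \<oplus> t') = T x z t \<oplus> T x z t'"
    and zero: "\<And>x. x \<in> carrier A \<Longrightarrow> T x x x = \<zero>"
    and xzt: "x \<in> carrier A" "z \<in> carrier A" "t \<in> carrier A"
  shows "T x z t \<oplus> T z t x \<oplus> T t x z = \<zero>"
proof -
  have double: "u = \<zero>" if "u \<in> carrier A" "u \<oplus> u = \<zero>" for u
    using scale_eq_zero[of u 2] that char add_scale[of u 1 1] by simp
  have add2: "T x (z \<oplus> z') t = T x z t \<oplus> T x z' t"
    if "x \<in> carrier A" "z \<in> carrier A" "z' \<in> carrier A" "t \<in> carrier A" for x z z' t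
    using that add1[of z z' x t] sym[of x _ t] by simp
  let ?p = "\<lambda>x z. T x x z \<oplus> (T x z x \<oplus> T x z x)"
  have pc: "?p x z \<in> carrier A" if "x \<in> carrier A" "z \<in> carrier A" for x z
    using that by (simp add: closed)
  have pq: "?p x z \<oplus> ?p z x = \<zero>" if xz: "x \<in> carrier A" "z \<in> carrier A" for x z
  proof -
    have s: "T z x x = T x z x" "T z x z = T x z z" using xz sym by auto
    have c: "T x x z \<in> carrier A" "T x z x \<in> carrier A" "T x z z \<in> carrier A" "T z z x \<in> carrier A"
      "T x x x = \<zero>" "T z z z = \<zero>"
      using xz closed zero by auto
    have "\<zero> = T (x \<oplus> z) (x \<oplus> z) (x \<oplus> z)" using zero xz by simp
    also have "\<dots> = ?p x z \<oplus> (T z z x \<oplus> (T x z z \<oplus> T x z z))"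
      using xz c by (simp add: add1 add2 add3 s a_ac)
    finally show ?thesis using s by simp
  qed
  have neg: "T (\<ominus> x) z t = \<ominus> T x z t" "T z x' (\<ominus> t) = \<ominus> T z x' t"
    if "x \<in> carrier A" "z \<in> carrier A" "t \<in> carrier A" "x' \<in> carrier A" for x z t x'
  proof -
    have "T \<zero> z t = \<zero>" using add1[of \<zero> \<zero> z t] closed[of \<zero> z t] that by simp
    then have "T (\<ominus> x) z t \<oplus> T x z t = \<zero>" using add1[of "\<ominus> x" x z t] that by (simp add: l_neg)
    then show "T (\<ominus> x) z t = \<ominus> T x z t"
      using that closed minus_equality[of "T (\<ominus> x) z t" "T x z t"] by simp
    have "T z x' \<zero> = \<zero>" using add3[of z x' \<zero> \<zero>] closed[of z x' \<zero>] that by simp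
    then have "T z x' (\<ominus> t) \<oplus> T z x' t = \<zero>" using add3[of z x' "\<ominus> t" t] that by (simp add: l_neg)
    then show "T z x' (\<ominus> t) = \<ominus> T z x' t"
      using that closed minus_equality[of "T z x' (\<ominus> t)" "T z x' t"] by simp
  qed
  have p: "?p x z = \<zero>" if xz: "x \<in> carrier A" "z \<in> carrier A" for x z
  proof -
    have c: "T x x z \<in> carrier A" "T x z x \<in> carrier A" "T z x z \<in> carrier A" "T z z x \<in> carrier A"
      using xz closed by auto
    have e: "T x x (\<ominus> z) = \<ominus> T x x z" using neg(2)[of x x z x] xz by simp
    have "T x (\<ominus> z) x = T (\<ominus> z) x x" using sym xz by simp
    then have e2: "T x (\<ominus> z) x = \<ominus> T x z x" using neg(1)[of z x x] sym[of z x x] xz by simp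
    have "T (\<ominus> z) (\<ominus> z) x = \<ominus> T (\<ominus> z) z x" using neg(1)[of z "\<ominus> z" x z] sym[of z "\<ominus> z" x] xz by simp
    then have e3: "T (\<ominus> z) (\<ominus> z) x = T z z x" using neg(1)[of z z x z] xz c by simp
    have e4: "T (\<ominus> z) x (\<ominus> z) = T z x z" using neg(1)[of z x "\<ominus> z" x] neg(2)[of z z z x] xz c by simp
    \<comment> \<open>The first term is odd and the second is even in \<open>z\<close>.\<close>
    have "?p x (\<ominus> z) = \<ominus> ?p x z" unfolding e e2 using c by (simp add: minus_add a_comm)
    moreover have "?p (\<ominus> z) x = ?p z x" unfolding e3 e4 by simp
    ultimately have "\<ominus> ?p x z \<oplus> ?p z x = \<zero>" using pq[of x "\<ominus> z"] xz by simp
    then have "?p z x = ?p x z"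
      using pc[OF xz] pc[OF xz(2,1)] minus_equality[of "?p z x" "\<ominus> ?p x z"] by (simp add: a_comm)
    then show ?thesis using pq[OF xz] double[OF pc[OF xz]] by simp
  qed
  have "?p (x \<oplus> t) z = ?p x z \<oplus> ?p t z \<oplus>
      ((T x z t \<oplus> T z t x \<oplus> T t x z) \<oplus> (T x z t \<oplus> T z t x \<oplus> T t x z))"
  proof -
    have s: "T t x z = T x t z" "T t z x = T z t x" "T z x t = T x z t" "T t z t = T z t t" "T z x x = T x z x"
      using xzt sym by auto
    show ?thesis
      using xzt by (simp add: add1 add2 add3 closed s a_ac)
  qed
  then have sum: "(T x z t \<oplus> T z t x \<oplus> T t x z) \<oplus> (T x z t \<oplus> T z t x \<oplus> T t x z) = \<zero>" (is "?E \<oplus> ?E = \<zero>")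
    unfolding p[OF a_closed[OF xzt(1,3)] xzt(2)] p[OF xzt(1,2)] p[OF xzt(3,2)]
    using closed[OF xzt] closed[OF xzt(2,3,1)] closed[OF xzt(3,1,2)] by simp
  have "?E \<in> carrier A"
    using closed[OF xzt] closed[OF xzt(2,3,1)] closed[OF xzt(3,1,2)] by simp
  then show ?thesis using sum by (rule double)
qed

text \<open>One direction is polarization of \<open>((xx)y)x = 0\<close>; in the other the linear identity at \<open>x = z = t\<close> gives
\<open>3 ((xx)y)x = 0\<close>.\<close>

lemma in_variety_iff:
  fixes A :: "('f::field_char_0, 'a, 'm) module_scheme" (structure)
  shows "in_variety jordan_metabelian A \<longleftrightarrow> metabelian_jordan A"
proof
  assume "in_variety jordan_metabelian A"
  then have A: "nonassoc_algebra A" and s: "\<forall>f\<in>jordan_metabelian. satisfies A f"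
    by (auto simp: in_variety_def)
  interpret nonassoc_algebra A by fact
  have *: "x \<otimes> y = y \<otimes> x \<and> ((x \<otimes> x) \<otimes> y) \<otimes> x = (x \<otimes> x) \<otimes> (y \<otimes> x) \<and> (x \<otimes> y) \<otimes> (z \<otimes> t) = \<zero>"
    if xy: "x \<in> carrier A" "y \<in> carrier A" "z \<in> carrier A" "t \<in> carrier A" for x y z t
  proof -
    define a where "a v = (if v = 0 then x else if v = 1 then y else if v = 2 then z else t)" for v :: nat
    have "\<forall>v. a v \<in> carrier A" using xy by (simp add: a_def)
    with satisfies_jordan_metabelian[THEN iffD1, OF s] have
      "a 0 \<otimes> a 1 = a 1 \<otimes> a 0 \<and> ((a 0 \<otimes> a 0) \<otimes> a 1) \<otimes> a 0 = (a 0 \<otimes> a 0) \<otimes> (a 1 \<otimes> a 0) \<and>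
       (a 0 \<otimes> a 1) \<otimes> (a 2 \<otimes> a 3) = \<zero>"
      by blast
    moreover have "a 0 = x" "a 1 = y" "a 2 = z" "a 3 = t" by (simp_all add: a_def)
    ultimately show ?thesis by metis
  qed
  have comm: "x \<otimes> y = y \<otimes> x" if "x \<in> carrier A" "y \<in> carrier A" for x y
    using *[of x y x x] that by blast
  show "metabelian_jordan A"
  proof unfold_locales
    fix x y z t assume c: "x \<in> carrier A" "y \<in> carrier A" "z \<in> carrier A" "t \<in> carrier A"
    show "(x \<otimes> y) \<otimes> (z \<otimes> t) = \<zero>" using *[OF c] by blast
    have zero: "((x \<otimes> x) \<otimes> y) \<otimes> x = \<zero>" if "x \<in> carrier A" for x
      using *[of x y x x] *[of x x y x] that c by metis
    show "((x \<otimes> z) \<otimes> y) \<otimes> t \<oplus> ((z \<otimes> t) \<otimes> y) \<otimes> x \<oplus> ((t \<otimes> x) \<otimes> y) \<otimes> z = \<zero>"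
      by (rule polarize[where T = "\<lambda>x z t. ((x \<otimes> z) \<otimes> y) \<otimes> t"])
        (use c zero in \<open>simp_all add: mult_closed mult_add_left mult_add_right comm\<close>)
  qed (rule comm)
next
  assume "metabelian_jordan A"
  then interpret metabelian_jordan A .
  have "((x \<otimes> x) \<otimes> y) \<otimes> x = \<zero>" if xy: "x \<in> carrier A" "y \<in> carrier A" for x y
  proof -
    let ?q = "((x \<otimes> x) \<otimes> y) \<otimes> x"
    have q: "?q \<in> carrier A" using xy by (simp add: mult_closed)
    have "(1 + 1 + 1 :: 'f) \<odot> ?q = \<zero>"
      using jordan[of x y x x] xy q by (simp only: add_scale one_scale)
    then have "(3 :: 'f) \<odot> ?q = \<zero>" by simp
    then show ?thesis by (rule scale_eq_zero[OF q, rotated]) simp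
  qed
  then show "in_variety jordan_metabelian A"
    unfolding in_variety_def satisfies_jordan_metabelian
    using nonassoc_algebra_axioms comm metabelian by auto
qed

text \<open>Membership in the variety of superalgebras is a matter of three multilinear superidentities.\<close>

theorem variety_superalgebra_iff:
  fixes A :: "('f::field_char_0, 'a) superalg"
  shows "variety_superalgebra jordan_metabelian A \<longleftrightarrow> superalgebra A \<and>
     satisfies_super A commutator_poly \<and> satisfies_super A metabelian_poly \<and> satisfies_super A jordan_poly"
proof (cases "superalgebra A")
  case True
  then interpret superalgebra A .
  interpret G: nonassoc_algebra GA by (rule envelope_algebra)
  show ?thesis
    using True
    by (simp add: variety_superalgebra_def in_variety_iff G.metabelian_jordan_iff_satisfies
        satisfies_super_iff_envelope multilinear_commutator multilinear_metabelian multilinear_jordan)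
qed (simp add: variety_superalgebra_def)

lemma envelope_metabelian_jordan:
  fixes A :: "('f::field_char_0, 'a) superalg"
  assumes "variety_superalgebra jordan_metabelian A"
  shows "metabelian_jordan (grassmann_envelope A)"
  using assms by (simp add: variety_superalgebra_def in_variety_iff)


section \<open>Quotients and free superalgebras\<close>

text \<open>Directness of the grading is the one axiom that does not pass to images by itself.\<close>

lemma superalgebra_image:
  assumes A: "superalgebra A" and h: "algebra_hom A B h" and surj: "h ` carrier A = carrier B"
    and part: "\<And>i. part B i = h ` part A i"
    and separated: "\<And>x y. \<lbrakk>x \<in> part A 0; y \<in> part A 1; h x = h y\<rbrakk> \<Longrightarrow> h x = \<zero>\<^bsub>B\<^esub>"
  shows "superalgebra B"
proof -
  interpret superalgebra A by fact
  have H: "h (x \<oplus>\<^bsub>A\<^esub> y) = h x \<oplus>\<^bsub>B\<^esub> h y" "h (x \<otimes>\<^bsub>A\<^esub> y) = h x \<otimes>\<^bsub>B\<^esub> h y" "h (c \<odot>\<^bsub>A\<^esub> x) = c \<odot>\<^bsub>B\<^esub> h x"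
    if "x \<in> carrier A" "y \<in> carrier A" for x y c
    using h that by (auto simp: algebra_hom_def)
  have h0: "h \<zero>\<^bsub>A\<^esub> = \<zero>\<^bsub>B\<^esub>" using h by (simp add: algebra_hom_def)
  show ?thesis
  proof (rule superalgebraI)
    show "nonassoc_algebra B" using nonassoc_algebra_axioms h surj by (rule algebra_hom_image)
    show "part B i \<subseteq> carrier B" for i
      unfolding part surj[symmetric] using part_carrier by (intro image_mono) auto
    show "\<zero>\<^bsub>B\<^esub> \<in> part B i" for i unfolding part h0[symmetric] by (rule imageI) simp
    show "x \<oplus>\<^bsub>B\<^esub> y \<in> part B i" if xy: "x \<in> part B i" "y \<in> part B i" for i x y
    proof -
      obtain x' y' where "x' \<in> part A i" "x = h x'" "y' \<in> part A i" "y = h y'" using xy unfolding part by blast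
      then show ?thesis unfolding part using H(1)[of x' y'] part_add[of x' i y'] part_carrier by (metis imageI)
    qed
    show "c \<odot>\<^bsub>B\<^esub> x \<in> part B i" if x: "x \<in> part B i" for i c x
    proof -
      obtain x' where "x' \<in> part A i" "x = h x'" using x unfolding part by blast
      then show ?thesis unfolding part using H(3)[of x' x' c] part_scale[of x' i c] part_carrier by (metis imageI)
    qed
    show "\<exists>y\<in>part B 0. \<exists>z\<in>part B 1. x = y \<oplus>\<^bsub>B\<^esub> z" if x: "x \<in> carrier B" for x
    proof -
      obtain x' where x': "x' \<in> carrier A" "x = h x'" using x surj by blast
      then obtain y z where "y \<in> part A 0" "z \<in> part A 1" "x' = y \<oplus>\<^bsub>A\<^esub> z" using decompose by blast
      then show ?thesis unfolding part using x'(2) H(1)[of y z] part_carrier by blast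
    qed
    show "x = \<zero>\<^bsub>B\<^esub>" if x: "x \<in> part B 0" "x \<in> part B 1" for x
    proof -
      obtain y z where "y \<in> part A 0" "x = h y" "z \<in> part A 1" "x = h z" using x unfolding part by blast
      then show ?thesis using separated by metis
    qed
    show "x \<otimes>\<^bsub>B\<^esub> y \<in> part B (i + j)" if xy: "x \<in> part B i" "y \<in> part B j" for i j x y
    proof -
      obtain x' y' where "x' \<in> part A i" "x = h x'" "y' \<in> part A j" "y = h y'" using xy unfolding part by blast
      then show ?thesis unfolding part using H(2)[of x' y'] part_mult[of x' i y' j] part_carrier by (metis imageI)
    qed
  qed
qed

subsection \<open>Quotients by graded ideals\<close>

context superalgebra
begin

context
  fixes I assumes I: "graded_ideal A I"
begin

lemma ideal_subset: "x \<in> I \<Longrightarrow> x \<in> carrier A"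
  and ideal_zero: "\<zero> \<in> I"
  and ideal_add: "\<lbrakk>x \<in> I; y \<in> I\<rbrakk> \<Longrightarrow> x \<oplus> y \<in> I"
  and ideal_minus: "x \<in> I \<Longrightarrow> \<ominus> x \<in> I"
  and ideal_scale: "x \<in> I \<Longrightarrow> c \<odot> x \<in> I"
  and ideal_mult: "\<lbrakk>x \<in> I; y \<in> carrier A\<rbrakk> \<Longrightarrow> x \<otimes> y \<in> I \<and> y \<otimes> x \<in> I"
proof -
  have s: "submodule I scalars A" using I by (simp add: graded_ideal_def)
  note E = submoduleE[OF s]
  show "x \<in> I \<Longrightarrow> x \<in> carrier A" "\<lbrakk>x \<in> I; y \<in> I\<rbrakk> \<Longrightarrow> x \<oplus> y \<in> I" "x \<in> I \<Longrightarrow> \<ominus> x \<in> I" "x \<in> I \<Longrightarrow> c \<odot> x \<in> I"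
    using E by auto
  obtain u where "u \<in> I" using E(2) by blast
  then show "\<zero> \<in> I" using E(4)[of 0 u] E(1) by auto
  show "\<lbrakk>x \<in> I; y \<in> carrier A\<rbrakk> \<Longrightarrow> x \<otimes> y \<in> I \<and> y \<otimes> x \<in> I"
    using I by (simp add: graded_ideal_def)
qed

lemma coset_mem: "y \<in> I +> x \<longleftrightarrow> (\<exists>i\<in>I. y = i \<oplus> x)"
  by (auto simp: a_r_coset_def')

lemma coset_eq_iff:
  assumes x: "x \<in> carrier A" and y: "y \<in> carrier A"
  shows "I +> x = I +> y \<longleftrightarrow> x \<ominus> y \<in> I"
proof
  assume "I +> x = I +> y"
  moreover have "x \<in> I +> x" unfolding coset_mem using ideal_zero x by (intro bexI[of _ \<zero>]) simp_all
  ultimately have "x \<in> I +> y" by simp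
  then obtain i where i: "i \<in> I" and e: "x = i \<oplus> y" unfolding coset_mem by blast
  have "x \<ominus> y = i" unfolding e using ideal_subset[OF i] y by (simp add: minus_eq a_assoc r_neg)
  then show "x \<ominus> y \<in> I" using i by simp
next
  assume d: "x \<ominus> y \<in> I"
  have "\<ominus> (x \<ominus> y) = y \<ominus> x"
    using x y a_comm[of "\<ominus> x" y] by (simp add: minus_eq minus_add)
  then have m: "y \<ominus> x \<in> I" using ideal_minus[OF d] by simp
  have *: "u \<in> I +> y" if u: "u \<in> I +> x" and "x \<ominus> y \<in> I" "x \<in> carrier A" "y \<in> carrier A" for u x y
  proof -
    obtain i where i: "i \<in> I" "u = i \<oplus> x" using u unfolding coset_mem by blast
    have "u = (i \<oplus> (x \<ominus> y)) \<oplus> y"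
      unfolding i(2) using that ideal_subset[OF i(1)] by (simp add: minus_eq a_assoc l_neg)
    then show ?thesis using ideal_add[OF i(1) that(2)] unfolding coset_mem by blast
  qed
  show "I +> x = I +> y" 
  proof (intro subset_antisym subsetI)
    show "u \<in> I +> y" if "u \<in> I +> x" for u using that d x y by (rule *)
    show "u \<in> I +> x" if "u \<in> I +> y" for u using that m y x by (rule *)
  qed
qed

lemma coset_eq_ideal:
  assumes "x \<in> carrier A"
  shows "I +> x = I \<longleftrightarrow> x \<in> I"
proof -
  have "I +> \<zero> = I" using a_coset_add_zero[of I] ideal_subset by blast
  moreover have "x \<ominus> \<zero> = x" using assms by (simp add: minus_eq)
  ultimately show ?thesis using coset_eq_iff[of x \<zero>] assms by simp
qed

lemma coset_self: "x \<in> carrier A \<Longrightarrow> x \<in> I +> x"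
  unfolding coset_mem using ideal_zero by (intro bexI[of _ \<zero>]) simp_all

lemma quotient_simps [simp]:
  "carrier (quotient_superalgebra A I) = a_rcosets I"
  "zero (quotient_superalgebra A I) = I"
  "add (quotient_superalgebra A I) = set_add A"
  "mult (quotient_superalgebra A I) = rcoset_mult A I"
  "smult (quotient_superalgebra A I) = (\<lambda>c X. \<Union>x\<in>X. I +> (c \<odot> x))"
  "part (quotient_superalgebra A I) i = (\<lambda>x. I +> x) ` part A i"
  by (simp_all add: quotient_superalgebra_def)

lemma UN_const: "\<lbrakk>x \<in> X; \<And>y. y \<in> X \<Longrightarrow> F y = F x\<rbrakk> \<Longrightarrow> (\<Union>y\<in>X. F y) = F x"
  by blast

lemma quotient_hom: "algebra_hom A (quotient_superalgebra A I) (\<lambda>x. I +> x)"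
  unfolding algebra_hom_def quotient_simps
proof (intro conjI ballI allI)
  show "(\<lambda>x. I +> x) \<in> carrier A \<rightarrow> a_rcosets I"
    by (auto simp: A_RCOSETS_def')
  show "I +> \<zero> = I" using coset_eq_ideal[of \<zero>] ideal_zero by simp
next
  fix x y assume x: "x \<in> carrier A" and y: "y \<in> carrier A"
  have "subgroup I (add_monoid A)" using I by (simp add: graded_ideal_def submodule_def)
  then have "additive_subgroup I A" by (rule additive_subgroup.intro)
  moreover have "abelian_group A" by unfold_locales
  ultimately have "abelian_subgroup I A" by (rule abelian_subgroupI3)
  then show "I +> (x \<oplus> y) = (I +> x) <+>\<^bsub>A\<^esub> (I +> y)"
    using abelian_subgroup.a_rcos_sum x y by metis
  have *: "I +> (u \<otimes> v) = I +> (x \<otimes> y)" if uv: "u \<in> I +> x" "v \<in> I +> y" for u v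
  proof -
    obtain i j where ij: "i \<in> I" "u = i \<oplus> x" "j \<in> I" "v = j \<oplus> y" using uv unfolding coset_mem by blast
    note c = ideal_subset[OF ij(1)] ideal_subset[OF ij(3)] x y
    have e: "u \<otimes> v = (i \<otimes> v \<oplus> x \<otimes> j) \<oplus> x \<otimes> y"
      using c unfolding ij by (simp add: mult_add_left mult_add_right mult_closed a_ac)
    have "u \<otimes> v \<ominus> x \<otimes> y = i \<otimes> v \<oplus> x \<otimes> j"
      unfolding e using c ij by (simp add: minus_eq a_assoc r_neg mult_closed)
    moreover have "i \<otimes> v \<oplus> x \<otimes> j \<in> I"
      using ideal_add ideal_mult ij c by simp
    ultimately show ?thesis using c ij by (subst coset_eq_iff) (simp_all add: mult_closed)
  qed
  have "(\<Union>v\<in>I +> y. I +> (u \<otimes> v)) = I +> (x \<otimes> y)" if "u \<in> I +> x" for u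
    using UN_const[OF coset_self[OF y], of "\<lambda>v. I +> (u \<otimes> v)"] *[OF that] *[OF that coset_self[OF y]] by metis
  then have "rcoset_mult A I (I +> x) (I +> y) = I +> (x \<otimes> y)"
    unfolding rcoset_mult_def using UN_const[OF coset_self[OF x], of "\<lambda>u. \<Union>v\<in>I +> y. I +> (u \<otimes> v)"] coset_self[OF x]
    by metis
  then show "I +> (x \<otimes> y) = rcoset_mult A I (I +> x) (I +> y)" by simp
next
  fix c x assume x: "x \<in> carrier A"
  have "I +> (c \<odot> u) = I +> (c \<odot> x)" if u: "u \<in> I +> x" for u
  proof -
    obtain i where i: "i \<in> I" "u = i \<oplus> x" using u unfolding coset_mem by blast
    then have "c \<odot> u \<ominus> c \<odot> x = c \<odot> i"
      using ideal_subset[OF i(1)] x by (simp add: scale_add minus_eq a_assoc r_neg)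
    then show ?thesis using ideal_scale[OF i(1)] ideal_subset[OF i(1)] i x by (subst coset_eq_iff) simp_all
  qed
  then show "I +> (c \<odot> x) = (\<Union>u\<in>I +> x. I +> (c \<odot> u))"
    using UN_const[OF coset_self[OF x], of "\<lambda>u. I +> (c \<odot> u)"] by simp
qed

lemma ideal_graded:
  assumes x: "x \<in> part A 0" and y: "y \<in> part A 1" and xy: "x \<oplus> y \<in> I"
  shows "x \<in> I \<and> y \<in> I"
proof -
  have "I = (I \<inter> part A 0) <+>\<^bsub>A\<^esub> (I \<inter> part A 1)" using I by (simp add: graded_ideal_def)
  then obtain u v where u: "u \<in> I" "u \<in> part A 0" and v: "v \<in> I" "v \<in> part A 1" and e: "x \<oplus> y = u \<oplus> v"
    using xy unfolding set_add_def' by blast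
  have minus: "\<ominus> z \<in> part A i" if "z \<in> part A i" for z i
    using part_scale[OF that, of "- 1"] minus_one_scale part_carrier[OF that] by simp
  note c = part_carrier[OF x] part_carrier[OF y] part_carrier[OF u(2)] part_carrier[OF v(2)]
  have "x \<oplus> \<ominus> u = v \<oplus> \<ominus> y"
  proof -
    have "x \<oplus> \<ominus> u = (x \<oplus> \<ominus> u) \<oplus> (y \<oplus> \<ominus> y)" using c by (simp add: r_neg)
    also have "\<dots> = (x \<oplus> y) \<oplus> (\<ominus> u \<oplus> \<ominus> y)" using c by (simp add: a_ac)
    also have "\<dots> = (u \<oplus> \<ominus> u) \<oplus> (v \<oplus> \<ominus> y)" unfolding e using c by (simp add: a_ac)
    also have "\<dots> = v \<oplus> \<ominus> y" using c by (simp add: r_neg)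
    finally show ?thesis .
  qed
  then have "x \<oplus> \<ominus> u = \<zero>"
    using direct[of "x \<oplus> \<ominus> u"] part_add[OF x minus[OF u(2)]] part_add[OF v(2) minus[OF y]] by simp
  then have "x = u" using difference_zero[of x u] c by (simp add: minus_eq)
  moreover from this have "y = v" using e c by simp
  ultimately show ?thesis using u v by simp
qed

lemma quotient_superalgebra: "superalgebra (quotient_superalgebra A I)"
proof (rule superalgebra_image[OF superalgebra_axioms quotient_hom])
  show "(\<lambda>x. I +> x) ` carrier A = carrier (quotient_superalgebra A I)"
    by (auto simp: A_RCOSETS_def')
  show "part (quotient_superalgebra A I) i = (\<lambda>x. I +> x) ` part A i" for i by simp
  fix x y assume x: "x \<in> part A 0" and y: "y \<in> part A 1" and xy: "I +> x = I +> y"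
  have "x \<ominus> y \<in> I" using xy coset_eq_iff part_carrier x y by blast
  moreover have "\<ominus> y \<in> part A 1"
    using part_scale[OF y, of "- 1"] minus_one_scale part_carrier[OF y] by simp
  ultimately have "x \<in> I" using ideal_graded[OF x] by (simp add: minus_eq)
  then show "I +> x = zero (quotient_superalgebra A I)"
    using coset_eq_ideal part_carrier[OF x] by simp
qed

lemma quotient_value_zero_iff:
  assumes a: "\<And>v. a v \<in> carrier A"
  shows "npoly_value (quotient_superalgebra A I) (\<lambda>v. I +> a v) f = zero (quotient_superalgebra A I)
    \<longleftrightarrow> npoly_value A a f \<in> I"
proof -
  interpret Q: superalgebra "quotient_superalgebra A I" by (rule quotient_superalgebra)
  show ?thesis
    using algebra_hom_npoly_value[OF nonassoc_algebra_axioms Q.nonassoc_algebra_axioms quotient_hom, of a f] a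
      coset_eq_ideal[OF npoly_value_closed[of a f]]
    by simp
qed

text \<open>Homogeneous elements of the quotient are the cosets of homogeneous elements, so superidentities of the quotient
can be read off upstairs.\<close>

lemma quotient_satisfies_super_iff:
  "satisfies_super (quotient_superalgebra A I) f \<longleftrightarrow>
    (\<forall>p a. (\<forall>v. a v \<in> part A (p v)) \<longrightarrow> npoly_value A a (superization p f) \<in> I)"
proof
  assume s: "satisfies_super (quotient_superalgebra A I) f"
  show "\<forall>p a. (\<forall>v. a v \<in> part A (p v)) \<longrightarrow> npoly_value A a (superization p f) \<in> I"
  proof (intro allI impI)
    fix p and a :: "nat \<Rightarrow> 'a" assume a: "\<forall>v. a v \<in> part A (p v)"
    then have "npoly_value (quotient_superalgebra A I) (\<lambda>v. I +> a v) (superization p f) = zero (quotient_superalgebra A I)"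
      using s[unfolded satisfies_super_def, rule_format, of "\<lambda>v. I +> a v" p] by simp
    moreover have "\<And>v. a v \<in> carrier A" using a part_carrier by blast
    ultimately show "npoly_value A a (superization p f) \<in> I"
      using quotient_value_zero_iff[of a] by blast
  qed
next
  assume s: "\<forall>p a. (\<forall>v. a v \<in> part A (p v)) \<longrightarrow> npoly_value A a (superization p f) \<in> I"
  show "satisfies_super (quotient_superalgebra A I) f"
    unfolding satisfies_super_def
  proof (intro allI impI)
    fix p and b :: "nat \<Rightarrow> 'a set" assume "\<forall>v. b v \<in> part (quotient_superalgebra A I) (p v)"
    then have "\<forall>v. \<exists>x. x \<in> part A (p v) \<and> b v = I +> x" by auto
    then obtain a where a: "\<And>v. a v \<in> part A (p v)" "\<And>v. b v = I +> a v" by metis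
    then have "b = (\<lambda>v. I +> a v)" by auto
    moreover have "\<And>v. a v \<in> carrier A" using a(1) part_carrier by blast
    moreover have "npoly_value A a (superization p f) \<in> I" using s a(1) by blast
    ultimately show "npoly_value (quotient_superalgebra A I) b (superization p f) = zero (quotient_superalgebra A I)"
      using quotient_value_zero_iff[of a] by blast
  qed
qed

end

end


lemma (in superalgebra) graded_idealI:
  assumes "I \<subseteq> carrier A" "\<zero> \<in> I" "\<And>x y. \<lbrakk>x \<in> I; y \<in> I\<rbrakk> \<Longrightarrow> x \<oplus> y \<in> I" "\<And>c x. x \<in> I \<Longrightarrow> c \<odot> x \<in> I"
    and "\<And>x y. \<lbrakk>x \<in> carrier A; y \<in> I\<rbrakk> \<Longrightarrow> x \<otimes> y \<in> I \<and> y \<otimes> x \<in> I"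
    and graded: "\<And>x y. \<lbrakk>x \<in> part A 0; y \<in> part A 1; x \<oplus> y \<in> I\<rbrakk> \<Longrightarrow> x \<in> I \<and> y \<in> I"
  shows "graded_ideal A I"
  unfolding graded_ideal_def
proof (intro conjI ballI)
  show "submodule I scalars A"
  proof (rule submoduleI)
    show "\<ominus> x \<in> I" if "x \<in> I" for x
      using assms(4)[OF that, of "- 1"] subsetD[OF assms(1) that] by (simp add: minus_one_scale)
  qed (use assms in auto)
  show "I = (I \<inter> part A 0) <+>\<^bsub>A\<^esub> (I \<inter> part A 1)"
  proof (intro subset_antisym subsetI)
    fix x assume x: "x \<in> I"
    then obtain y z where yz: "y \<in> part A 0" "z \<in> part A 1" "x = y \<oplus> z" using assms(1) decompose by blast
    then have "y \<in> I \<and> z \<in> I" using graded x by simp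
    then show "x \<in> (I \<inter> part A 0) <+>\<^bsub>A\<^esub> (I \<inter> part A 1)" using yz unfolding set_add_def' by blast
  next
    fix x assume "x \<in> (I \<inter> part A 0) <+>\<^bsub>A\<^esub> (I \<inter> part A 1)"
    then show "x \<in> I" using assms(3) unfolding set_add_def' by blast
  qed
qed (use assms in auto)

lemma (in superalgebra) graded_ideal_Inter:
  assumes "\<I> \<noteq> {}" "\<And>I. I \<in> \<I> \<Longrightarrow> graded_ideal A I"
  shows "graded_ideal A (\<Inter>\<I>)"
proof (rule graded_idealI)
  note G = assms(2)
  show "\<Inter>\<I> \<subseteq> carrier A" using assms(1) ideal_subset[OF G] by blast
  show "\<zero> \<in> \<Inter>\<I>" using ideal_zero[OF G] by blast
  show "x \<oplus> y \<in> \<Inter>\<I>" if "x \<in> \<Inter>\<I>" "y \<in> \<Inter>\<I>" for x y using that ideal_add[OF G] by blast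
  show "c \<odot> x \<in> \<Inter>\<I>" if "x \<in> \<Inter>\<I>" for c x using that ideal_scale[OF G] by blast
  show "x \<otimes> y \<in> \<Inter>\<I> \<and> y \<otimes> x \<in> \<Inter>\<I>" if "x \<in> carrier A" "y \<in> \<Inter>\<I>" for x y
    using that ideal_mult[OF G] by blast
  show "x \<in> \<Inter>\<I> \<and> y \<in> \<Inter>\<I>" if "x \<in> part A 0" "y \<in> part A 1" "x \<oplus> y \<in> \<Inter>\<I>" for x y
    using that ideal_graded[OF G] by blast
qed

lemma (in superalgebra) graded_ideal_carrier: "graded_ideal A (carrier A)"
  by (rule graded_idealI) (auto simp: part_carrier mult_closed)

subsection \<open>The free superalgebra\<close>

lemma word_parity_simps [simp]:
  "word_parity (Gen (Inl i)) = 0" "word_parity (Gen (Inr j)) = 1"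
  "word_parity (Times u w) = word_parity u + word_parity w"
  by (simp_all add: word_parity_def)

lemma free_superalgebra_simps [simp]:
  "carrier (free_superalgebra r s) = npolys_on r s"
  "zero (free_superalgebra r s) = 0"
  "add (free_superalgebra r s) = (+)"
  "mult (free_superalgebra r s) = (\<star>)"
  "smult (free_superalgebra r s) = npoly_scale"
  "part (free_superalgebra r s) i = {f \<in> npolys_on r s. \<forall>w\<in>Poly_Mapping.keys f. word_parity w = i}"
  by (simp_all add: free_superalgebra_def)

abbreviation on_letters :: "nat \<Rightarrow> nat \<Rightarrow> (nat + nat) word \<Rightarrow> bool" where
  "on_letters r s w \<equiv> set (letters w) \<subseteq> Inl ` {..<r} \<union> Inr ` {..<s}"

lemma npolys_onD: "\<lbrakk>f \<in> npolys_on r s; w \<in> Poly_Mapping.keys f\<rbrakk> \<Longrightarrow> on_letters r s w"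
  by (auto simp: npolys_on_def)

lemma npolys_onI: "(\<And>w. w \<in> Poly_Mapping.keys f \<Longrightarrow> on_letters r s w) \<Longrightarrow> f \<in> npolys_on r s"
  by (simp add: npolys_on_def)

lemma free_superalgebra: "superalgebra (free_superalgebra r s :: ('f::field, (nat + nat, 'f) npoly) superalg)"
proof (rule superalgebraI)
  have add: "f + g \<in> npolys_on r s" if "f \<in> npolys_on r s" "g \<in> npolys_on r s" for f g :: "(nat + nat, 'f) npoly"
    using that keys_add[of f g] by (intro npolys_onI) (blast dest: npolys_onD)
  have scale: "npoly_scale c f \<in> npolys_on r s" if "f \<in> npolys_on r s" for c and f :: "(nat + nat, 'f) npoly"
    using that keys_npoly_scale[of c f] by (intro npolys_onI) (blast dest: npolys_onD)
  have mult: "f \<star> g \<in> npolys_on r s" if "f \<in> npolys_on r s" "g \<in> npolys_on r s" for f g :: "(nat + nat, 'f) npoly"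
  proof (rule npolys_onI)
    fix w assume "w \<in> Poly_Mapping.keys (f \<star> g)"
    then obtain u v where "u \<in> Poly_Mapping.keys f" "v \<in> Poly_Mapping.keys g" "w = Times u v"
      using keys_npoly_times by blast
    then show "on_letters r s w" using npolys_onD[OF that(1), of u] npolys_onD[OF that(2), of v] by simp
  qed
  let ?A = "free_superalgebra r s :: ('f, (nat + nat, 'f) npoly) superalg"
  show "nonassoc_algebra ?A"
  proof (rule nonassoc_algebraI)
    fix f g h :: "(nat + nat, 'f) npoly" and c d :: 'f
    show "\<zero>\<^bsub>?A\<^esub> \<in> carrier ?A" by (simp add: npolys_on_def)
    show "f \<oplus>\<^bsub>?A\<^esub> g \<oplus>\<^bsub>?A\<^esub> h = f \<oplus>\<^bsub>?A\<^esub> (g \<oplus>\<^bsub>?A\<^esub> h)" "f \<oplus>\<^bsub>?A\<^esub> g = g \<oplus>\<^bsub>?A\<^esub> f" "\<zero>\<^bsub>?A\<^esub> \<oplus>\<^bsub>?A\<^esub> f = f"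
      by (simp_all add: add_ac)
    show "(- 1) \<odot>\<^bsub>?A\<^esub> f \<oplus>\<^bsub>?A\<^esub> f = \<zero>\<^bsub>?A\<^esub>" "(c + d) \<odot>\<^bsub>?A\<^esub> f = c \<odot>\<^bsub>?A\<^esub> f \<oplus>\<^bsub>?A\<^esub> d \<odot>\<^bsub>?A\<^esub> f"
      "(c * d) \<odot>\<^bsub>?A\<^esub> f = c \<odot>\<^bsub>?A\<^esub> (d \<odot>\<^bsub>?A\<^esub> f)" "1 \<odot>\<^bsub>?A\<^esub> f = f"
      by (simp_all add: poly_mapping_eq_iff fun_eq_iff lookup_npoly_scale lookup_add algebra_simps)
    show "c \<odot>\<^bsub>?A\<^esub> (f \<oplus>\<^bsub>?A\<^esub> g) = c \<odot>\<^bsub>?A\<^esub> f \<oplus>\<^bsub>?A\<^esub> c \<odot>\<^bsub>?A\<^esub> g"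
      by (simp add: npoly_scale_add)
    show "(f \<oplus>\<^bsub>?A\<^esub> g) \<otimes>\<^bsub>?A\<^esub> h = f \<otimes>\<^bsub>?A\<^esub> h \<oplus>\<^bsub>?A\<^esub> g \<otimes>\<^bsub>?A\<^esub> h" "f \<otimes>\<^bsub>?A\<^esub> (g \<oplus>\<^bsub>?A\<^esub> h) = f \<otimes>\<^bsub>?A\<^esub> g \<oplus>\<^bsub>?A\<^esub> f \<otimes>\<^bsub>?A\<^esub> h"
      by (simp_all add: npoly_times_add_left npoly_times_add_right)
    show "(c \<odot>\<^bsub>?A\<^esub> f) \<otimes>\<^bsub>?A\<^esub> g = c \<odot>\<^bsub>?A\<^esub> (f \<otimes>\<^bsub>?A\<^esub> g)" "f \<otimes>\<^bsub>?A\<^esub> (c \<odot>\<^bsub>?A\<^esub> g) = c \<odot>\<^bsub>?A\<^esub> (f \<otimes>\<^bsub>?A\<^esub> g)"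
      by (simp_all add: npoly_times_scale_left npoly_times_scale_right)
  qed (simp_all add: add scale mult)
  fix i j and f g :: "(nat + nat, 'f) npoly" and c :: 'f
  show "part ?A i \<subseteq> carrier ?A" "\<zero>\<^bsub>?A\<^esub> \<in> part ?A i" by (auto simp: npolys_on_def)
  show "f \<oplus>\<^bsub>?A\<^esub> g \<in> part ?A i" if "f \<in> part ?A i" "g \<in> part ?A i"
    using that keys_add[of f g] add by auto
  show "c \<odot>\<^bsub>?A\<^esub> f \<in> part ?A i" if "f \<in> part ?A i"
    using that keys_npoly_scale[of c f] scale by auto
  show "f \<otimes>\<^bsub>?A\<^esub> g \<in> part ?A (i + j)" if "f \<in> part ?A i" "g \<in> part ?A j"
    using that mult[of f g] keys_npoly_times[of _ f g] by fastforce
  show "f = \<zero>\<^bsub>?A\<^esub>" if f: "f \<in> part ?A 0" "f \<in> part ?A 1"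
  proof -
    have "Poly_Mapping.keys f = {}" using f by auto
    then show ?thesis by simp
  qed
  show "\<exists>y\<in>part ?A 0. \<exists>z\<in>part ?A 1. f = y \<oplus>\<^bsub>?A\<^esub> z" if f: "f \<in> carrier ?A"
  proof -
    define comp where "comp i = Poly_Mapping.mapp (\<lambda>w c. if word_parity w = i then c else 0) f" for i
    have look: "Poly_Mapping.lookup (comp i) w = (if word_parity w = i then Poly_Mapping.lookup f w else 0)" for i w
      by (simp add: comp_def lookup_mapp when_def in_keys_iff)
    have "comp i \<in> part ?A i" for i
      using f by (auto simp: npolys_on_def in_keys_iff look split: if_splits)
    moreover have "f = comp 0 + comp 1"
    proof (rule poly_mapping_eqI)
      show "Poly_Mapping.lookup f w = Poly_Mapping.lookup (comp 0 + comp 1) w" for w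
        using bit_cases[of "word_parity w"] by (auto simp: lookup_add look)
    qed
    ultimately show ?thesis by (metis free_superalgebra_simps(3))
  qed
qed

context superalgebra
begin

context
  fixes b :: "nat + nat \<Rightarrow> 'a"
  assumes b: "\<And>i. b (Inl i) \<in> part A 0" "\<And>j. b (Inr j) \<in> part A 1"
begin

lemma b_carrier: "b v \<in> carrier A"
  using b part_carrier by (cases v) auto

lemma word_value_part: "word_value A b w \<in> part A (word_parity w)"
proof (induction w)
  case (Gen v)
  then show ?case using b by (cases v) auto
qed (simp only: word_parity_simps word_value.simps part_mult)

lemma npoly_value_part:
  assumes "\<forall>w\<in>Poly_Mapping.keys f. word_parity w = i"
  shows "npoly_value A b f \<in> part A i"
  unfolding npoly_value_def
  using assms word_value_part part_scale by (intro part_finsum) auto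

lemma evaluation_hom: "algebra_hom (free_superalgebra r s) A (npoly_value A b)"
  by (simp add: algebra_hom_def npoly_value_closed b_carrier npoly_value_add npoly_value_times npoly_value_scale)

definition evaluation_kernel :: "nat \<Rightarrow> nat \<Rightarrow> (nat + nat, 'f) npoly set" where
  "evaluation_kernel r s = {f \<in> npolys_on r s. npoly_value A b f = \<zero>}"

lemma evaluation_kernel_graded_ideal: "graded_ideal (free_superalgebra r s) (evaluation_kernel r s)"
proof -
  interpret F: superalgebra "free_superalgebra r s :: ('f, (nat + nat, 'f) npoly) superalg" by (rule free_superalgebra)
  note c = npoly_value_closed[of b, OF b_carrier]
  show ?thesis
  proof (rule F.graded_idealI)
    fix f g :: "(nat + nat, 'f) npoly"
    assume f: "f \<in> part (free_superalgebra r s) 0" and g: "g \<in> part (free_superalgebra r s) 1"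
      and fg: "f \<oplus>\<^bsub>free_superalgebra r s\<^esub> g \<in> evaluation_kernel r s"
    have f0: "npoly_value A b f \<in> part A 0" and g1: "npoly_value A b g \<in> part A 1"
      using f g by (auto intro: npoly_value_part)
    have sum: "npoly_value A b f \<oplus> npoly_value A b g = \<zero>"
      using fg by (simp add: evaluation_kernel_def npoly_value_add b_carrier)
    then have "npoly_value A b f = (- 1) \<odot> npoly_value A b g"
      using c minus_equality by (simp add: minus_one_scale)
    then have "npoly_value A b f \<in> part A 1" using part_scale[OF g1] by simp
    then have "npoly_value A b f = \<zero>" using direct f0 by simp
    with sum c have "npoly_value A b f = \<zero> \<and> npoly_value A b g = \<zero>" by simp
    then show "f \<in> evaluation_kernel r s \<and> g \<in> evaluation_kernel r s"
      using f g by (simp add: evaluation_kernel_def)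
  next
    show "\<zero>\<^bsub>free_superalgebra r s\<^esub> \<in> evaluation_kernel r s"
      by (simp add: evaluation_kernel_def npolys_on_def)
  next
    fix c and f :: "(nat + nat, 'f) npoly" assume f: "f \<in> evaluation_kernel r s"
    show "c \<odot>\<^bsub>free_superalgebra r s\<^esub> f \<in> evaluation_kernel r s"
      using f F.scale_closed[of f c] by (simp add: evaluation_kernel_def npoly_value_scale b_carrier)
  qed (use F.mult_closed F.a_closed in \<open>auto simp: evaluation_kernel_def npoly_value_add npoly_value_times npoly_value_scale b_carrier c\<close>)
qed

text \<open>The quotient embeds into \<open>A\<close>, so it satisfies what \<open>A\<close> satisfies. This makes the kernel of an evaluation one of
the ideals whose intersection is the verbal ideal.\<close>

lemma evaluation_kernel_satisfies:
  assumes "satisfies_super A f"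
  shows "satisfies_super (quotient_superalgebra (free_superalgebra r s) (evaluation_kernel r s)) f"
proof -
  interpret F: superalgebra "free_superalgebra r s :: ('f, (nat + nat, 'f) npoly) superalg" by (rule free_superalgebra)
  show ?thesis
    unfolding F.quotient_satisfies_super_iff[OF evaluation_kernel_graded_ideal]
  proof (intro allI impI)
    fix p and a :: "nat \<Rightarrow> (nat + nat, 'f) npoly"
    assume a: "\<forall>v. a v \<in> part (free_superalgebra r s) (p v)"
    then have ac: "a v \<in> carrier (free_superalgebra r s)" for v using F.part_carrier by blast
    have "npoly_value A b (npoly_value (free_superalgebra r s) a (superization p f)) =
      npoly_value A (\<lambda>v. npoly_value A b (a v)) (superization p f)"
      using algebra_hom_npoly_value[OF F.nonassoc_algebra_axioms nonassoc_algebra_axioms evaluation_hom ac] .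
    also have "\<dots> = \<zero>"
    proof -
      have "\<forall>v. npoly_value A b (a v) \<in> part A (p v)"
        using a by (auto intro: npoly_value_part)
      then show ?thesis using assms unfolding satisfies_super_def by simp
    qed
    finally show "npoly_value (free_superalgebra r s) a (superization p f) \<in> evaluation_kernel r s"
      using F.npoly_value_closed[of a] ac by (simp add: evaluation_kernel_def)
  qed
qed

end

end

subsection \<open>Free superalgebras of the variety\<close>

text \<open>The zero algebra lies in the variety, so the whole algebra is one of the ideals in the intersection; and graded
ideals are closed under nonempty intersections.\<close>

lemma verbal_ideal_graded:
  "graded_ideal (free_superalgebra r s :: ('f::field_char_0, (nat + nat, 'f) npoly) superalg)
     (verbal_ideal jordan_metabelian (free_superalgebra r s))"
proof -
  interpret F: superalgebra "free_superalgebra r s :: ('f, (nat + nat, 'f) npoly) superalg" by (rule free_superalgebra)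
  let ?F = "free_superalgebra r s :: ('f, (nat + nat, 'f) npoly) superalg"
  have g: "graded_ideal ?F (carrier ?F)" by (rule F.graded_ideal_carrier)
  have "satisfies_super (quotient_superalgebra ?F (carrier ?F)) f" for f
    unfolding F.quotient_satisfies_super_iff[OF g]
    using F.part_carrier by (blast intro: F.npoly_value_closed)
  then have "variety_superalgebra jordan_metabelian (quotient_superalgebra ?F (carrier ?F))"
    using F.quotient_superalgebra[OF g] by (simp add: variety_superalgebra_iff)
  with g show ?thesis
    unfolding verbal_ideal_def by (intro F.graded_ideal_Inter) auto
qed

text \<open>The free superalgebra of the variety is a subdirect product of the quotients from which the verbal ideal is formed.\<close>

lemma free_variety_superalgebra_satisfies:
  assumes f: "\<And>B :: ('f::field_char_0, (nat + nat, 'f) npoly set) superalg.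
    variety_superalgebra jordan_metabelian B \<Longrightarrow> satisfies_super B f"
  shows "satisfies_super (free_variety_superalgebra jordan_metabelian r s) f"
proof -
  let ?F = "free_superalgebra r s :: ('f, (nat + nat, 'f) npoly) superalg"
  interpret F: superalgebra ?F by (rule free_superalgebra)
  show ?thesis
    unfolding free_variety_superalgebra_def F.quotient_satisfies_super_iff[OF verbal_ideal_graded]
  proof (intro allI impI)
    fix p and a :: "nat \<Rightarrow> (nat + nat, 'f) npoly" assume a: "\<forall>v. a v \<in> part ?F (p v)"
    have "npoly_value ?F a (superization p f) \<in> I"
      if I: "graded_ideal ?F I" "variety_superalgebra jordan_metabelian (quotient_superalgebra ?F I)" for I
      using f[OF I(2)] a unfolding F.quotient_satisfies_super_iff[OF I(1)] by blast
    then show "npoly_value ?F a (superization p f) \<in> verbal_ideal jordan_metabelian ?F"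
      unfolding verbal_ideal_def by blast
  qed
qed

theorem free_variety_superalgebra_in_variety:
  "variety_superalgebra jordan_metabelian
    (free_variety_superalgebra jordan_metabelian r s :: ('f::field_char_0, (nat + nat, 'f) npoly set) superalg)"
proof -
  let ?F = "free_superalgebra r s :: ('f, (nat + nat, 'f) npoly) superalg"
  interpret F: superalgebra ?F by (rule free_superalgebra)
  have "superalgebra (free_variety_superalgebra jordan_metabelian r s :: ('f, (nat + nat, 'f) npoly set) superalg)"
    unfolding free_variety_superalgebra_def by (rule F.quotient_superalgebra[OF verbal_ideal_graded])
  then show ?thesis
    unfolding variety_superalgebra_iff
    by (auto intro!: free_variety_superalgebra_satisfies simp: variety_superalgebra_iff)
qed

text \<open>The universal property, in the form in which it is used: a superidentity of the free superalgebra holds for all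
elements of \<open>A\<close> that are polynomials in images of the generators.\<close>

theorem free_variety_superalgebra_universal:
  fixes A :: "('f::field_char_0, 'a) superalg"
  assumes sat: "satisfies_super (free_variety_superalgebra jordan_metabelian r s) f"
    and A: "variety_superalgebra jordan_metabelian A"
    and b: "\<And>i. b (Inl i) \<in> part A 0" "\<And>j. b (Inr j) \<in> part A 1"
    and g: "\<And>v. g v \<in> part (free_superalgebra r s) (p v)"
  shows "npoly_value A (\<lambda>v. npoly_value A b (g v)) (superization p f) = \<zero>\<^bsub>A\<^esub>"
proof -
  let ?F = "free_superalgebra r s :: ('f, (nat + nat, 'f) npoly) superalg"
  interpret F: superalgebra ?F by (rule free_superalgebra)
  interpret superalgebra A using A by (simp add: variety_superalgebra_def)
  have K: "graded_ideal ?F (evaluation_kernel b r s)"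
    using b by (rule evaluation_kernel_graded_ideal)
  have "variety_superalgebra jordan_metabelian (quotient_superalgebra ?F (evaluation_kernel b r s))"
    unfolding variety_superalgebra_iff
    using A[unfolded variety_superalgebra_iff] F.quotient_superalgebra[OF K] evaluation_kernel_satisfies[of b, OF b]
    by auto
  then have "verbal_ideal jordan_metabelian ?F \<subseteq> evaluation_kernel b r s"
    unfolding verbal_ideal_def using K by blast
  moreover have "npoly_value ?F g (superization p f) \<in> verbal_ideal jordan_metabelian ?F"
    using sat g unfolding free_variety_superalgebra_def F.quotient_satisfies_super_iff[OF verbal_ideal_graded] by blast
  ultimately have "npoly_value A b (npoly_value ?F g (superization p f)) = \<zero>\<^bsub>A\<^esub>"
    unfolding evaluation_kernel_def[of b, OF b] by auto
  moreover have "\<And>v. g v \<in> carrier ?F" using g F.part_carrier by blast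
  ultimately show ?thesis
    using algebra_hom_npoly_value[OF F.nonassoc_algebra_axioms nonassoc_algebra_axioms evaluation_hom[of b, OF b], of g]
    by simp
qed


section \<open>Words in metabelian Jordan algebras\<close>

context metabelian_jordan
begin

text \<open>The elements annihilated by \<open>A\<^sup>2\<close>. They contain \<open>A\<^sup>2\<close>, but also elements such as \<open>1 \<otimes> (xy)\<close> with \<open>x\<close>, \<open>y\<close>
odd in a Grassmann envelope, which need not be sums of products there. Skew-symmetry of operators holds on all
of them.\<close>

definition sq_annihilator :: "'a set" where
  "sq_annihilator = {x \<in> carrier A. \<forall>y\<in>carrier A. \<forall>z\<in>carrier A. (y \<otimes> z) \<otimes> x = \<zero>}"

abbreviation opword :: "'a \<Rightarrow> 'a list \<Rightarrow> 'a" where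
  "opword \<equiv> foldl (\<otimes>)"

lemma annihilator_carrier: "x \<in> sq_annihilator \<Longrightarrow> x \<in> carrier A"
  by (simp add: sq_annihilator_def)

lemma product_annihilator: "\<lbrakk>x \<in> carrier A; y \<in> carrier A\<rbrakk> \<Longrightarrow> x \<otimes> y \<in> sq_annihilator"
  by (simp add: sq_annihilator_def mult_closed metabelian)

lemma opword_closed: "\<lbrakk>u \<in> carrier A; set vs \<subseteq> carrier A\<rbrakk> \<Longrightarrow> opword u vs \<in> carrier A"
  by (induction vs arbitrary: u) (auto simp: mult_closed)

lemma opword_annihilator: "\<lbrakk>u \<in> sq_annihilator; set vs \<subseteq> carrier A\<rbrakk> \<Longrightarrow> opword u vs \<in> sq_annihilator"
  by (induction vs arbitrary: u) (auto simp: product_annihilator annihilator_carrier)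

lemma opword_add: "\<lbrakk>u \<in> carrier A; u' \<in> carrier A; set vs \<subseteq> carrier A\<rbrakk>
    \<Longrightarrow> opword (u \<oplus> u') vs = opword u vs \<oplus> opword u' vs"
  by (induction vs arbitrary: u u') (auto simp: mult_closed mult_add_left)

lemma opword_scale: "\<lbrakk>u \<in> carrier A; set vs \<subseteq> carrier A\<rbrakk> \<Longrightarrow> opword (c \<odot> u) vs = c \<odot> opword u vs"
  by (induction vs arbitrary: u) (auto simp: mult_closed mult_smult_left)

lemma opword_minus: "\<lbrakk>u \<in> carrier A; set vs \<subseteq> carrier A\<rbrakk> \<Longrightarrow> opword (\<ominus> u) vs = \<ominus> opword u vs"
  using opword_scale[of u vs "- 1"] by (simp add: minus_one_scale opword_closed)

lemma opword_zero: "set vs \<subseteq> carrier A \<Longrightarrow> opword \<zero> vs = \<zero>"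
  by (induction vs) auto

text \<open>The Jordan identity for \<open>u, z, t\<close> with middle letter \<open>y\<close>: its term \<open>((zt)y)u\<close> is 0 by the choice of \<open>u\<close>.\<close>

lemma operators_skew3:
  assumes u: "u \<in> sq_annihilator" and c: "z \<in> carrier A" "y \<in> carrier A" "t \<in> carrier A"
  shows "((u \<otimes> z) \<otimes> y) \<otimes> t = \<ominus> (((u \<otimes> t) \<otimes> y) \<otimes> z)"
proof -
  note uc = annihilator_carrier[OF u]
  have "((z \<otimes> t) \<otimes> y) \<otimes> u = \<zero>"
    using u c by (auto simp: sq_annihilator_def mult_closed)
  then have "((u \<otimes> z) \<otimes> y) \<otimes> t \<oplus> ((u \<otimes> t) \<otimes> y) \<otimes> z = \<zero>"
    using jordan[of u y z t] uc c by (simp add: mult_closed comm[of t u])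
  then show ?thesis
    using uc c by (intro minus_equality[symmetric]) (simp_all add: mult_closed)
qed

text \<open>Exchanging \<open>z\<close> with the entry two places further on, recursively exchanging it with \<open>t\<close>, and moving that entry
back takes three sign changes.\<close>

lemma operators_skew:
  assumes "odd (length mid)" "u \<in> sq_annihilator" "set (z # mid @ [t]) \<subseteq> carrier A"
  shows "opword u (z # mid @ [t]) = \<ominus> opword u (t # mid @ [z])"
  using assms
proof (induction "length mid" arbitrary: mid u z t rule: less_induct)
  case less
  show ?case
  proof (cases "length mid = 1")
    case True
    then obtain y where "mid = [y]" by (metis One_nat_def length_0_conv length_Suc_conv)
    with less.prems operators_skew3[of u z y t] show ?thesis by simp
  next
    case False
    then have "mid \<noteq> []" "tl mid \<noteq> []" using less.prems(1) by (cases mid; simp)+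
    then obtain y y' mid' where mid: "mid = y # y' # mid'" by (metis list.exhaust_sel)
    have len: "length mid' < length mid" "odd (length mid')" using mid less.prems(1) by auto
    have c: "y \<in> carrier A" "y' \<in> carrier A" "set mid' \<subseteq> carrier A" "z \<in> carrier A" "t \<in> carrier A" "u \<in> carrier A"
      using less.prems mid annihilator_carrier by auto
    note u = less.prems(2)
    have an: "(u \<otimes> y') \<otimes> y \<in> sq_annihilator" using c by (simp add: product_annihilator mult_closed)
    have "opword u (z # mid @ [t]) = opword (((u \<otimes> z) \<otimes> y) \<otimes> y') (mid' @ [t])"
      by (simp add: mid)
    also have "((u \<otimes> z) \<otimes> y) \<otimes> y' = \<ominus> (((u \<otimes> y') \<otimes> y) \<otimes> z)"
      using u c(4,1,2) by (rule operators_skew3)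
    also have "opword (\<ominus> (((u \<otimes> y') \<otimes> y) \<otimes> z)) (mid' @ [t]) = \<ominus> opword ((u \<otimes> y') \<otimes> y) (z # mid' @ [t])"
      using opword_minus[of "((u \<otimes> y') \<otimes> y) \<otimes> z" "mid' @ [t]"] c
      by (simp add: mult_closed del: foldl_append)
    also have "opword ((u \<otimes> y') \<otimes> y) (z # mid' @ [t]) = \<ominus> opword ((u \<otimes> y') \<otimes> y) (t # mid' @ [z])"
      using c by (intro less.hyps[OF len an]) simp
    also have "opword ((u \<otimes> y') \<otimes> y) (t # mid' @ [z]) = opword (((u \<otimes> y') \<otimes> y) \<otimes> t) (mid' @ [z])"
      by simp
    also have "((u \<otimes> y') \<otimes> y) \<otimes> t = \<ominus> (((u \<otimes> t) \<otimes> y) \<otimes> y')"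
      using u c(2,1,5) by (rule operators_skew3)
    also have "opword (\<ominus> (((u \<otimes> t) \<otimes> y) \<otimes> y')) (mid' @ [z]) = \<ominus> opword u (t # mid @ [z])"
      using opword_minus[of "((u \<otimes> t) \<otimes> y) \<otimes> y'" "mid' @ [z]"] c
      by (simp add: mult_closed mid del: foldl_append)
    finally show ?thesis
      using c mid by (simp add: opword_closed mult_closed)
  qed
qed

lemma operators_swap:
  assumes "odd (length mid)" "u \<in> sq_annihilator" "set (pre @ z # mid @ t # post) \<subseteq> carrier A"
  shows "opword u (pre @ z # mid @ t # post) = \<ominus> opword u (pre @ t # mid @ z # post)"
proof -
  have "opword u (pre @ z # mid @ t # post) = opword (opword (opword u pre) (z # mid @ [t])) post"
    by simp
  also have "opword (opword u pre) (z # mid @ [t]) = \<ominus> opword (opword u pre) (t # mid @ [z])"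
    using assms by (intro operators_skew opword_annihilator) auto
  also have "opword \<dots> post = \<ominus> opword (opword (opword u pre) (t # mid @ [z])) post"
    using assms annihilator_carrier by (intro opword_minus opword_closed) auto
  finally show ?thesis by simp
qed

lemma operators_repeat:
  assumes char: "(2 :: 'f) \<noteq> 0"
    and "odd (length mid)" "u \<in> sq_annihilator" "set (pre @ z # mid @ z # post) \<subseteq> carrier A"
  shows "opword u (pre @ z # mid @ z # post) = \<zero>"
proof -
  let ?x = "opword u (pre @ z # mid @ z # post)"
  have c: "?x \<in> carrier A" using assms(3,4) annihilator_carrier by (intro opword_closed) auto
  have "?x = \<ominus> ?x" using operators_swap[OF assms(2-4)] .
  then have "?x \<oplus> ?x = ?x \<oplus> \<ominus> ?x" by (rule arg_cong)
  also have "\<dots> = \<zero>" using c by (rule r_neg)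
  finally have "(1 + 1) \<odot> ?x = \<zero>" unfolding add_scale[OF c] one_scale[OF c] .
  then show ?thesis using scale_eq_zero[OF c, of 2] char by simp
qed

text \<open>For \<open>d\<close> in the second operator position this is the Jordan identity. Skew-symmetry moves any \<open>d\<close> at a position of the
same parity there, with the same sign in all three terms.\<close>

lemma jordan_exchange:
  assumes "odd (length pre)" "a \<in> carrier A" "b \<in> carrier A" "set (pre @ d # post) \<subseteq> carrier A"
  shows "opword (a \<otimes> b) (pre @ d # post) \<oplus> opword (b \<otimes> d) (pre @ a # post) \<oplus> opword (d \<otimes> a) (pre @ b # post) = \<zero>"
proof -
  have base: "opword (a \<otimes> b) (c # d # post) \<oplus> opword (b \<otimes> d) (c # a # post) \<oplus> opword (d \<otimes> a) (c # b # post) = \<zero>"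
    if "a \<in> carrier A" "b \<in> carrier A" "c \<in> carrier A" "d \<in> carrier A" "set post \<subseteq> carrier A" for a b c d post
  proof -
    have "opword (a \<otimes> b) (c # d # post) \<oplus> opword (b \<otimes> d) (c # a # post) \<oplus> opword (d \<otimes> a) (c # b # post) =
      opword (((a \<otimes> b) \<otimes> c) \<otimes> d \<oplus> ((b \<otimes> d) \<otimes> c) \<otimes> a \<oplus> ((d \<otimes> a) \<otimes> c) \<otimes> b) post"
      using that by (simp add: opword_add mult_closed)
    then show ?thesis using jordan[of a c b d] that by (simp add: opword_zero)
  qed
  obtain c pre1 where pre1: "pre = c # pre1" using assms(1) by (cases pre) auto
  show ?thesis
  proof (cases pre1)
    case Nil
    then show ?thesis using base assms pre1 by simp
  next
    case (Cons d1 mid)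
    have odd: "odd (length mid)" using assms(1) pre1 Cons by simp
    have cc: "c \<in> carrier A" "d \<in> carrier A" "d1 \<in> carrier A" "set mid \<subseteq> carrier A" "set post \<subseteq> carrier A"
      using assms(4) pre1 Cons by auto
    have sw: "opword (x \<otimes> y) (pre @ e # post) = \<ominus> opword (x \<otimes> y) (c # e # mid @ d1 # post)"
      if "x \<in> carrier A" "y \<in> carrier A" "e \<in> carrier A" for x y e
      using operators_swap[OF odd product_annihilator[OF that(1,2)], of "[c]" d1 e post] that cc
      by (simp add: pre1 Cons)
    let ?p = "opword (a \<otimes> b) (c # d # mid @ d1 # post)" and ?q = "opword (b \<otimes> d) (c # a # mid @ d1 # post)"
      and ?r = "opword (d \<otimes> a) (c # b # mid @ d1 # post)"
    have cl: "?p \<in> carrier A" "?q \<in> carrier A" "?r \<in> carrier A"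
      using assms(2,3) cc by (auto intro!: opword_closed mult_closed)
    have "?p \<oplus> ?q \<oplus> ?r = \<zero>" using base[of a b c d "mid @ d1 # post"] assms(2,3) cc by simp
    then have "\<ominus> (?p \<oplus> ?q \<oplus> ?r) = \<zero>" using minus_one_scale[of \<zero>] by simp
    then have "\<ominus> ?p \<oplus> \<ominus> ?q \<oplus> \<ominus> ?r = \<zero>" using cl by (simp only: minus_add a_closed)
    then show ?thesis using sw assms(2,3) cc by simp
  qed
qed

end

subsection \<open>Left-normed words\<close>

text \<open>The letters of a word in the order in which they are multiplied, if the word is left-normed up to
commutativity. All other words contain a product of two products, so they vanish in metabelian algebras.\<close>

fun left_normed :: "'v word \<Rightarrow> 'v list option" where
  "left_normed (Gen v) = Some [v]"
| "left_normed (Times u (Gen v)) = map_option (\<lambda>vs. vs @ [v]) (left_normed u)"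
| "left_normed (Times (Gen v) (Times u w)) = map_option (\<lambda>vs. vs @ [v]) (left_normed (Times u w))"
| "left_normed (Times (Times _ _) (Times _ _)) = None"

lemma left_normed_letters:
  "left_normed w = Some vs \<Longrightarrow> vs \<noteq> [] \<and> set vs = set (letters w) \<and> length vs = length (letters w)"
  by (induction w arbitrary: vs rule: left_normed.induct) auto

context metabelian_jordan
begin

lemma word_value_left_normed:
  assumes a: "\<And>v. a v \<in> carrier A"
  shows "word_value A a w = (case left_normed w of None \<Rightarrow> \<zero> | Some vs \<Rightarrow> opword (a (hd vs)) (map a (tl vs)))"
proof (induction w rule: left_normed.induct)
  case (2 u v)
  then show ?case
    using a left_normed_letters[of u] by (cases "left_normed u") auto
next
  case (3 v u w)
  have c: "word_value A a (Times u w) \<in> carrier A" using a by (intro word_value_closed)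
  have "word_value A a (Times (Gen v) (Times u w)) = word_value A a (Times u w) \<otimes> a v"
    using comm[OF a[of v] c] by simp
  then show ?case
    unfolding 3 using a left_normed_letters[of "Times u w"] by (cases "left_normed (Times u w)") auto
next
  case (4 u w u' w')
  have "word_value A a x \<in> carrier A" for x using a by (intro word_value_closed)
  then show ?case by (simp add: metabelian)
qed simp

end

subsection \<open>Alternating positions\<close>

text \<open>Positions are counted from 0. In an operator word these are the two sets of letters in which it is skew-symmetric.\<close>

fun evens odds :: "'v list \<Rightarrow> 'v set" where
  "evens [] = {}"
| "evens (v # vs) = insert v (odds vs)"
| "odds [] = {}"
| "odds (v # vs) = evens vs"

lemma evens_subset: "evens vs \<subseteq> set vs" and odds_subset: "odds vs \<subseteq> set vs"
  by (induction vs) auto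

lemma evens_append: "evens (us @ vs) = evens us \<union> (if even (length us) then evens vs else odds vs)"
  and odds_append: "odds (us @ vs) = odds us \<union> (if even (length us) then odds vs else evens vs)"
  by (induction us) auto

lemma evens_mem:
  assumes "distinct (us @ v # vs)"
  shows "v \<in> evens (us @ v # vs) \<longleftrightarrow> even (length us)"
  using assms evens_subset[of us] evens_subset[of vs] odds_subset[of vs] by (auto simp: evens_append)

lemma evens_split: "v \<in> evens vs \<Longrightarrow> \<exists>pre post. vs = pre @ v # post \<and> even (length pre)"
  and odds_split: "v \<in> odds vs \<Longrightarrow> \<exists>pre post. vs = pre @ v # post \<and> odd (length pre)"
proof (induction vs)
  case (Cons u vs)
  {
    case 1
    show ?case
    proof (cases "v = u")
      case True
      then show ?thesis by (intro exI[of _ "[]"] exI[of _ vs]) auto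
    next
      case False
      then obtain pre post where "vs = pre @ v # post" "odd (length pre)" using 1 Cons by auto
      then show ?thesis by (intro exI[of _ "u # pre"] exI[of _ post]) auto
    qed
  next
    case 2
    then obtain pre post where "vs = pre @ v # post" "even (length pre)" using Cons by auto
    then show ?case by (intro exI[of _ "u # pre"] exI[of _ post]) auto
  }
qed auto

lemma card_evens: "distinct vs \<Longrightarrow> card (evens vs) = (length vs + 1) div 2"
  and card_odds: "distinct vs \<Longrightarrow> card (odds vs) = length vs div 2"
proof (induction vs)
  case (Cons v vs)
  {
    case 1
    have "v \<notin> odds vs" "finite (odds vs)"
      using 1 odds_subset[of vs] finite_subset[OF odds_subset] by auto
    then show ?case using Cons 1 by simp
  next
    case 2
    then show ?case using Cons by simp
  }
qed auto

text \<open>Two arrangements with the same first entry and the same letters at even positions are connected by exchanges of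
entries whose positions have the same parity: the second list is built up from the left, each exchange bringing
the next letter to its place.\<close>

lemma rearrangement_invariant:
  assumes P: "\<And>pre z mid t post. \<lbrakk>pre \<noteq> []; odd (length mid); distinct (pre @ z # mid @ t # post);
      set (pre @ z # mid @ t # post) = V\<rbrakk> \<Longrightarrow> P (pre @ z # mid @ t # post) = P (pre @ t # mid @ z # post)"
    and vs: "distinct (s # vs)" "set (s # vs) = V" and ws: "distinct (s # ws)" "set (s # ws) = V"
    and ev: "evens (s # vs) = evens (s # ws)"
  shows "P (s # vs) = P (s # ws)"
proof -
  have "P (pre @ vs) = P (pre @ ws)"
    if "pre \<noteq> []" "distinct (pre @ vs)" "set (pre @ vs) = V" "distinct (pre @ ws)" "set (pre @ ws) = V"
      "evens (pre @ vs) = evens (pre @ ws)" for pre vs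
    using that
  proof (induction ws arbitrary: pre vs)
    case Nil
    then have "vs = []" by (cases vs) auto
    then show ?case by simp
  next
    case (Cons t ws)
    have "t \<in> set vs" using Cons.prems by auto
    then obtain mid0 post where vs: "vs = mid0 @ t # post" by (meson split_list)
    show ?case
    proof (cases mid0)
      case Nil
      then show ?thesis using Cons.IH[of "pre @ [t]" post] Cons.prems vs by simp
    next
      case c: (Cons z mid)
      have "even (length (pre @ mid0)) \<longleftrightarrow> t \<in> evens (pre @ vs)"
        using evens_mem[of "pre @ mid0" t post] Cons.prems(2) vs by simp
      also have "\<dots> \<longleftrightarrow> even (length pre)"
        using evens_mem[of pre t ws] Cons.prems(4,6) by simp
      finally have odd: "odd (length mid)" using c by (cases "even (length pre)") simp_all
      have "P (pre @ vs) = P (pre @ t # mid @ z # post)"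
        using P[of pre mid z t post] odd Cons.prems vs c by simp
      also have "\<dots> = P ((pre @ [t]) @ ws)"
      proof -
        have "evens (pre @ z # mid @ t # post) = evens (pre @ t # mid @ z # post)"
          using odd by (auto simp: evens_append odds_append)
        moreover have "distinct (pre @ t # mid @ z # post)" "set (pre @ t # mid @ z # post) = V"
          using Cons.prems(2,3) vs c by auto
        ultimately show ?thesis
          using Cons.IH[of "pre @ [t]" "mid @ z # post"] Cons.prems vs c by simp
      qed
      finally show ?thesis by simp
    qed
  qed
  from this[of "[s]" vs] show ?thesis using assms by simp
qed

text \<open>The sign of the permutation that sorts the list.\<close>

definition list_sign :: "nat list \<Rightarrow> 'f::field" where
  "list_sign = pair_prod (\<lambda>u v. if v < u then - 1 else 1)"

lemma list_sign_square: "list_sign vs * list_sign vs = (1 :: 'f::field)"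
proof -
  let ?g = "\<lambda>u v :: nat. if v < u then - 1 else (1 :: 'f)"
  have square: "(x * y) * (x * y) = 1" if "x * x = 1" "y * y = 1" for x y :: 'f
  proof -
    have "(x * y) * (x * y) = (x * x) * (y * y)" by (simp only: mult_ac)
    with that show ?thesis by simp
  qed
  have "(\<Prod>u\<leftarrow>vs. ?g v u) * (\<Prod>u\<leftarrow>vs. ?g v u) = 1" for v vs
    by (induction vs) (simp_all only: list.map prod_list.Nil prod_list.Cons square mult_1 split: if_split, simp_all)
  then show ?thesis
    unfolding list_sign_def by (induction vs) (simp_all only: pair_prod.simps square mult_1)
qed

lemma pair_prod_swap:
  fixes g :: "'v \<Rightarrow> 'v \<Rightarrow> 'f::field"
  assumes anti: "\<And>u v. u \<noteq> v \<Longrightarrow> g u v = - g v u" and "distinct (pre @ z # mid @ t # post)"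
  shows "pair_prod g (pre @ z # mid @ t # post) = - pair_prod g (pre @ t # mid @ z # post)"
proof -
  define P where "P z t = (\<Prod>u\<leftarrow>pre. \<Prod>v\<leftarrow>z # mid @ t # post. g u v)" for z t
  \<comment> \<open>\<open>K\<close> collects the factors that are symmetric in \<open>z\<close> and \<open>t\<close>.\<close>
  define K where "K z t = pair_prod g pre * pair_prod g mid * pair_prod g post * (\<Prod>u\<leftarrow>mid. \<Prod>v\<leftarrow>post. g u v) *
    (\<Prod>v\<leftarrow>post. g z v) * (\<Prod>v\<leftarrow>post. g t v) * P z t" for z t
  have expand: "pair_prod g (pre @ z # mid @ t # post) =
    ((\<Prod>v\<leftarrow>mid. g z v) * (\<Prod>v\<leftarrow>mid. g v t)) * g z t * K z t" for z t
    by (simp add: K_def P_def pair_prod_append prod_list_mult mult_ac)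
  have "P z t = P t z"
    unfolding P_def by (simp only: list.map prod_list.Cons map_append prod_list.append mult_ac)
  then have K: "K z t = K t z"
    unfolding K_def by (simp only: mult.commute mult.left_commute mult.assoc)
  have "(\<Prod>v\<leftarrow>mid. g z v * g v t) = (\<Prod>v\<leftarrow>mid. g t v * g v z)"
  proof (intro arg_cong[where f = prod_list] map_cong refl)
    fix v assume "v \<in> set mid"
    then have "z \<noteq> v" "t \<noteq> v" using assms(2) by auto
    then have "g v t = - g t v" "g v z = - g z v" using anti by metis+
    then show "g z v * g v t = g t v * g v z"
      by simp
  qed
  then have M: "(\<Prod>v\<leftarrow>mid. g z v) * (\<Prod>v\<leftarrow>mid. g v t) = (\<Prod>v\<leftarrow>mid. g t v) * (\<Prod>v\<leftarrow>mid. g v z)"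
    by (simp only: prod_list_mult)
  have "g z t = - g t z" by (rule anti) (use assms(2) in auto)
  then show ?thesis
    unfolding expand[of z t] expand[of t z] K M by simp
qed

lemma list_sign_swap:
  "distinct (pre @ z # mid @ t # post) \<Longrightarrow>
    list_sign (pre @ z # mid @ t # post) = - (list_sign (pre @ t # mid @ z # post) :: 'f::field)"
  unfolding list_sign_def by (rule pair_prod_swap) auto


section \<open>Multilinear polynomials are determined by their alternating coefficients\<close>

context metabelian_jordan
begin

text \<open>The first entry \<open>s\<close> is kept apart because the word starts with the product of \<open>i\<close> and \<open>s\<close>: it cannot be exchanged with
later letters by skew-symmetry.\<close>

definition arrangements :: "nat set \<Rightarrow> nat \<Rightarrow> nat set \<Rightarrow> nat \<Rightarrow> nat list set" where
  "arrangements V i S s = {vs. distinct (s # vs) \<and> set (s # vs) = V - {i} \<and> evens (s # vs) = S}"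

text \<open>The sign of the list cancels the sign of the exchanges, so this depends on the arrangement only through
\<open>i\<close>, the first entry and the letters at even positions (\<open>signed_word_invariant\<close>).\<close>

definition signed_word :: "(nat \<Rightarrow> 'a) \<Rightarrow> nat \<Rightarrow> nat list \<Rightarrow> 'a" where
  "signed_word a i vs = (list_sign vs :: 'f) \<odot> opword (a i) (map a vs)"

definition arranged_word :: "(nat \<Rightarrow> 'a) \<Rightarrow> nat set \<Rightarrow> nat \<Rightarrow> nat set \<Rightarrow> nat \<Rightarrow> 'a" where
  "arranged_word a V i S s = (if arrangements V i S s = {} then \<zero>
     else signed_word a i (s # (SOME vs. vs \<in> arrangements V i S s)))"

text \<open>The element \<open>E(i,S)\<close> of the introduction.\<close>

definition alternating_element :: "(nat \<Rightarrow> 'a) \<Rightarrow> nat set \<Rightarrow> nat \<Rightarrow> nat set \<Rightarrow> 'a" where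
  "alternating_element a V i S = (\<Oplus>s\<in>S. arranged_word a V i S s)"

context
  fixes a :: "nat \<Rightarrow> 'a" assumes a: "\<And>v. a v \<in> carrier A"
begin

lemma map_closed: "set (map a vs) \<subseteq> carrier A"
  using a by auto

lemma signed_word_closed: "signed_word a i vs \<in> carrier A"
  unfolding signed_word_def by (intro scale_closed opword_closed map_closed a)

lemma arranged_word_closed: "arranged_word a V i S s \<in> carrier A"
  unfolding arranged_word_def using signed_word_closed by simp

lemma alternating_element_closed: "alternating_element a V i S \<in> carrier A"
  unfolding alternating_element_def using arranged_word_closed by simp

lemma signed_word_invariant:
  assumes "vs \<in> arrangements V i S s" "ws \<in> arrangements V i S s"
  shows "signed_word a i (s # vs) = signed_word a i (s # ws)"
proof (rule rearrangement_invariant[where V = "V - {i}"])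
  fix pre mid post :: "nat list" and z t :: nat
  assume pre: "pre \<noteq> []" and odd: "odd (length mid)" and d: "distinct (pre @ z # mid @ t # post)"
  obtain p pre' where p: "pre = p # pre'" using pre by (cases pre) auto
  have "opword (a i) (map a (pre @ z # mid @ t # post)) =
      opword (a i \<otimes> a p) (map a pre' @ a z # map a mid @ a t # map a post)"
    by (simp add: p)
  also have "\<dots> = \<ominus> opword (a i \<otimes> a p) (map a pre' @ a t # map a mid @ a z # map a post)"
    using odd a by (intro operators_swap product_annihilator) auto
  also have "\<dots> = \<ominus> opword (a i) (map a (pre @ t # mid @ z # post))"
    by (simp add: p)
  finally have "opword (a i) (map a (pre @ z # mid @ t # post)) = \<ominus> opword (a i) (map a (pre @ t # mid @ z # post))" .
  moreover have "list_sign (pre @ z # mid @ t # post) = - (list_sign (pre @ t # mid @ z # post) :: 'f)"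
    using d by (rule list_sign_swap)
  moreover have "opword (a i) (map a (pre @ t # mid @ z # post)) \<in> carrier A"
    by (intro opword_closed map_closed a)
  ultimately show "signed_word a i (pre @ z # mid @ t # post) = signed_word a i (pre @ t # mid @ z # post)"
    unfolding signed_word_def by (simp only: minus_scale scale_minus scale_closed minus_minus a_inv_closed)
qed (use assms in \<open>auto simp: arrangements_def\<close>)

lemma arranged_word_eq:
  assumes "vs \<in> arrangements V i S s"
  shows "arranged_word a V i S s = signed_word a i (s # vs)"
proof -
  have "(SOME vs. vs \<in> arrangements V i S s) \<in> arrangements V i S s"
    using assms by (rule someI)
  from signed_word_invariant[OF this assms] show ?thesis
    using assms unfolding arranged_word_def by (simp split: if_split) blast
qed

text \<open>Since \<open>y\<close> stands next to \<open>x\<close> in the word itself, its summand is the word; the other summands are computed in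
\<open>arranged_word_split\<close>.\<close>

lemma alternating_element_expansion:
  assumes d: "distinct (x # y # rest)" and V: "set (x # y # rest) = V"
  shows "list_sign (y # rest) \<odot> alternating_element a V x (evens (y # rest)) =
    opword (a x \<otimes> a y) (map a rest) \<oplus>
    (\<Oplus>v\<in>odds rest. list_sign (y # rest) \<odot> arranged_word a V x (evens (y # rest)) v)"
proof -
  let ?S = "evens (y # rest)" and ?e = "list_sign (y # rest) :: 'f"
  have fin: "finite ?S" using finite_subset[OF evens_subset[of "y # rest"]] by simp
  have y: "y \<notin> odds rest" "finite (odds rest)"
    using d odds_subset[of rest] finite_subset[OF odds_subset[of rest]] by auto
  have "rest \<in> arrangements V x ?S y"
    using d V by (auto simp: arrangements_def)
  then have "?e \<odot> arranged_word a V x ?S y = (?e * ?e) \<odot> opword (a x) (map a (y # rest))"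
    by (simp only: arranged_word_eq signed_word_def scale_scale opword_closed map_closed a)
  then have first: "?e \<odot> arranged_word a V x ?S y = opword (a x \<otimes> a y) (map a rest)"
    using a by (simp add: list_sign_square opword_closed mult_closed map_closed image_subset_iff)
  have "?e \<odot> alternating_element a V x ?S = (\<Oplus>v\<in>insert y (odds rest). ?e \<odot> arranged_word a V x ?S v)"
    unfolding alternating_element_def using fin arranged_word_closed by (subst finsum_scale) auto
  also have "\<dots> = ?e \<odot> arranged_word a V x ?S y \<oplus> (\<Oplus>v\<in>odds rest. ?e \<odot> arranged_word a V x ?S v)"
    using y arranged_word_closed by (intro finsum_insert) auto
  finally show ?thesis unfolding first .
qed

text \<open>An arrangement starting with \<open>v\<close> is obtained from \<open>y # pre @ v # post\<close> by exchanging \<open>y\<close> and \<open>v\<close>, which changes the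
sign of the list.\<close>

lemma arranged_word_split:
  assumes d: "distinct (x # y # pre @ v # post)" and V: "set (x # y # pre @ v # post) = V" and odd: "odd (length pre)"
  shows "list_sign (y # pre @ v # post) \<odot> arranged_word a V x (evens (y # pre @ v # post)) v =
    \<ominus> opword (a x \<otimes> a v) (map a (pre @ y # post))"
proof -
  have "pre @ y # post \<in> arrangements V x (evens (y # pre @ v # post)) v"
    using d V odd by (auto simp: arrangements_def odds_append evens_append)
  then have w: "arranged_word a V x (evens (y # pre @ v # post)) v =
      (list_sign (v # pre @ y # post) :: 'f) \<odot> opword (a x) (map a (v # pre @ y # post))"
    by (simp only: arranged_word_eq signed_word_def)
  have s: "list_sign (y # pre @ v # post) = - (list_sign (v # pre @ y # post) :: 'f)"
    using list_sign_swap[of "[]" y pre v post] d by simp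
  have c: "opword (a x) (map a (v # pre @ y # post)) \<in> carrier A"
    by (intro opword_closed map_closed a)
  have "list_sign (y # pre @ v # post) \<odot> arranged_word a V x (evens (y # pre @ v # post)) v =
      (- (1 :: 'f)) \<odot> opword (a x) (map a (v # pre @ y # post))"
    unfolding w s scale_scale[OF c] by (simp add: list_sign_square)
  also have "\<dots> = \<ominus> opword (a x) (map a (v # pre @ y # post))"
    using c by (rule minus_one_scale)
  finally show ?thesis by simp
qed

text \<open>Both elements contribute the word once. For each letter \<open>v\<close> at an odd position of \<open>rest\<close> the summands of the two
elements belonging to \<open>v\<close> add up to the word again, by \<open>jordan_exchange\<close>; there are \<open>length rest div 2\<close> of
them.\<close>

lemma left_normed_expansion:
  assumes d: "distinct (x # y # rest)" and V: "set (x # y # rest) = V"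
  shows "(of_nat (length rest div 2) + 2 :: 'f) \<odot> opword (a x \<otimes> a y) (map a rest) =
    list_sign (y # rest) \<odot> alternating_element a V x (evens (y # rest)) \<oplus>
    list_sign (x # rest) \<odot> alternating_element a V y (evens (x # rest))"
proof -
  let ?L = "opword (a x \<otimes> a y) (map a rest)"
  let ?F = "\<lambda>x y v. (list_sign (y # rest) :: 'f) \<odot> arranged_word a V x (evens (y # rest)) v"
  have L: "?L \<in> carrier A" using a by (intro opword_closed map_closed mult_closed)
  have F: "?F x y v \<in> carrier A" for x y v using arranged_word_closed by blast
  have sum: "?F x y v \<oplus> ?F y x v = ?L" if v: "v \<in> odds rest" for v
  proof -
    obtain pre post where r: "rest = pre @ v # post" and odd: "odd (length pre)" using odds_split[OF v] by blast
    let ?p = "opword (a x \<otimes> a v) (map a (pre @ y # post))" and ?q = "opword (a y \<otimes> a v) (map a (pre @ x # post))"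
    have c: "?p \<in> carrier A" "?q \<in> carrier A"
      by (rule opword_closed[OF mult_closed[OF a a] map_closed])+
    have Fs: "?F x y v = \<ominus> ?p" "?F y x v = \<ominus> ?q"
      using arranged_word_split[of x y pre v post V] arranged_word_split[of y x pre v post V] d V odd
      unfolding r by auto
    have "?L \<oplus> ?q \<oplus> ?p = \<zero>"
      using jordan_exchange[of "map a pre" "a x" "a y" "a v" "map a post"] odd a comm[OF a a, of v x]
      by (auto simp: r)
    then have "?L \<oplus> (?p \<oplus> ?q) = \<zero>" using L c by (simp add: a_ac)
    then have "?L = \<ominus> (?p \<oplus> ?q)" using minus_equality[of ?L "?p \<oplus> ?q"] L c by simp
    then show ?thesis unfolding Fs using c by (simp add: minus_add)
  qed
  have fin: "finite (odds rest)" using finite_subset[OF odds_subset[of rest]] by simp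
  have card: "card (odds rest) = length rest div 2" using d by (intro card_odds) simp
  have "(\<Oplus>v\<in>odds rest. ?F x y v) \<oplus> (\<Oplus>v\<in>odds rest. ?F y x v) = (\<Oplus>v\<in>odds rest. ?F x y v \<oplus> ?F y x v)"
    using F by (intro finsum_addf[symmetric]) auto
  also have "\<dots> = (\<Oplus>v\<in>odds rest. (1 :: 'f) \<odot> ?L)"
    using L sum by (intro finsum_cong') auto
  also have "\<dots> = (of_nat (length rest div 2) :: 'f) \<odot> ?L"
    using scale_finsum[OF fin L, of "\<lambda>_. 1"] card by simp
  finally have S: "(\<Oplus>v\<in>odds rest. ?F x y v) \<oplus> (\<Oplus>v\<in>odds rest. ?F y x v) = (of_nat (length rest div 2) :: 'f) \<odot> ?L" .
  have d': "distinct (y # x # rest)" and V': "set (y # x # rest) = V" using d V by auto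
  have L': "opword (a y \<otimes> a x) (map a rest) = ?L" using comm[OF a a, of y x] by simp
  have Fc: "(\<Oplus>v\<in>odds rest. ?F x y v) \<in> carrier A" "(\<Oplus>v\<in>odds rest. ?F y x v) \<in> carrier A"
    using F by (auto intro!: finsum_closed)
  have "list_sign (y # rest) \<odot> alternating_element a V x (evens (y # rest)) \<oplus>
    list_sign (x # rest) \<odot> alternating_element a V y (evens (x # rest)) =
    (?L \<oplus> (\<Oplus>v\<in>odds rest. ?F x y v)) \<oplus> (?L \<oplus> (\<Oplus>v\<in>odds rest. ?F y x v))"
    unfolding alternating_element_expansion[OF d V] alternating_element_expansion[OF d' V'] L' ..
  also have "\<dots> = ((\<Oplus>v\<in>odds rest. ?F x y v) \<oplus> (\<Oplus>v\<in>odds rest. ?F y x v)) \<oplus> (?L \<oplus> ?L)"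
    using L Fc by (simp only: a_ac a_closed)
  also have "\<dots> = (of_nat (length rest div 2) :: 'f) \<odot> ?L \<oplus> (1 + 1 :: 'f) \<odot> ?L"
    unfolding S add_scale[OF L, of 1 1] one_scale[OF L] ..
  also have "\<dots> = (of_nat (length rest div 2) + 2 :: 'f) \<odot> ?L"
    using L by (simp add: add_scale)
  finally show ?thesis by simp
qed

end

end

text \<open>The coefficient of the element \<open>E(i,S)\<close> in the expansion of a word. If the word is not left-normed, the
coefficient is 0; words of length 1 get the default value 0, as the expansion starts in degree 2.\<close>

definition alternating_coeff :: "nat \<Rightarrow> nat set \<Rightarrow> nat word \<Rightarrow> 'f::field" where
  "alternating_coeff i S w = (case left_normed w of
     Some (x # y # rest) \<Rightarrow>
       (if i = x \<and> S = evens (y # rest) then list_sign (y # rest)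
        else if i = y \<and> S = evens (x # rest) then list_sign (x # rest) else 0)
   | _ \<Rightarrow> 0)"

context metabelian_jordan
begin

lemma word_value_expansion:
  assumes a: "\<And>v. a v \<in> carrier A"
    and w: "distinct (letters w)" "set (letters w) = V" and V: "2 \<le> card V"
  shows "(of_nat (card V div 2) + 1 :: 'f) \<odot> word_value A a w =
    (\<Oplus>p\<in>V \<times> Pow V. alternating_coeff (fst p) (snd p) w \<odot> alternating_element a V (fst p) (snd p))"
proof (cases "left_normed w")
  case None
  then have "word_value A a w = \<zero>" using word_value_left_normed[of a w, OF a] by simp
  moreover have "(\<Oplus>p\<in>V \<times> Pow V. alternating_coeff (fst p) (snd p) w \<odot> alternating_element a V (fst p) (snd p)) = \<zero>"
    using None alternating_element_closed[of a, OF a] by (intro finsum_neutral) (simp add: alternating_coeff_def)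
  ultimately show ?thesis by simp
next
  case (Some vs)
  have finV: "finite V" using w by auto
  have len: "length (letters w) = card V" using w distinct_card by metis
  have "vs \<noteq> []" "set vs = V" "length vs = card V"
    using left_normed_letters[OF Some] w len by auto
  then obtain x y rest where vs: "vs = x # y # rest"
    using V by (metis (no_types, lifting) Suc_le_length_iff numeral_2_eq_2)
  have d: "distinct (x # y # rest)"
    using \<open>set vs = V\<close> \<open>length vs = card V\<close> vs card_distinct by metis
  have sV: "set (x # y # rest) = V" using \<open>set vs = V\<close> vs by simp
  have card: "card V div 2 = Suc (length rest div 2)" using \<open>length vs = card V\<close> vs by simp
  let ?Sx = "evens (y # rest)" and ?Sy = "evens (x # rest)"
  let ?t = "\<lambda>p. (alternating_coeff (fst p) (snd p) w :: 'f) \<odot> alternating_element a V (fst p) (snd p)"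
  have t: "?t p \<in> carrier A" for p using alternating_element_closed[of a, OF a] by blast
  have xy: "x \<noteq> y" using d by auto
  have tx: "?t (x, ?Sx) = list_sign (y # rest) \<odot> alternating_element a V x ?Sx"
    and ty: "?t (y, ?Sy) = list_sign (x # rest) \<odot> alternating_element a V y ?Sy"
    using xy by (simp_all add: alternating_coeff_def Some vs)
  have sub: "{(x, ?Sx), (y, ?Sy)} \<subseteq> V \<times> Pow V"
    using evens_subset[of "y # rest"] evens_subset[of "x # rest"] sV by auto
  have zero: "?t p = \<zero>" if "p \<in> V \<times> Pow V - {(x, ?Sx), (y, ?Sy)}" for p
  proof -
    have "(alternating_coeff (fst p) (snd p) w :: 'f) = 0"
      using that by (cases p) (auto simp: alternating_coeff_def Some vs)
    then show ?thesis using alternating_element_closed[of a, OF a] by simp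
  qed
  have "(\<Oplus>p\<in>V \<times> Pow V. ?t p) = (\<Oplus>p\<in>{(x, ?Sx), (y, ?Sy)}. ?t p)"
    using finV sub zero t by (intro finsum_superset[symmetric]) auto
  also have "\<dots> = ?t (x, ?Sx) \<oplus> ?t (y, ?Sy)"
    using xy t by (subst finsum_insert) auto
  also have "\<dots> = (of_nat (length rest div 2) + 2 :: 'f) \<odot> opword (a x \<otimes> a y) (map a rest)"
    unfolding tx ty by (rule left_normed_expansion[of a, OF a d sV, symmetric])
  also have "opword (a x \<otimes> a y) (map a rest) = word_value A a w"
    using word_value_left_normed[of a w, OF a] by (simp add: Some vs)
  finally show ?thesis by (simp add: card add.commute)
qed

text \<open>The factor \<open>card V div 2 + 1\<close> in the expansion is the same for all words of \<open>f\<close> and is invertible in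
characteristic 0.\<close>

theorem vanishes_if_alternating_coeffs_vanish:
  assumes char: "\<And>n. (of_nat (Suc n) :: 'f) \<noteq> 0"
    and a: "\<And>v. a v \<in> carrier A"
    and f: "\<And>w. w \<in> Poly_Mapping.keys f \<Longrightarrow> distinct (letters w) \<and> set (letters w) = V"
    and V: "2 \<le> card V"
    and coeff: "\<And>i S. \<lbrakk>i \<in> V; S \<subseteq> V\<rbrakk> \<Longrightarrow>
      (\<Sum>w\<in>Poly_Mapping.keys f. Poly_Mapping.lookup f w * alternating_coeff i S w) = 0"
  shows "npoly_value A a f = \<zero>"
proof -
  let ?c = "of_nat (card V div 2) + 1 :: 'f" and ?K = "Poly_Mapping.keys f"
  let ?E = "\<lambda>p. alternating_element a V (fst p) (snd p)"
  let ?co = "\<lambda>p w. alternating_coeff (fst p) (snd p) w :: 'f"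
  let ?l = "Poly_Mapping.lookup f"
  have E: "?E p \<in> carrier A" for p using alternating_element_closed[of a, OF a] by blast
  have wc: "word_value A a w \<in> carrier A" for w using a by (intro word_value_closed)
  have finV: "finite V" using V by (auto intro: card_ge_0_finite)
  have "?c \<odot> npoly_value A a f = (\<Oplus>w\<in>?K. ?c \<odot> (?l w \<odot> word_value A a w))"
    unfolding npoly_value_def by (rule finsum_scale) (auto simp: wc)
  also have "\<dots> = (\<Oplus>w\<in>?K. \<Oplus>p\<in>V \<times> Pow V. (?l w * ?co p w) \<odot> ?E p)"
  proof (rule finsum_cong'[OF refl])
    fix w assume w: "w \<in> ?K"
    have "?c \<odot> (?l w \<odot> word_value A a w) = ?l w \<odot> (?c \<odot> word_value A a w)"
      by (simp only: scale_scale wc mult.commute)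
    also have "?c \<odot> word_value A a w = (\<Oplus>p\<in>V \<times> Pow V. ?co p w \<odot> ?E p)"
      using word_value_expansion[of a w V, OF a] f[OF w] V by blast
    also have "?l w \<odot> \<dots> = (\<Oplus>p\<in>V \<times> Pow V. ?l w \<odot> (?co p w \<odot> ?E p))"
      using finV E by (intro finsum_scale) auto
    also have "\<dots> = (\<Oplus>p\<in>V \<times> Pow V. (?l w * ?co p w) \<odot> ?E p)"
      using E by (intro finsum_cong') (auto simp: scale_scale)
    finally show "?c \<odot> (?l w \<odot> word_value A a w) = (\<Oplus>p\<in>V \<times> Pow V. (?l w * ?co p w) \<odot> ?E p)" .
  qed (use E in \<open>auto intro!: finsum_closed\<close>)
  also have "\<dots> = (\<Oplus>p\<in>V \<times> Pow V. \<Oplus>w\<in>?K. (?l w * ?co p w) \<odot> ?E p)"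
    using finV E by (intro finsum_swap) auto
  also have "\<dots> = \<zero>"
  proof (rule finsum_neutral)
    fix p assume p: "p \<in> V \<times> Pow V"
    have "(\<Oplus>w\<in>?K. (?l w * ?co p w) \<odot> ?E p) = (\<Sum>w\<in>?K. ?l w * ?co p w) \<odot> ?E p"
      using E by (intro scale_finsum[symmetric]) auto
    also have "(\<Sum>w\<in>?K. ?l w * ?co p w) = 0" using coeff p by auto
    finally show "(\<Oplus>w\<in>?K. (?l w * ?co p w) \<odot> ?E p) = \<zero>" using E by simp
  qed
  finally show ?thesis
    using scale_eq_zero[of "npoly_value A a f" ?c] char[of "card V div 2"] npoly_value_closed[of a f] a
    by (simp add: add.commute)
qed

end


section \<open>The alternating superalgebra\<close>

text \<open>Coordinates 0 and 1 belong to the odd generators \<open>x\<close> and \<open>y\<close>, coordinate \<open>k + 2\<close> to \<open>m\<^sub>k\<close>, which has the parity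
of \<open>k\<close>. Supercommutativity fixes \<open>x m\<^sub>k\<close> and \<open>y m\<^sub>k\<close>: the former is \<open>m\<^sub>k x\<close> for even \<open>k\<close>, the latter is \<open>- m\<^sub>k y\<close>
for odd \<open>k\<close>.\<close>

fun alt_mult :: "(nat \<Rightarrow> 'f::field) \<Rightarrow> (nat \<Rightarrow> 'f) \<Rightarrow> nat \<Rightarrow> 'f" where
  "alt_mult g h 0 = 0"
| "alt_mult g h (Suc 0) = 0"
| "alt_mult g h (Suc (Suc 0)) = g 0 * h 1 - g 1 * h 0"
| "alt_mult g h (Suc (Suc (Suc k))) =
     (if even k then g (k + 2) * h 0 + g 0 * h (k + 2) else g (k + 2) * h 1 - g 1 * h (k + 2))"

lemma nat_cases3:
  obtains "n = 0" | "n = Suc 0" | "n = Suc (Suc 0)" | k where "n = Suc (Suc (Suc k))"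
  by (metis not0_implies_Suc)

lemma alt_mult_linear:
  "alt_mult (\<lambda>k. g k + h k) l = (\<lambda>k. alt_mult g l k + alt_mult h l k)"
  "alt_mult g (\<lambda>k. h k + l k) = (\<lambda>k. alt_mult g h k + alt_mult g l k)"
  "alt_mult (\<lambda>k. c * g k) h = (\<lambda>k. c * alt_mult g h k)"
  "alt_mult g (\<lambda>k. c * h k) = (\<lambda>k. c * alt_mult g h k)"
proof -
  have "alt_mult (\<lambda>k. g k + h k) l n = alt_mult g l n + alt_mult h l n"
    "alt_mult g (\<lambda>k. h k + l k) n = alt_mult g h n + alt_mult g l n"
    "alt_mult (\<lambda>k. c * g k) h n = c * alt_mult g h n"
    "alt_mult g (\<lambda>k. c * h k) n = c * alt_mult g h n" for n
    by (cases n rule: nat_cases3; simp add: algebra_simps)+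
  then show "alt_mult (\<lambda>k. g k + h k) l = (\<lambda>k. alt_mult g l k + alt_mult h l k)"
    "alt_mult g (\<lambda>k. h k + l k) = (\<lambda>k. alt_mult g h k + alt_mult g l k)"
    "alt_mult (\<lambda>k. c * g k) h = (\<lambda>k. c * alt_mult g h k)"
    "alt_mult g (\<lambda>k. c * h k) = (\<lambda>k. c * alt_mult g h k)"
    by auto
qed

definition alt_parity :: "nat \<Rightarrow> bit" where
  "alt_parity k = (if k = 0 then 1 else of_nat k)"

definition alternating_superalgebra :: "('f::field, nat \<Rightarrow> 'f) superalg" where
  "alternating_superalgebra = \<lparr>
     carrier = {g. finite {k. g k \<noteq> 0}},
     mult = alt_mult,
     one = undefined,
     zero = (\<lambda>k. 0),
     add = (\<lambda>g h k. g k + h k),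
     smult = (\<lambda>c g k. c * g k),
     part = (\<lambda>i. {g. finite {k. g k \<noteq> 0} \<and> (\<forall>k. g k \<noteq> 0 \<longrightarrow> alt_parity k = i)})\<rparr>"

lemma alternating_simps [simp]:
  "carrier alternating_superalgebra = {g. finite {k. g k \<noteq> 0}}"
  "mult alternating_superalgebra = alt_mult"
  "zero alternating_superalgebra = (\<lambda>k. 0)"
  "add alternating_superalgebra = (\<lambda>g h k. g k + h k)"
  "smult alternating_superalgebra = (\<lambda>c g k. c * g k)"
  "part alternating_superalgebra i = {g. finite {k. g k \<noteq> 0} \<and> (\<forall>k. g k \<noteq> 0 \<longrightarrow> alt_parity k = i)}"
  by (simp_all add: alternating_superalgebra_def)

lemma alternating_superalgebra: "superalgebra (alternating_superalgebra :: ('f::field, nat \<Rightarrow> 'f) superalg)"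
proof (rule superalgebraI)
  let ?B = "alternating_superalgebra :: ('f, nat \<Rightarrow> 'f) superalg"
  have add: "finite {k. g k + h k \<noteq> 0}" if "finite {k. g k \<noteq> 0}" "finite {k. h k \<noteq> 0}" for g h :: "nat \<Rightarrow> 'f"
    by (rule finite_subset[of _ "{k. g k \<noteq> 0} \<union> {k. h k \<noteq> 0}"]) (use that in auto)
  have scale: "finite {k. c * g k \<noteq> 0}" if "finite {k. g k \<noteq> 0}" for c and g :: "nat \<Rightarrow> 'f"
    by (rule finite_subset[of _ "{k. g k \<noteq> 0}"]) (use that in auto)
  have mult: "finite {n. alt_mult g h n \<noteq> 0}" if "finite {k. g k \<noteq> 0}" "finite {k. h k \<noteq> 0}" for g h :: "nat \<Rightarrow> 'f"
  proof (rule finite_subset)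
    show "{n. alt_mult g h n \<noteq> 0} \<subseteq> insert 2 (Suc ` {k. g k \<noteq> 0} \<union> Suc ` {k. h k \<noteq> 0})"
    proof
      fix n assume "n \<in> {n. alt_mult g h n \<noteq> 0}"
      then show "n \<in> insert 2 (Suc ` {k. g k \<noteq> 0} \<union> Suc ` {k. h k \<noteq> 0})"
        by (cases n rule: nat_cases3) (auto split: if_splits simp: image_iff)
    qed
  qed (use that in auto)
  show "nonassoc_algebra ?B"
  proof (rule nonassoc_algebraI)
    fix g h l :: "nat \<Rightarrow> 'f" and c d :: 'f
    show "(g \<oplus>\<^bsub>?B\<^esub> h) \<otimes>\<^bsub>?B\<^esub> l = g \<otimes>\<^bsub>?B\<^esub> l \<oplus>\<^bsub>?B\<^esub> h \<otimes>\<^bsub>?B\<^esub> l" "g \<otimes>\<^bsub>?B\<^esub> (h \<oplus>\<^bsub>?B\<^esub> l) = g \<otimes>\<^bsub>?B\<^esub> h \<oplus>\<^bsub>?B\<^esub> g \<otimes>\<^bsub>?B\<^esub> l"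
      "(c \<odot>\<^bsub>?B\<^esub> g) \<otimes>\<^bsub>?B\<^esub> h = c \<odot>\<^bsub>?B\<^esub> (g \<otimes>\<^bsub>?B\<^esub> h)" "g \<otimes>\<^bsub>?B\<^esub> (c \<odot>\<^bsub>?B\<^esub> h) = c \<odot>\<^bsub>?B\<^esub> (g \<otimes>\<^bsub>?B\<^esub> h)"
      by (simp_all add: alt_mult_linear)
  qed (simp_all add: add scale mult algebra_simps)
  fix i j and g h :: "nat \<Rightarrow> 'f" and c :: 'f
  show "part ?B i \<subseteq> carrier ?B" "\<zero>\<^bsub>?B\<^esub> \<in> part ?B i" by auto
  show "c \<odot>\<^bsub>?B\<^esub> g \<in> part ?B i" if "g \<in> part ?B i" using that by (auto simp: scale)
  show "g \<oplus>\<^bsub>?B\<^esub> h \<in> part ?B i" if "g \<in> part ?B i" "h \<in> part ?B i"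
    using that by (auto simp: add) (metis add.right_neutral)
  show "g = \<zero>\<^bsub>?B\<^esub>" if "g \<in> part ?B 0" "g \<in> part ?B 1"
    using that by (auto simp: fun_eq_iff)
  show "\<exists>y\<in>part ?B 0. \<exists>z\<in>part ?B 1. g = y \<oplus>\<^bsub>?B\<^esub> z" if "g \<in> carrier ?B"
  proof -
    have "(\<lambda>k. if alt_parity k = i then g k else 0) \<in> part ?B i" for i
      using that by (auto intro: finite_subset[of _ "{k. g k \<noteq> 0}"])
    moreover have "g = (\<lambda>k. if alt_parity k = 0 then g k else 0) \<oplus>\<^bsub>?B\<^esub> (\<lambda>k. if alt_parity k = 1 then g k else 0)"
      using bit_cases by (auto simp: fun_eq_iff)
    ultimately show ?thesis by blast
  qed
  show "g \<otimes>\<^bsub>?B\<^esub> h \<in> part ?B (i + j)" if g: "g \<in> part ?B i" and h: "h \<in> part ?B j"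
  proof -
    have "alt_parity n = i + j" if "alt_mult g h n \<noteq> 0" for n
    proof -
      have *: "g k * h l \<noteq> 0 \<Longrightarrow> i + j = alt_parity k + alt_parity l" for k l
        using g h by auto
      show ?thesis
      proof (cases n rule: nat_cases3)
        case 3
        then have "g 0 * h 1 \<noteq> 0 \<or> g 1 * h 0 \<noteq> 0" using that by auto
        then show ?thesis using *[of 0 1] *[of 1 0] 3 by (auto simp: alt_parity_def)
      next
        case (4 k)
        have "g (k + 2) * h 0 \<noteq> 0 \<or> g 0 * h (k + 2) \<noteq> 0 \<or> g (k + 2) * h 1 \<noteq> 0 \<or> g 1 * h (k + 2) \<noteq> 0"
          using that 4 by (auto split: if_splits)
        then show ?thesis
          using *[of "k + 2" 0] *[of 0 "k + 2"] *[of "k + 2" 1] *[of 1 "k + 2"] 4 by (auto simp: alt_parity_def add_ac)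
      qed (use that in auto)
    qed
    then show ?thesis using g h mult by auto
  qed
qed

interpretation B: superalgebra "alternating_superalgebra :: ('f::field, nat \<Rightarrow> 'f) superalg"
  by (rule alternating_superalgebra)

lemma superization_add: "superization p (f + g) = superization p f + superization p g"
  by (rule poly_mapping_eqI) (simp add: lookup_superization lookup_add algebra_simps)

lemma superization_single:
  "superization p (Poly_Mapping.single w c) = Poly_Mapping.single w (koszul_sign p (letters w) * c)"
  by (rule poly_mapping_eqI) (simp add: lookup_superization lookup_single when_def)

lemma alt_part_zero:
  assumes "g \<in> part (alternating_superalgebra :: ('f::field, nat \<Rightarrow> 'f) superalg) i"
  shows "i = 0 \<Longrightarrow> g 0 = 0" "i = 0 \<Longrightarrow> g (Suc 0) = 0" "\<lbrakk>i = 0; odd k\<rbrakk> \<Longrightarrow> g k = 0"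
    "\<lbrakk>i = 1; even k\<rbrakk> \<Longrightarrow> g (Suc (Suc k)) = 0"
proof -
  have *: "alt_parity k \<noteq> i \<Longrightarrow> g k = 0" for k using assms by auto
  show "i = 0 \<Longrightarrow> g 0 = 0" "i = 0 \<Longrightarrow> g (Suc 0) = 0" using *[of 0] *[of "Suc 0"] by (auto simp: alt_parity_def)
  have o: "(of_nat k :: bit) = of_bool (odd k)" for k by (induction k) auto
  show "\<lbrakk>i = 0; odd k\<rbrakk> \<Longrightarrow> g k = 0" using *[of k] by (auto simp: alt_parity_def o)
  show "\<lbrakk>i = 1; even k\<rbrakk> \<Longrightarrow> g (Suc (Suc k)) = 0" using *[of "Suc (Suc k)"] by (auto simp: alt_parity_def o)
qed

lemma alt_mult_product: "alt_mult (alt_mult g h) (alt_mult k l) = (\<lambda>n. 0)"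
  by (rule ext, rename_tac n, case_tac n rule: nat_cases3; simp)

text \<open>The Jordan superidentity is alternating in three arguments if all are odd, and odd elements have only two coordinates
modulo the square of the algebra. If one of the three, say \<open>u\<close>, lies in that square, the terms \<open>((u b) c) d\<close> and
\<open>((u d) c) b\<close> remain; both involve only the coordinates of \<open>b\<close> and \<open>d\<close> at the same generator, so they are equal
up to sign and cancel. The proof checks coordinates for the 16 choices of parities.\<close>

theorem alternating_superalgebra_variety:
  "variety_superalgebra jordan_metabelian (alternating_superalgebra :: ('f::field_char_0, nat \<Rightarrow> 'f) superalg)"
  unfolding variety_superalgebra_iff
proof (intro conjI alternating_superalgebra)
  let ?B = "alternating_superalgebra :: ('f, nat \<Rightarrow> 'f) superalg"
  have val: "npoly_value ?B a (Poly_Mapping.single w c) = c \<odot>\<^bsub>?B\<^esub> word_value ?B a w"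
    "npoly_value ?B a (f + g) = npoly_value ?B a f \<oplus>\<^bsub>?B\<^esub> npoly_value ?B a g"
    if "\<forall>v. a v \<in> part ?B (p v)" for a w c f g and p :: "nat \<Rightarrow> bit"
    using that B.part_carrier by (blast intro: B.npoly_value_single B.npoly_value_add)+
  show "satisfies_super ?B metabelian_poly"
    unfolding satisfies_super_def metabelian_poly_def superization_single
    by (auto simp only: val word_value.simps) (simp add: alt_mult_product)
  show "satisfies_super ?B commutator_poly"
    unfolding satisfies_super_def commutator_poly_def superization_add superization_single
  proof (intro allI impI)
    fix p :: "nat \<Rightarrow> bit" and a assume a: "\<forall>v. a v \<in> part ?B (p v)"
    note z = alt_part_zero[OF a[rule_format]]
    show "npoly_value ?B a (Poly_Mapping.single (Times (Gen 0) (Gen 1)) (koszul_sign p (letters (Times (Gen 0) (Gen 1))) * 1) +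
      Poly_Mapping.single (Times (Gen 1) (Gen 0)) (koszul_sign p (letters (Times (Gen 1) (Gen 0))) * - 1)) = \<zero>\<^bsub>?B\<^esub>"
      unfolding val[OF a]
    proof (rule ext)
      fix n
      show "(((koszul_sign p (letters (Times (Gen 0) (Gen 1))) * 1) \<odot>\<^bsub>?B\<^esub> word_value ?B a (Times (Gen 0) (Gen 1))) \<oplus>\<^bsub>?B\<^esub>
        ((koszul_sign p (letters (Times (Gen 1) (Gen 0))) * - 1) \<odot>\<^bsub>?B\<^esub> word_value ?B a (Times (Gen 1) (Gen 0)))) n = \<zero>\<^bsub>?B\<^esub> n"
        using bit_cases[of "p 0"] bit_cases[of "p 1"] z[of 0] z[of 1]
        by (cases n rule: nat_cases3) (auto simp: koszul_sign_conv_pair_prod algebra_simps)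
    qed
  qed
  show "satisfies_super ?B jordan_poly"
    unfolding satisfies_super_def jordan_poly_def superization_add superization_single
  proof (intro allI impI)
    fix p :: "nat \<Rightarrow> bit" and a assume a: "\<forall>v. a v \<in> part ?B (p v)"
    note z = alt_part_zero[OF a[rule_format]]
    let ?u = "Times (Times (Times (Gen 0) (Gen 2)) (Gen 1)) (Gen 3)" and ?v = "Times (Times (Times (Gen 2) (Gen 3)) (Gen 1)) (Gen 0)"
      and ?w = "Times (Times (Times (Gen 3) (Gen 0)) (Gen 1)) (Gen (2 :: nat))"
    have "koszul_sign p (letters ?u) * word_value ?B a ?u n + koszul_sign p (letters ?v) * word_value ?B a ?v n +
        koszul_sign p (letters ?w) * word_value ?B a ?w n = 0" for n
    proof (cases n rule: nat_cases3)
      case (4 k)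
      show ?thesis
      proof (cases k)
        case 0
        then show ?thesis unfolding 4 by simp
      next
        case (Suc l)
        show ?thesis
        proof (cases l)
          case 0
          show ?thesis
            unfolding 4 Suc 0
            using bit_cases[of "p 0"] bit_cases[of "p 1"] bit_cases[of "p 2"] bit_cases[of "p 3"] z(1,2)
            by (auto simp: koszul_sign_conv_pair_prod algebra_simps)
        next
          case (Suc m)
          show ?thesis
            unfolding 4 \<open>k = Suc l\<close> Suc
            using bit_cases[of "p 0"] bit_cases[of "p 1"] bit_cases[of "p 2"] bit_cases[of "p 3"]
              z(1,2) z(3)[of _ m] z(4)[of _ m] z(3)[of _ "Suc (Suc m)"]
            by (cases "even m") (auto simp: koszul_sign_conv_pair_prod algebra_simps)
        qed
      qed
    qed simp_all
    then show "npoly_value ?B a (Poly_Mapping.single ?u (koszul_sign p (letters ?u) * 1) +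
       Poly_Mapping.single ?v (koszul_sign p (letters ?v) * 1) +
       Poly_Mapping.single ?w (koszul_sign p (letters ?w) * 1)) = \<zero>\<^bsub>?B\<^esub>"
      unfolding val[OF a] by (simp add: fun_eq_iff)
  qed
qed


section \<open>Alternating coefficients as values\<close>

text \<open>Elements of the square of the envelope have coefficients that are sums of products.\<close>

lemma (in superalgebra) homog_annihilates:
  assumes b: "b \<in> part A (of_nat (card S))" and S: "finite S"
    and ann: "\<And>x y. \<lbrakk>x \<in> carrier A; y \<in> carrier A\<rbrakk> \<Longrightarrow> (x \<otimes> y) \<otimes> b = \<zero>"
    and kl: "k \<in> carrier GA" "l \<in> carrier GA"
  shows "(k \<otimes>\<^bsub>GA\<^esub> l) \<otimes>\<^bsub>GA\<^esub> homog A S b = \<zero>\<^bsub>GA\<^esub>"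
proof
  fix U
  have bc: "b \<in> carrier A" using b part_carrier by blast
  have kl_ann: "(k \<otimes>\<^bsub>GA\<^esub> l) T \<otimes> b = \<zero>" for T
  proof (cases "finite T")
    case True
    have c: "k R \<in> carrier A" "l R \<in> carrier A" for R using kl envelope_coeff by auto
    have "(k \<otimes>\<^bsub>GA\<^esub> l) T \<otimes> b = (\<Oplus>R\<in>Pow T. grassmann_sign R (T - R) \<odot> (k R \<otimes> l (T - R))) \<otimes> b"
      using True by (simp add: envelope_mult)
    also have "\<dots> = (\<Oplus>R\<in>Pow T. (grassmann_sign R (T - R) \<odot> (k R \<otimes> l (T - R))) \<otimes> b)"
      using True c bc by (intro finsum_mult_right) (auto simp: mult_closed)
    also have "\<dots> = \<zero>"
      using c bc ann by (intro finsum_neutral) (simp add: mult_smult_left mult_closed)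
    finally show ?thesis .
  qed (simp add: envelope_mult bc)
  have klc: "(k \<otimes>\<^bsub>GA\<^esub> l) T \<in> carrier A" for T
    using envelope_coeff[OF envelope_mult_closed[OF kl]] .
  have "(\<Oplus>T\<in>Pow U. grassmann_sign T (U - T) \<odot> ((k \<otimes>\<^bsub>GA\<^esub> l) T \<otimes> homog A S b (U - T))) = \<zero>"
    by (rule finsum_neutral) (use kl_ann klc in \<open>auto simp: homog_def\<close>)
  then show "((k \<otimes>\<^bsub>GA\<^esub> l) \<otimes>\<^bsub>GA\<^esub> homog A S b) U = \<zero>\<^bsub>GA\<^esub> U"
    by (simp add: envelope_mult[where x = "k \<otimes>\<^bsub>GA\<^esub> l"])
qed

definition basis :: "nat \<Rightarrow> nat \<Rightarrow> 'f::field" where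
  "basis n = (\<lambda>k. if k = n then 1 else 0)"

lemma basis_mult:
  "alt_mult (basis 0) (basis 1) = (basis 2 :: nat \<Rightarrow> 'f::field)"
  "even k \<Longrightarrow> alt_mult (basis (k + 2)) (basis 0) = (basis (k + 3) :: nat \<Rightarrow> 'f)"
  "odd k \<Longrightarrow> alt_mult (basis (k + 2)) (basis 0) = (\<lambda>_. 0 :: 'f)"
  "odd k \<Longrightarrow> alt_mult (basis (k + 2)) (basis 1) = (basis (k + 3) :: nat \<Rightarrow> 'f)"
  "even k \<Longrightarrow> alt_mult (basis (k + 2)) (basis 1) = (\<lambda>_. 0 :: 'f)"
proof -
  have "alt_mult (basis 0) (basis 1) n = (basis 2 n :: 'f)"
    "even k \<Longrightarrow> alt_mult (basis (k + 2)) (basis 0) n = (basis (k + 3) n :: 'f)"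
    "odd k \<Longrightarrow> alt_mult (basis (k + 2)) (basis 0) n = (0 :: 'f)"
    "odd k \<Longrightarrow> alt_mult (basis (k + 2)) (basis 1) n = (basis (k + 3) n :: 'f)"
    "even k \<Longrightarrow> alt_mult (basis (k + 2)) (basis 1) n = (0 :: 'f)" for n
    by (cases n rule: nat_cases3; auto simp: basis_def numeral_eq_Suc)+
  then show "alt_mult (basis 0) (basis 1) = (basis 2 :: nat \<Rightarrow> 'f)"
    "even k \<Longrightarrow> alt_mult (basis (k + 2)) (basis 0) = (basis (k + 3) :: nat \<Rightarrow> 'f)"
    "odd k \<Longrightarrow> alt_mult (basis (k + 2)) (basis 0) = (\<lambda>_. 0 :: 'f)"
    "odd k \<Longrightarrow> alt_mult (basis (k + 2)) (basis 1) = (basis (k + 3) :: nat \<Rightarrow> 'f)"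
    "even k \<Longrightarrow> alt_mult (basis (k + 2)) (basis 1) = (\<lambda>_. 0 :: 'f)"
    by (auto simp: fun_eq_iff)
qed

lemma basis_part:
  "basis 0 \<in> part alternating_superalgebra 1" "basis 1 \<in> part alternating_superalgebra 1"
  "basis (k + 2) \<in> part alternating_superalgebra (of_nat k)"
  by (auto simp: basis_def alt_parity_def)

lemma basis_finite [simp]: "finite {k. basis n k \<noteq> (0 :: 'f::field)}"
  by (simp add: basis_def)

text \<open>Multiplying \<open>m\<^sub>0\<close> by generators gives 0 unless \<open>x\<close> and \<open>y\<close> alternate; so \<open>S\<close> has to be the set of letters at even
positions after \<open>i\<close> for the value of a word to be nonzero.\<close>

definition test_value :: "nat \<Rightarrow> nat set \<Rightarrow> nat \<Rightarrow> nat \<Rightarrow> 'f::field" where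
  "test_value i S v = (if v = i then basis 2 else if v \<in> S then basis 0 else basis 1)"

definition test_parity :: "nat \<Rightarrow> nat \<Rightarrow> bit" where
  "test_parity i v = (if v = i then 0 else 1)"

definition test_element :: "nat \<Rightarrow> nat set \<Rightarrow> nat \<Rightarrow> nat set \<Rightarrow> nat \<Rightarrow> 'f::field" where
  "test_element i S v = homog (alternating_superalgebra :: ('f, nat \<Rightarrow> 'f) superalg) (odd_set (test_parity i) v) (test_value i S v)"

lemma test_value_part: "test_value i S v \<in> part alternating_superalgebra (test_parity i v)"
  unfolding test_value_def test_parity_def by (auto simp: basis_def alt_parity_def)

text \<open>\<open>c e\<^sub>U\<close> times the basis element with coordinate \<open>n\<close>; in particular \<open>m\<^sub>k\<close> has \<open>n = k + 2\<close>.\<close>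

definition scaled_homog :: "nat set \<Rightarrow> 'f::field \<Rightarrow> nat \<Rightarrow> nat set \<Rightarrow> nat \<Rightarrow> 'f" where
  "scaled_homog U c n = homog (alternating_superalgebra :: ('f, nat \<Rightarrow> 'f) superalg) U (\<lambda>k. c * basis n k)"

text \<open>Starting at \<open>m\<^sub>k\<close>, only \<open>x\<close> is allowed next if \<open>k\<close> is even and only \<open>y\<close> if \<open>k\<close> is odd, so the letters of \<open>S\<close> must occupy
every second place. The Grassmann letters contribute the sign of the list.\<close>

lemma test_opword:
  fixes c :: "'f::field_char_0"
  defines "GB \<equiv> grassmann_envelope (alternating_superalgebra :: ('f, nat \<Rightarrow> 'f) superalg)"
  assumes "finite U" "distinct vs" "set vs \<inter> U = {}" "i \<notin> set vs"
  shows "foldl (\<otimes>\<^bsub>GB\<^esub>) (scaled_homog U c (k + 2)) (map (test_element i S) vs) =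
    (if (if even k then evens vs else odds vs) = S \<inter> set vs
     then scaled_homog (U \<union> set vs) (c * grassmann_sign U (set vs) * list_sign vs) (k + length vs + 2)
     else \<zero>\<^bsub>GB\<^esub>)"
  using assms(2-)
proof (induction vs arbitrary: U c k)
  case Nil
  then show ?case by (simp add: list_sign_def)
next
  case (Cons v vs)
  let ?B = "alternating_superalgebra :: ('f, nat \<Rightarrow> 'f) superalg"
  have v: "v \<noteq> i" "v \<notin> U" "v \<notin> set vs" using Cons.prems by auto
  have fold_zero: "foldl (\<otimes>\<^bsub>GB\<^esub>) \<zero>\<^bsub>GB\<^esub> us = \<zero>\<^bsub>GB\<^esub>" if "set us \<subseteq> carrier GB" for us
  proof -
    interpret G: metabelian_jordan GB
      unfolding GB_def using alternating_superalgebra_variety by (rule envelope_metabelian_jordan)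
    show ?thesis using that by (rule G.opword_zero)
  qed
  have "test_element i S u \<in> carrier GB" for u
    unfolding test_element_def GB_def using test_value_part[of i S u] by (intro B.homog_closed) simp_all
  then have zero: "foldl (\<otimes>\<^bsub>GB\<^esub>) \<zero>\<^bsub>GB\<^esub> (map (test_element i S) us) = \<zero>\<^bsub>GB\<^esub>" for us
    by (intro fold_zero) auto
  have step: "scaled_homog U c (k + 2) \<otimes>\<^bsub>GB\<^esub> test_element i S v =
    homog ?B (insert v U) (\<lambda>n. grassmann_sign U {v} * (c * alt_mult (basis (k + 2)) (if v \<in> S then basis 0 else basis 1) n))"
    unfolding scaled_homog_def test_element_def GB_def
    using v Cons.prems(1) by (subst B.homog_mult) (auto simp: odd_set_def test_parity_def test_value_def alt_mult_linear basis_def)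
  have sign: "grassmann_sign U {v} * grassmann_sign (insert v U) (set vs) * list_sign vs =
    grassmann_sign U (set (v # vs)) * (list_sign (v # vs) :: 'f)"
  proof -
    have "grassmann_sign (insert v U) (set vs) = grassmann_sign {v} (set vs) * (grassmann_sign U (set vs) :: 'f)"
      using grassmann_sign_union_left[of "{v}" U "set vs"] Cons.prems v by simp
    moreover have "grassmann_sign U (set (v # vs)) = grassmann_sign U {v} * (grassmann_sign U (set vs) :: 'f)"
      using grassmann_sign_union_right[of U "{v}" "set vs"] Cons.prems v by simp
    moreover have "grassmann_sign {v} (set vs) = (\<Prod>u\<leftarrow>vs. if u < v then - 1 else (1 :: 'f))"
      using Cons.prems by (simp add: grassmann_sign_prod prod.distinct_set_conv_list)
    ultimately show ?thesis by (simp add: list_sign_def mult_ac)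
  qed
  have set: "insert v U \<union> set vs = U \<union> set (v # vs)" by auto
  show ?case
  proof (cases "even k \<longleftrightarrow> v \<in> S")
    case True
    have m: "alt_mult (basis (k + 2)) (if v \<in> S then basis 0 else basis 1) = (basis (k + 3) :: nat \<Rightarrow> 'f)"
      using True basis_mult by (cases "even k") auto
    have "scaled_homog U c (k + 2) \<otimes>\<^bsub>GB\<^esub> test_element i S v = scaled_homog (insert v U) (c * grassmann_sign U {v}) (Suc k + 2)"
      by (simp only: step m) (simp add: scaled_homog_def mult_ac eval_nat_numeral)
    then have fold: "foldl (\<otimes>\<^bsub>GB\<^esub>) (scaled_homog U c (k + 2)) (map (test_element i S) (v # vs)) =
        foldl (\<otimes>\<^bsub>GB\<^esub>) (scaled_homog (insert v U) (c * grassmann_sign U {v}) (Suc k + 2)) (map (test_element i S) vs)"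
      by (simp only: list.map foldl_Cons)
    have cond: "(if even (Suc k) then evens vs else odds vs) = S \<inter> set vs \<longleftrightarrow>
        (if even k then evens (v # vs) else odds (v # vs)) = S \<inter> set (v # vs)"
      using True v evens_subset[of vs] odds_subset[of vs] by (cases "even k") auto
    have coeff: "c * grassmann_sign U {v} * grassmann_sign (insert v U) (set vs) * list_sign vs =
        c * grassmann_sign U (set (v # vs)) * list_sign (v # vs)"
      using arg_cong[OF sign, of "\<lambda>x. c * x"] by (simp only: mult.assoc)
    have index: "Suc k + length vs + 2 = k + length (v # vs) + 2" by simp
    have "foldl (\<otimes>\<^bsub>GB\<^esub>) (scaled_homog (insert v U) (c * grassmann_sign U {v}) (Suc k + 2)) (map (test_element i S) vs) =
      (if (if even (Suc k) then evens vs else odds vs) = S \<inter> set vs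
       then scaled_homog (insert v U \<union> set vs)
         (c * grassmann_sign U {v} * grassmann_sign (insert v U) (set vs) * list_sign vs) (Suc k + length vs + 2)
       else \<zero>\<^bsub>GB\<^esub>)"
      using Cons.prems v by (intro Cons.IH) auto
    then show ?thesis
      unfolding fold cond coeff index set .
  next
    case False
    have m: "alt_mult (basis (k + 2)) (if v \<in> S then basis 0 else basis 1) = (\<lambda>_. 0 :: 'f)"
      using False basis_mult by (cases "even k") auto
    have "scaled_homog U c (k + 2) \<otimes>\<^bsub>GB\<^esub> test_element i S v = \<zero>\<^bsub>GB\<^esub>"
      by (simp only: step m) (auto simp: GB_def homog_def fun_eq_iff)
    moreover have "(if even k then evens (v # vs) else odds (v # vs)) \<noteq> S \<inter> set (v # vs)"
      using False v evens_subset[of vs] odds_subset[of vs] by (cases "even k") auto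
    ultimately show ?thesis
      using zero[of vs] by simp
  qed
qed

text \<open>If \<open>i\<close> is not among the first two letters, it multiplies a product, and \<open>m\<^sub>0\<close> is annihilated by products. Otherwise
commutativity of the envelope moves \<open>i\<close> to the front.\<close>

lemma test_coefficient:
  fixes w :: "nat word"
  defines "GB \<equiv> grassmann_envelope (alternating_superalgebra :: ('f::field_char_0, nat \<Rightarrow> 'f) superalg)"
  assumes w: "distinct (letters w)" "set (letters w) = V" and V: "2 \<le> card V" and i: "i \<in> V" and S: "S \<subseteq> V - {i}"
  shows "word_value GB (test_element i S) w (V - {i}) (card V + 1) = alternating_coeff i S w"
proof -
  let ?B = "alternating_superalgebra :: ('f, nat \<Rightarrow> 'f) superalg"
  interpret G: metabelian_jordan GB
    unfolding GB_def using alternating_superalgebra_variety by (rule envelope_metabelian_jordan)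
  let ?e = "test_element i S :: nat \<Rightarrow> nat set \<Rightarrow> nat \<Rightarrow> 'f"
  have e: "?e u \<in> carrier GB" for u
    unfolding test_element_def GB_def using test_value_part[of i S u] by (intro B.homog_closed) simp_all
  have zero: "\<zero>\<^bsub>GB\<^esub> T n = 0" for T n by (simp add: GB_def)
  have ei: "?e i = scaled_homog {} 1 (0 + 2)"
    by (simp add: test_element_def scaled_homog_def odd_set_def test_parity_def test_value_def numeral_2_eq_2)
  have ann: "?e i \<in> G.sq_annihilator"
    unfolding G.sq_annihilator_def
  proof (intro CollectI conjI ballI e)
    fix k l assume kl: "k \<in> carrier GB" "l \<in> carrier GB"
    have ann_basis: "alt_mult (alt_mult x y) (basis 2) = (\<lambda>_. 0)" for x y :: "nat \<Rightarrow> 'f"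
    proof
      show "alt_mult (alt_mult x y) (basis 2) n = 0" for n
        by (cases n rule: nat_cases3) (simp_all add: basis_def)
    qed
    have "?e i = homog ?B {} (basis 2)"
      by (simp add: test_element_def odd_set_def test_parity_def test_value_def)
    then show "(k \<otimes>\<^bsub>GB\<^esub> l) \<otimes>\<^bsub>GB\<^esub> ?e i = \<zero>\<^bsub>GB\<^esub>"
      unfolding GB_def
    proof (simp only:, intro B.homog_annihilates)
      show "basis 2 \<in> part ?B (of_nat (card {}))" using basis_part(3)[of 0] by (simp add: numeral_2_eq_2)
      show "k \<in> carrier (grassmann_envelope ?B)" "l \<in> carrier (grassmann_envelope ?B)"
        using kl unfolding GB_def .
      show "(x \<otimes>\<^bsub>?B\<^esub> y) \<otimes>\<^bsub>?B\<^esub> basis 2 = \<zero>\<^bsub>?B\<^esub>" for x y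
        by (simp add: ann_basis)
    qed simp
  qed
  have start: "foldl (\<otimes>\<^bsub>GB\<^esub>) (?e i) (map ?e vs) (V - {i}) (card V + 1) = (if S = evens vs then list_sign vs else 0)"
    if vs: "distinct vs" "set vs = V - {i}" for vs
  proof -
    have "length vs = card V - 1"
      using vs i distinct_card[OF vs(1)] by (metis card_Diff_singleton)
    then have len: "length vs + 2 = card V + 1" using V by simp
    have "S \<inter> set vs = S" using S vs by auto
    have "foldl (\<otimes>\<^bsub>GB\<^esub>) (?e i) (map ?e vs) =
      (if (if even (0 :: nat) then evens vs else odds vs) = S \<inter> set vs
       then scaled_homog ({} \<union> set vs) (1 * grassmann_sign {} (set vs) * list_sign vs) (0 + length vs + 2)
       else \<zero>\<^bsub>GB\<^esub>)"
      unfolding ei GB_def by (rule test_opword[OF finite.emptyI vs(1)]) (use vs in auto)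
    also have "\<dots> = (if evens vs = S then scaled_homog (V - {i}) (list_sign vs) (card V + 1) else \<zero>\<^bsub>GB\<^esub>)"
      using \<open>S \<inter> set vs = S\<close> vs(2) len by simp
    finally show ?thesis
      by (auto simp: scaled_homog_def homog_def basis_def zero)
  qed
  show ?thesis
  proof (cases "left_normed w")
    case None
    then show ?thesis
      using G.word_value_left_normed[of ?e w, OF e] by (simp add: alternating_coeff_def zero)
  next
    case (Some vs)
    have len: "length (letters w) = card V" using w distinct_card by metis
    have "vs \<noteq> []" "set vs = V" "length vs = card V"
      using left_normed_letters[OF Some] w len by auto
    then obtain x y rest where vs: "vs = x # y # rest"
      using V by (metis (no_types, lifting) Suc_le_length_iff numeral_2_eq_2)
    have d: "distinct (x # y # rest)"
      using \<open>set vs = V\<close> \<open>length vs = card V\<close> vs card_distinct by metis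
    have sV: "set (x # y # rest) = V" using \<open>set vs = V\<close> vs by simp
    have val: "word_value GB ?e w = foldl (\<otimes>\<^bsub>GB\<^esub>) (?e x \<otimes>\<^bsub>GB\<^esub> ?e y) (map ?e rest)"
      using G.word_value_left_normed[of ?e w, OF e] by (simp add: Some vs)
    consider "i = x" | "i = y" "i \<noteq> x" | "i \<noteq> x" "i \<noteq> y" by blast
    then show ?thesis
    proof cases
      case 1
      then have "word_value GB ?e w = foldl (\<otimes>\<^bsub>GB\<^esub>) (?e i) (map ?e (y # rest))" unfolding val by simp
      moreover have "distinct (y # rest)" "set (y # rest) = V - {i}" "i \<noteq> y" using 1 d sV by auto
      moreover from this have "alternating_coeff i S w = (if S = evens (y # rest) then list_sign (y # rest) else (0 :: 'f))"
        using 1 by (simp only: alternating_coeff_def Some vs option.case list.case) simp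
      ultimately show ?thesis
        using start[of "y # rest"] by simp
    next
      case 2
      then have "word_value GB ?e w = foldl (\<otimes>\<^bsub>GB\<^esub>) (?e i) (map ?e (x # rest))"
        unfolding val using G.comm[OF e e, of x y] by simp
      moreover have "distinct (x # rest)" "set (x # rest) = V - {i}" using 2 d sV by auto
      moreover have "alternating_coeff i S w = (if S = evens (x # rest) then list_sign (x # rest) else (0 :: 'f))"
        using 2 by (simp only: alternating_coeff_def Some vs option.case list.case) simp
      ultimately show ?thesis
        using start[of "x # rest"] by simp
    next
      case 3
      then have "i \<in> set rest" using i sV by auto
      then obtain pre post where r: "rest = pre @ i # post" by (meson split_list)
      let ?u = "foldl (\<otimes>\<^bsub>GB\<^esub>) (?e x \<otimes>\<^bsub>GB\<^esub> ?e y) (map ?e pre)"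
      have pc: "set (map ?e us) \<subseteq> carrier GB" for us using e by auto
      have "?u \<otimes>\<^bsub>GB\<^esub> ?e i = \<zero>\<^bsub>GB\<^esub>"
      proof (cases pre rule: rev_cases)
        case Nil
        then show ?thesis using ann e by (simp add: G.sq_annihilator_def)
      next
        case (snoc pre' p)
        have "foldl (\<otimes>\<^bsub>GB\<^esub>) (?e x \<otimes>\<^bsub>GB\<^esub> ?e y) (map ?e pre') \<in> carrier GB"
          by (intro G.opword_closed G.mult_closed e pc)
        then show ?thesis using ann e by (simp add: G.sq_annihilator_def snoc)
      qed
      then have "word_value GB ?e w = foldl (\<otimes>\<^bsub>GB\<^esub>) \<zero>\<^bsub>GB\<^esub> (map ?e post)"
        unfolding val r by simp
      also have "\<dots> = \<zero>\<^bsub>GB\<^esub>" by (rule G.opword_zero[OF pc])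
      finally show ?thesis using 3 by (simp add: alternating_coeff_def Some vs zero)
    qed
  qed
qed

text \<open>The value of \<open>f\<close> in the envelope of the alternating superalgebra has the sum of the alternating coefficients as one of its coordinates.\<close>

theorem identity_of_alternating_test:
  fixes f :: "(nat, 'f::field_char_0) npoly"
  assumes f: "\<And>w. w \<in> Poly_Mapping.keys f \<Longrightarrow> distinct (letters w) \<and> set (letters w) = V"
    and V: "2 \<le> card V"
    and test: "\<And>i S. \<lbrakk>i \<in> V; S \<subseteq> V - {i}\<rbrakk> \<Longrightarrow>
      npoly_value alternating_superalgebra (test_value i S) (superization (test_parity i) f) = \<zero>\<^bsub>alternating_superalgebra\<^esub>"
    and K: "metabelian_jordan (K :: ('f, 'k, 'm) module_scheme)"
  shows "satisfies K f"
proof -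
  let ?B = "alternating_superalgebra :: ('f, nat \<Rightarrow> 'f) superalg"
  let ?GB = "grassmann_envelope ?B"
  interpret K: metabelian_jordan K by fact
  interpret G: nonassoc_algebra ?GB by (rule B.envelope_algebra)
  have coeff: "(\<Sum>w\<in>Poly_Mapping.keys f. Poly_Mapping.lookup f w * alternating_coeff i S w) = 0"
    if i: "i \<in> V" and S: "S \<subseteq> V" for i S
  proof (cases "i \<in> S")
    case True
    have "alternating_coeff i S w = (0 :: 'f)" if w: "w \<in> Poly_Mapping.keys f" for w
    proof (cases "left_normed w")
      case (Some vs)
      have "set vs = V" "length vs = card V"
        using left_normed_letters[OF Some] f[OF w] distinct_card by metis+
      then have "distinct vs" using card_distinct by metis
      then have "i \<noteq> x \<or> S \<noteq> evens (y # rest)" "i \<noteq> y \<or> S \<noteq> evens (x # rest)" if "vs = x # y # rest" for x y rest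
        using that True evens_subset[of "y # rest"] evens_subset[of "x # rest"] by auto
      then show ?thesis by (auto simp: alternating_coeff_def Some split: list.split)
    qed (simp add: alternating_coeff_def)
    then show ?thesis by simp
  next
    case False
    then have S': "S \<subseteq> V - {i}" using S by auto
    have e: "test_element i S u \<in> carrier ?GB" for u
      unfolding test_element_def using test_value_part[of i S u] by (intro B.homog_closed) simp_all
    have zero: "npoly_value ?GB (test_element i S) f = \<zero>\<^bsub>?GB\<^esub>"
      unfolding test_element_def
    proof (rule B.superidentity_on_homog[where V = V])
      show "npoly_value ?B (test_value i S) (superization (\<lambda>v. of_nat (card (odd_set (test_parity i) v))) f) = \<zero>\<^bsub>?B\<^esub>"
        using test[OF i S'] by simp
      show "test_value i S v \<in> part ?B (of_nat (card (odd_set (test_parity i) v)))" for v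
        using test_value_part[of i S v] by simp
    qed (use f in auto)
    have pointwise: "(\<Oplus>\<^bsub>?GB\<^esub>w\<in>X. F w) T n = (\<Sum>w\<in>X. F w T n)" if "finite X" "F \<in> X \<rightarrow> carrier ?GB" for X F T n
      using that
    proof induction
      case (insert w X)
      then have "(\<Oplus>\<^bsub>?GB\<^esub>w\<in>insert w X. F w) = F w \<oplus>\<^bsub>?GB\<^esub> (\<Oplus>\<^bsub>?GB\<^esub>w\<in>X. F w)"
        by (intro G.finsum_insert) auto
      with insert show ?case by simp
    qed simp
    have "npoly_value ?GB (test_element i S) f (V - {i}) (card V + 1) =
      (\<Sum>w\<in>Poly_Mapping.keys f. (Poly_Mapping.lookup f w \<odot>\<^bsub>?GB\<^esub> word_value ?GB (test_element i S) w) (V - {i}) (card V + 1))"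
      unfolding npoly_value_def
      by (rule pointwise) (use e in \<open>auto intro!: G.scale_closed G.word_value_closed simp del: envelope_simps\<close>)
    also have "\<dots> = (\<Sum>w\<in>Poly_Mapping.keys f. Poly_Mapping.lookup f w * alternating_coeff i S w)"
      using test_coefficient[where V = V and i = i and S = S] f V i S' by (intro sum.cong) auto
    finally show ?thesis using zero by simp
  qed
  show ?thesis
    unfolding satisfies_def
  proof (intro allI impI)
    fix a :: "nat \<Rightarrow> 'k" assume a: "\<forall>v. a v \<in> carrier K"
    show "npoly_value K a f = \<zero>\<^bsub>K\<^esub>"
    proof (rule K.vanishes_if_alternating_coeffs_vanish[where V = V])
      show "(of_nat (Suc n) :: 'f) \<noteq> 0" for n by (rule of_nat_neq_0)
      show "a v \<in> carrier K" for v using a by blast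
      show "distinct (letters w) \<and> set (letters w) = V" if "w \<in> Poly_Mapping.keys f" for w
        using that by (rule f)
      show "2 \<le> card V" by (rule V)
      show "(\<Sum>w\<in>Poly_Mapping.keys f. Poly_Mapping.lookup f w * alternating_coeff i S w) = 0"
        if "i \<in> V" "S \<subseteq> V" for i S
        using that by (rule coeff)
    qed
  qed
qed


section \<open>Two odd generators suffice\<close>

lemma letters_nonempty [simp]: "letters w \<noteq> []"
  by (induction w) auto

lemma letters_singleton: "letters w = [v] \<Longrightarrow> w = Gen v"
  by (cases w) (auto simp: append_eq_Cons_conv)

text \<open>The values substituted here are \<open>x\<close>, \<open>y\<close> and \<open>m\<^sub>0 = x y\<close>, polynomials in two odd elements.\<close>

lemma test_values_vanish:
  fixes f :: "(nat, 'f::field_char_0) npoly"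
  assumes "satisfies_super (free_variety_superalgebra jordan_metabelian 0 2) f"
  shows "npoly_value alternating_superalgebra (test_value i S) (superization (test_parity i) f) = \<zero>\<^bsub>alternating_superalgebra\<^esub>"
proof -
  let ?B = "alternating_superalgebra :: ('f, nat \<Rightarrow> 'f) superalg"
  let ?F = "free_superalgebra 0 2 :: ('f, (nat + nat, 'f) npoly) superalg"
  define b :: "nat + nat \<Rightarrow> nat \<Rightarrow> 'f" where
    "b = case_sum (\<lambda>_. \<zero>\<^bsub>?B\<^esub>) (\<lambda>j. if j = 0 then basis 0 else basis 1)"
  define g :: "nat \<Rightarrow> (nat + nat, 'f) npoly" where
    "g v = (if v = i then var (Inr 0) \<star> var (Inr 1) else if v \<in> S then var (Inr 0) else var (Inr 1))" for v
  have b_part: "b (Inl k) \<in> part ?B 0" "b (Inr k) \<in> part ?B 1" for k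
    using basis_part(1,2) B.part_zero by (auto simp: b_def)
  have b_carrier: "b v \<in> carrier ?B" for v
    using b_part B.part_carrier by (cases v) blast+
  have "g v \<in> part ?F (test_parity i v)" for v
    by (auto simp: g_def test_parity_def var_def npoly_times_single npolys_on_def)
  from free_variety_superalgebra_universal[of 0 2 f ?B b g "test_parity i", OF assms alternating_superalgebra_variety b_part this]
  have "npoly_value ?B (\<lambda>v. npoly_value ?B b (g v)) (superization (test_parity i) f) = \<zero>\<^bsub>?B\<^esub>" .
  moreover have "npoly_value ?B b (g v) = test_value i S v" for v
  proof -
    have "b (Inr 0) = basis 0" "b (Inr 1) = basis 1" by (simp_all add: b_def)
    then show ?thesis
      using basis_mult(1)[where 'f = 'f] unfolding g_def test_value_def
      by (simp add: B.npoly_value_times[OF b_carrier] B.npoly_value_var[OF b_carrier])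
  qed
  ultimately show ?thesis by simp
qed

text \<open>The expansion into alternating elements needs degree at least 2; a linear superidentity \<open>c v\<close> is refuted by \<open>v = x\<close>
unless \<open>c = 0\<close>.\<close>

theorem superidentities_of_two_odd_generators:
  fixes f :: "(nat, 'f::field_char_0) npoly" and A :: "('f, 'a) superalg"
  assumes mult: "multilinear f"
    and sat: "satisfies_super (free_variety_superalgebra jordan_metabelian 0 2) f"
    and A: "variety_superalgebra jordan_metabelian A"
  shows "satisfies_super A f"
proof -
  interpret superalgebra A using A by (simp add: variety_superalgebra_def)
  obtain V where f: "\<And>w. w \<in> Poly_Mapping.keys f \<Longrightarrow> distinct (letters w) \<and> set (letters w) = V"
    using mult by (auto simp: multilinear_def)
  consider "Poly_Mapping.keys f = {}" | "2 \<le> card V" | w where "w \<in> Poly_Mapping.keys f" "card V \<le> 1"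
    by fastforce
  then have "satisfies GA f"
  proof cases
    case 1
    interpret G: nonassoc_algebra GA by (rule envelope_algebra)
    from 1 have "f = 0" by simp
    then show ?thesis unfolding satisfies_def by (simp only: G.npoly_value_zero) simp
  next
    case 2
    then show ?thesis
      using f test_values_vanish[OF sat] envelope_metabelian_jordan[OF A]
      by (intro identity_of_alternating_test[where V = V]) auto
  next
    case 3
    have "length (letters w) = card V" using f[OF 3(1)] distinct_card by metis
    then have "length (letters w) = 1" using 3(2) by (cases "letters w") auto
    then obtain v where v: "letters w = [v]" by (metis One_nat_def length_0_conv length_Suc_conv)
    then have "V = {v}" using f[OF 3(1)] by auto
    have keys: "Poly_Mapping.keys f = {Gen v}"
    proof -
      have "u = Gen v" if u: "u \<in> Poly_Mapping.keys f" for u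
      proof -
        have "length (letters u) = 1" using f[OF u] distinct_card[of "letters u"] \<open>V = {v}\<close> by simp
        then have "letters u = [v]" using f[OF u] \<open>V = {v}\<close> by (cases "letters u") auto
        then show ?thesis by (rule letters_singleton)
      qed
      then show ?thesis using 3(1) by blast
    qed
    have "superization (test_parity (Suc v)) f =
        Poly_Mapping.single (Gen v) (koszul_sign (test_parity (Suc v)) [v] * Poly_Mapping.lookup f (Gen v))"
    proof (rule poly_mapping_eqI)
      fix u
      have "u \<noteq> Gen v \<Longrightarrow> Poly_Mapping.lookup f u = 0" using keys by (metis in_keys_iff singletonD)
      then show "Poly_Mapping.lookup (superization (test_parity (Suc v)) f) u =
          Poly_Mapping.lookup (Poly_Mapping.single (Gen v) (koszul_sign (test_parity (Suc v)) [v] * Poly_Mapping.lookup f (Gen v))) u"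
        by (auto simp: lookup_superization lookup_single when_def)
    qed
    then have "npoly_value alternating_superalgebra (test_value (Suc v) {v}) (superization (test_parity (Suc v)) f) =
      (koszul_sign (test_parity (Suc v)) [v] * Poly_Mapping.lookup f (Gen v)) \<odot>\<^bsub>alternating_superalgebra\<^esub> test_value (Suc v) {v} v"
      using B.npoly_value_single[where a = "test_value (Suc v) {v}" and w = "Gen v",
          OF B.part_carrier[OF test_value_part]] by simp
    then have "koszul_sign (test_parity (Suc v)) [v] * Poly_Mapping.lookup f (Gen v) = 0"
      using fun_cong[OF test_values_vanish[OF sat, of "Suc v" "{v}"], of 0] by (simp add: test_value_def basis_def)
    then have "Poly_Mapping.lookup f (Gen v) = 0"
      using koszul_sign_nonzero[of "test_parity (Suc v)" "[v]", where 'f = 'f] by simp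
    then show ?thesis using keys by (metis in_keys_iff insertI1)
  qed
  then show ?thesis using satisfies_super_iff_envelope[OF mult] by simp
qed

theorem rank_supervariety_0_2:
  "(rank_supervariety jordan_metabelian 0 2 :: ('f::field_char_0, 'u) superalg set) = variety_superalgebras jordan_metabelian"
proof (intro subset_antisym subsetI)
  let ?F = "free_variety_superalgebra jordan_metabelian 0 2 :: ('f, (nat + nat, 'f) npoly set) superalg"
  fix A :: "('f, 'u) superalg"
  show "A \<in> variety_superalgebras jordan_metabelian" if "A \<in> rank_supervariety jordan_metabelian 0 2"
    using that free_variety_superalgebra_in_variety[of 0 2, where 'f = 'f]
      multilinear_commutator multilinear_metabelian multilinear_jordan
    by (auto simp: variety_superalgebras_def rank_supervariety_def generated_supervariety_def variety_superalgebra_iff)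
  show "A \<in> rank_supervariety jordan_metabelian 0 2" if "A \<in> variety_superalgebras jordan_metabelian"
    using that superidentities_of_two_odd_generators[of _ A]
    by (auto simp: variety_superalgebras_def rank_supervariety_def generated_supervariety_def variety_superalgebra_def)
qed

section \<open>One odd generator does not suffice\<close>

text \<open>Each step applies the Jordan product \<open>R\<^sub>y R\<^sub>z + R\<^sub>z R\<^sub>y\<close> of two operators.\<close>

fun pairs_poly :: "nat \<Rightarrow> (nat, 'f::field) npoly" where
  "pairs_poly 0 = var 0 \<star> var 1"
| "pairs_poly (Suc k) = (pairs_poly k \<star> var (2 * k + 2)) \<star> var (2 * k + 3) + (pairs_poly k \<star> var (2 * k + 3)) \<star> var (2 * k + 2)"

lemma pairs_poly_multilinear:
  assumes "w \<in> Poly_Mapping.keys (pairs_poly k :: (nat, 'f::field) npoly)"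
  shows "distinct (letters w) \<and> set (letters w) = {..<2 * k + 2}"
  using assms
proof (induction k arbitrary: w)
  case 0
  then show ?case by (auto simp: var_def npoly_times_single)
next
  case (Suc k)
  let ?p = "pairs_poly k :: (nat, 'f) npoly" and ?y = "2 * k + 2" and ?z = "2 * k + 3"
  have "w \<in> Poly_Mapping.keys ((?p \<star> var ?y) \<star> var ?z) \<or> w \<in> Poly_Mapping.keys ((?p \<star> var ?z) \<star> var ?y)"
    using Suc.prems keys_add by fastforce
  then have "\<exists>u\<in>Poly_Mapping.keys ?p. w = Times (Times u (Gen ?y)) (Gen ?z) \<or> w = Times (Times u (Gen ?z)) (Gen ?y)"
  proof
    assume "w \<in> Poly_Mapping.keys ((?p \<star> var ?y) \<star> var ?z)"
    from keys_npoly_times[OF this] obtain t where t: "t \<in> Poly_Mapping.keys (?p \<star> var ?y)" "w = Times t (Gen ?z)"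
      by (auto simp: var_def)
    from keys_npoly_times[OF t(1)] t(2) show ?thesis by (auto simp: var_def)
  next
    assume "w \<in> Poly_Mapping.keys ((?p \<star> var ?z) \<star> var ?y)"
    from keys_npoly_times[OF this] obtain t where t: "t \<in> Poly_Mapping.keys (?p \<star> var ?z)" "w = Times t (Gen ?y)"
      by (auto simp: var_def)
    from keys_npoly_times[OF t(1)] t(2) show ?thesis by (auto simp: var_def)
  qed
  then show ?case using Suc.IH by auto
qed

lemma multilinear_pairs_poly: "multilinear (pairs_poly k)"
  unfolding multilinear_def using pairs_poly_multilinear by blast

text \<open>The letters with even numbers become \<open>x\<close>, the others \<open>y\<close>. Then \<open>m\<^sub>2\<^sub>k\<close> goes to \<open>m\<^sub>2\<^sub>k y x = 0\<close> under one of
the two orders and to \<open>m\<^sub>2\<^sub>k x y\<close>, the next element with an even index, under the other.\<close>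

lemma pairs_poly_not_satisfied:
  "\<not> satisfies_super (alternating_superalgebra :: ('f::field, nat \<Rightarrow> 'f) superalg) (pairs_poly m)"
proof -
  let ?B = "alternating_superalgebra :: ('f, nat \<Rightarrow> 'f) superalg"
  let ?GB = "grassmann_envelope ?B"
  interpret G: nonassoc_algebra ?GB by (rule B.envelope_algebra)
  define a where "a v = homog ?B {v} (if even v then basis 0 else basis 1)" for v :: nat
  have a: "a v \<in> carrier ?GB" for v
    unfolding a_def using basis_part(1,2) by (intro B.homog_closed) auto
  have "\<exists>c. c \<noteq> 0 \<and> npoly_value ?GB a (pairs_poly k) = scaled_homog {..<2 * k + 2} c (2 * k + 2)" for k
  proof (induction k)
    case 0
    have "a 0 \<otimes>\<^bsub>?GB\<^esub> a 1 = scaled_homog {0, 1} (grassmann_sign {0} {1}) 2"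
      unfolding a_def scaled_homog_def using basis_mult(1)[where 'f = 'f]
      by (subst B.homog_mult) (auto simp: insert_commute)
    moreover have "{0, 1} = {..<2 * 0 + 2 :: nat}" by auto
    ultimately show ?case
      using grassmann_sign_nonzero
      by (intro exI[of _ "grassmann_sign {0} {1}"]) (simp add: G.npoly_value_times[OF a] G.npoly_value_var[OF a] numeral_2_eq_2)
  next
    case (Suc k)
    then obtain c where c: "c \<noteq> 0" "npoly_value ?GB a (pairs_poly k) = scaled_homog {..<2 * k + 2} c (2 * k + 2)" by blast
    let ?U = "{..<2 * k + 2}" and ?y = "2 * k + 2" and ?z = "2 * k + 3"
    let ?d = "c * grassmann_sign ?U {?y} * grassmann_sign (insert ?y ?U) {?z}"
    have step: "scaled_homog U d n \<otimes>\<^bsub>?GB\<^esub> a v =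
        homog ?B (insert v U) (\<lambda>k. grassmann_sign U {v} * (d * alt_mult (basis n) b k))"
      if "finite U" "v \<notin> U" "b = (if even v then basis 0 else basis 1)" for U d n v b
      unfolding scaled_homog_def a_def using that
      by (subst B.homog_mult) (auto simp: alt_mult_linear basis_def)
    have ev: "even (2 * k)" "odd (2 * k + 1)" by simp_all
    have n: "2 * k + 1 + 2 = 2 * k + 3" "2 * k + 1 + 3 = 2 * k + 4" by simp_all
    have m: "alt_mult (basis (2 * k + 2)) (basis 0) = (basis (2 * k + 3) :: nat \<Rightarrow> 'f)"
      "alt_mult (basis (2 * k + 3)) (basis 1) = (basis (2 * k + 4) :: nat \<Rightarrow> 'f)"
      "alt_mult (basis (2 * k + 2)) (basis 1) = (\<lambda>_. 0 :: 'f)"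
      using basis_mult(2)[OF ev(1)] basis_mult(4)[OF ev(2), unfolded n] basis_mult(5)[OF ev(1)] .
    have fin: "finite ?U" "?y \<notin> ?U" "?z \<notin> ?U" "finite (insert ?y ?U)" "?z \<notin> insert ?y ?U" by auto
    have par: "basis 0 = (if even ?y then basis 0 else (basis 1 :: nat \<Rightarrow> 'f))"
      "basis 1 = (if even ?z then basis 0 else (basis 1 :: nat \<Rightarrow> 'f))" by simp_all
    have 1: "scaled_homog ?U c (2 * k + 2) \<otimes>\<^bsub>?GB\<^esub> a ?y = scaled_homog (insert ?y ?U) (c * grassmann_sign ?U {?y}) (2 * k + 3)"
      unfolding step[OF fin(1,2) par(1)] m unfolding scaled_homog_def by (simp only: mult_ac)
    have 2: "scaled_homog (insert ?y ?U) (c * grassmann_sign ?U {?y}) (2 * k + 3) \<otimes>\<^bsub>?GB\<^esub> a ?z =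
        scaled_homog (insert ?z (insert ?y ?U)) ?d (2 * k + 4)"
      unfolding step[OF fin(4,5) par(2)] m unfolding scaled_homog_def by (simp only: mult_ac)
    have 3: "scaled_homog ?U c (2 * k + 2) \<otimes>\<^bsub>?GB\<^esub> a ?z = \<zero>\<^bsub>?GB\<^esub>"
      unfolding step[OF fin(1,3) par(2)] m by (auto simp: homog_def fun_eq_iff)
    have "npoly_value ?GB a (pairs_poly (Suc k)) =
      (scaled_homog ?U c (2 * k + 2) \<otimes>\<^bsub>?GB\<^esub> a ?y) \<otimes>\<^bsub>?GB\<^esub> a ?z \<oplus>\<^bsub>?GB\<^esub> (scaled_homog ?U c (2 * k + 2) \<otimes>\<^bsub>?GB\<^esub> a ?z) \<otimes>\<^bsub>?GB\<^esub> a ?y"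
      unfolding pairs_poly.simps G.npoly_value_add[OF a] G.npoly_value_times[OF a] G.npoly_value_var[OF a] c(2) ..
    also have "\<dots> = scaled_homog (insert ?z (insert ?y ?U)) ?d (2 * k + 4)"
      unfolding 1 2 3 G.mult_zero_left[OF a] by (simp add: scaled_homog_def homog_def)
    also have "insert ?z (insert ?y ?U) = {..<2 * Suc k + 2}" by auto
    also have "2 * k + 4 = 2 * Suc k + 2" by simp
    finally have "npoly_value ?GB a (pairs_poly (Suc k)) = scaled_homog {..<2 * Suc k + 2} ?d (2 * Suc k + 2)" .
    moreover have "?d \<noteq> 0" using c(1) by simp
    ultimately show ?case by blast
  qed
  then obtain c where "c \<noteq> 0" and c: "npoly_value ?GB a (pairs_poly m) = scaled_homog {..<2 * m + 2} c (2 * m + 2)" by blast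
  then have "npoly_value ?GB a (pairs_poly m) {..<2 * m + 2} (2 * m + 2) \<noteq> 0"
    by (simp add: scaled_homog_def homog_def basis_def)
  then have "npoly_value ?GB a (pairs_poly m) \<noteq> \<zero>\<^bsub>?GB\<^esub>"
    by auto
  then have "\<not> satisfies ?GB (pairs_poly m)"
    using a unfolding satisfies_def by blast
  then show ?thesis by (simp add: B.satisfies_super_iff_envelope[OF multilinear_pairs_poly])
qed

subsection \<open>Copies over other types\<close>

text \<open>A copy of a superalgebra on the image of an injection, so that superalgebras over one type become members of
classes over another type.\<close>

definition transport :: "('a \<Rightarrow> 'b) \<Rightarrow> ('f::field, 'a) superalg \<Rightarrow> ('f, 'b) superalg" where
  "transport h A = (let g = inv_into (carrier A) h in \<lparr>
     carrier = h ` carrier A,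
     mult = (\<lambda>x y. h (g x \<otimes>\<^bsub>A\<^esub> g y)),
     one = undefined,
     zero = h \<zero>\<^bsub>A\<^esub>,
     add = (\<lambda>x y. h (g x \<oplus>\<^bsub>A\<^esub> g y)),
     smult = (\<lambda>c x. h (c \<odot>\<^bsub>A\<^esub> g x)),
     part = (\<lambda>i. h ` part A i)\<rparr>)"

lemma transport_simps [simp]:
  "carrier (transport h A) = h ` carrier A"
  "zero (transport h A) = h \<zero>\<^bsub>A\<^esub>"
  "part (transport h A) i = h ` part A i"
  by (simp_all add: transport_def Let_def)

lemma transport_hom: "inj_on h (carrier A) \<Longrightarrow> algebra_hom A (transport h A) h"
  by (auto simp: algebra_hom_def transport_def Let_def)

lemma transport_superalgebra:
  assumes A: "superalgebra A" and h: "inj_on h (carrier A)"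
  shows "superalgebra (transport h A)"
proof (rule superalgebra_image[OF A transport_hom[OF h]])
  interpret superalgebra A by fact
  fix x y assume "x \<in> part A 0" "y \<in> part A 1" "h x = h y"
  moreover from this have "x = y" using h part_carrier by (auto dest: inj_onD)
  ultimately show "h x = \<zero>\<^bsub>transport h A\<^esub>" using direct by simp
qed simp_all

lemma transport_satisfies_super_iff:
  assumes A: "superalgebra A" and h: "inj_on h (carrier A)"
  shows "satisfies_super (transport h A) f \<longleftrightarrow> satisfies_super A f"
proof -
  interpret superalgebra A by fact
  interpret T: superalgebra "transport h A" using assms by (rule transport_superalgebra)
  have key: "npoly_value (transport h A) (\<lambda>v. h (a v)) g = \<zero>\<^bsub>transport h A\<^esub> \<longleftrightarrow> npoly_value A a g = \<zero>\<^bsub>A\<^esub>"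
    if "\<forall>v. a v \<in> part A (p v)" for a g and p :: "nat \<Rightarrow> bit"
  proof -
    have a: "a v \<in> carrier A" for v using that part_carrier by blast
    have "npoly_value (transport h A) (\<lambda>v. h (a v)) g = h (npoly_value A a g)"
      using algebra_hom_npoly_value[of A "transport h A" h a g, OF nonassoc_algebra_axioms T.nonassoc_algebra_axioms transport_hom[OF h] a] by simp
    then show ?thesis
      using h npoly_value_closed[of a g, OF a] by (auto dest: inj_onD)
  qed
  show ?thesis
  proof
    assume s: "satisfies_super (transport h A) f"
    show "satisfies_super A f"
      unfolding satisfies_super_def
    proof (intro allI impI)
      fix p :: "nat \<Rightarrow> bit" and a assume a: "\<forall>v. a v \<in> part A (p v)"
      then have "\<forall>v. h (a v) \<in> part (transport h A) (p v)" by simp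
      then have "npoly_value (transport h A) (\<lambda>v. h (a v)) (superization p f) = \<zero>\<^bsub>transport h A\<^esub>"
        using s unfolding satisfies_super_def by simp
      then show "npoly_value A a (superization p f) = \<zero>\<^bsub>A\<^esub>" using key[OF a] by blast
    qed
  next
    assume s: "satisfies_super A f"
    show "satisfies_super (transport h A) f"
      unfolding satisfies_super_def
    proof (intro allI impI)
      fix p :: "nat \<Rightarrow> bit" and b assume "\<forall>v. b v \<in> part (transport h A) (p v)"
      then have "\<forall>v. \<exists>x. x \<in> part A (p v) \<and> b v = h x" by auto
      then obtain a where a: "\<forall>v. a v \<in> part A (p v)" "\<And>v. b v = h (a v)" by metis
      have "npoly_value A a (superization p f) = \<zero>\<^bsub>A\<^esub>" using s a(1) unfolding satisfies_super_def by blast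
      then have "npoly_value (transport h A) (\<lambda>v. h (a v)) (superization p f) = \<zero>\<^bsub>transport h A\<^esub>" using key[OF a(1)] by blast
      moreover have "b = (\<lambda>v. h (a v))" using a(2) by auto
      ultimately show "npoly_value (transport h A) b (superization p f) = \<zero>\<^bsub>transport h A\<^esub>" by simp
    qed
  qed
qed

text \<open>An infinite set is in bijection with its square. Iterating a pairing encodes the first \<open>n\<close> values of a
function, and pairing the result with \<open>n\<close>, embedded into the field, encodes functions of finite support.\<close>

lemma finite_support_encoding:
  "\<exists>\<phi> :: (nat \<Rightarrow> 'f::field_char_0) \<Rightarrow> 'f. inj_on \<phi> {g. finite {k. g k \<noteq> 0}}"
proof -
  have "(card_of (UNIV \<times> UNIV :: ('f \<times> 'f) set), card_of (UNIV :: 'f set)) \<in> ordIso"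
    by (rule card_of_Times_same_infinite) (rule infinite_UNIV_char_0)
  then obtain \<pi> :: "'f \<times> 'f \<Rightarrow> 'f" where "bij_betw \<pi> (UNIV \<times> UNIV) UNIV"
    using card_of_ordIso by blast
  then have \<pi>: "inj \<pi>" by (simp add: bij_betw_def)
  define enc where "enc = rec_nat (\<lambda>_. 0) (\<lambda>n r (g :: nat \<Rightarrow> 'f). \<pi> (r g, g n))"
  have enc: "enc n g = enc n h \<Longrightarrow> k < n \<Longrightarrow> g k = h k" for n k g h
  proof (induction n)
    case (Suc n)
    have "\<pi> (enc n g, g n) = \<pi> (enc n h, h n)" using Suc.prems(1) by (simp add: enc_def)
    from injD[OF \<pi> this] have "enc n g = enc n h" "g n = h n" by simp_all
    then show ?case using Suc by (cases "k = n") auto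
  qed simp
  define bound where "bound g n \<longleftrightarrow> (\<forall>k\<ge>n. g k = 0)" for g :: "nat \<Rightarrow> 'f" and n
  define len where "len g = (LEAST n. bound g n)" for g
  have len: "g k = 0" if g: "finite {k. g k \<noteq> 0}" and k: "len g \<le> k" for g k
  proof -
    obtain n where n: "\<And>l. g l \<noteq> 0 \<Longrightarrow> l < n" using g finite_nat_set_iff_bounded[of "{k. g k \<noteq> 0}"] by blast
    have "bound g n" unfolding bound_def using n by (metis linorder_not_le)
    then have "bound g (len g)" unfolding len_def by (rule LeastI)
    then show ?thesis using k by (simp add: bound_def)
  qed
  have "inj_on (\<lambda>g. \<pi> (of_nat (len g), enc (len g) g)) {g. finite {k. g k \<noteq> 0}}"
  proof (rule inj_onI)
    fix g h :: "nat \<Rightarrow> 'f"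
    assume g: "g \<in> {g. finite {k. g k \<noteq> 0}}" and h: "h \<in> {g. finite {k. g k \<noteq> 0}}"
      and "\<pi> (of_nat (len g), enc (len g) g) = \<pi> (of_nat (len h), enc (len h) h)"
    note pair = injD[OF \<pi> this(3), unfolded prod.inject of_nat_eq_iff]
    have eq: "len g = len h" "enc (len g) g = enc (len h) h"
      by (rule pair[THEN conjunct1], rule pair[THEN conjunct2])
    have fin: "finite {k. g k \<noteq> 0}" "finite {k. h k \<noteq> 0}" using g h by simp_all
    show "g = h"
    proof
      fix k
      show "g k = h k"
      proof (cases "k < len g")
        case True
        have "enc (len g) g = enc (len g) h" using eq(2) by (simp only: eq(1))
        then show ?thesis using True by (rule enc)
      next
        case False
        then show ?thesis using len[OF fin(1), of k] len[OF fin(2), of k] eq(1) by simp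
      qed
    qed
  qed
  then show ?thesis by blast
qed


subsection \<open>Operators in Grassmann envelopes\<close>

lemma (in superalgebra) carrier_addspan:
  assumes "x \<in> carrier A"
  shows "x \<in> addspan A (part A 0 \<union> part A 1)"
proof -
  obtain y z where yz: "y \<in> part A 0" "z \<in> part A 1" and x: "x = y \<oplus> z" using assms decompose by blast
  show ?thesis unfolding x using yz by (intro addspan.add addspan.gen) auto
qed

text \<open>The superidentity speaks about homogeneous elements; by additivity it holds for all.\<close>

lemma (in superalgebra) super_metabelian:
  assumes sat: "satisfies_super A metabelian_poly"
    and c: "x \<in> carrier A" "y \<in> carrier A" "z \<in> carrier A" "t \<in> carrier A"
  shows "(x \<otimes> y) \<otimes> (z \<otimes> t) = \<zero>"
proof -
  define a where "a v = (if v = 0 then x else if v = 1 then y else if v = 2 then z else t)" for v :: nat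
  have ac: "a v \<in> carrier A" for v using c by (simp add: a_def)
  have "npoly_value A a metabelian_poly = \<zero>"
  proof (rule multilinear_zero_on_span[where V = "{0, 1, 2, 3}" and Q = "\<lambda>_. part A 0 \<union> part A 1"])
    show "distinct (letters w) \<and> set (letters w) = {0, 1, 2, 3}"
      if "w \<in> Poly_Mapping.keys (metabelian_poly :: (nat, 'f) npoly)" for w
      using that by (auto simp: metabelian_poly_def)
    show "part A 0 \<union> part A 1 \<subseteq> carrier A" using part_carrier by blast
    show "a v \<in> carrier A" for v by (rule ac)
    show "a v \<in> addspan A (part A 0 \<union> part A 1)" for v using ac by (rule carrier_addspan)
    fix b :: "nat \<Rightarrow> 'a" assume bc: "\<And>v. b v \<in> carrier A"
      and b: "\<And>v. v \<in> {0, 1, 2, 3} \<Longrightarrow> b v \<in> part A 0 \<union> part A 1"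
    define b' where "b' v = (if v \<le> 3 then b v else \<zero>)" for v
    define p :: "nat \<Rightarrow> bit" where "p v = (if b' v \<in> part A 0 then 0 else 1)" for v
    have "b' v \<in> part A 0 \<union> part A 1" for v
    proof (cases "v \<le> 3")
      case True
      then have "v \<in> {0, 1, 2, 3}" by auto
      then show ?thesis using b True by (simp add: b'_def)
    qed (simp add: b'_def)
    then have "\<forall>v. b' v \<in> part A (p v)" by (auto simp: p_def)
    then have "npoly_value A b' (superization p metabelian_poly) = \<zero>"
      using sat unfolding satisfies_super_def by simp
    moreover have b'c: "b' v \<in> carrier A" for v using bc by (simp add: b'_def)
    ultimately have "koszul_sign p [0, 1, 2, 3] \<odot> ((b' 0 \<otimes> b' 1) \<otimes> (b' 2 \<otimes> b' 3)) = \<zero>"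
      by (simp add: metabelian_poly_def superization_single npoly_value_single)
    then have "(b' 0 \<otimes> b' 1) \<otimes> (b' 2 \<otimes> b' 3) = \<zero>"
      using scale_eq_zero[of "(b' 0 \<otimes> b' 1) \<otimes> (b' 2 \<otimes> b' 3)" "koszul_sign p [0, 1, 2, 3]"]
        koszul_sign_nonzero[of p "[0, 1, 2, 3]", where 'f = 'f]
      by (simp add: mult_closed b'c)
    then show "npoly_value A b metabelian_poly = \<zero>"
      using bc by (simp add: metabelian_poly_def npoly_value_single b'_def mult_closed)
  qed
  then show ?thesis
    using ac c by (simp add: metabelian_poly_def npoly_value_single mult_closed) (simp add: a_def)
qed

text \<open>On elementary tensors the two terms differ only in the order of the Grassmann letters \<open>s\<close> and \<open>t\<close>, hence in sign.\<close>

lemma (in superalgebra) odd_operators_anticommute: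
  assumes x: "x \<in> part A 1" and st: "s \<noteq> t" and u: "u \<in> carrier GA"
  shows "(u \<otimes>\<^bsub>GA\<^esub> homog A {s} x) \<otimes>\<^bsub>GA\<^esub> homog A {t} x \<oplus>\<^bsub>GA\<^esub> (u \<otimes>\<^bsub>GA\<^esub> homog A {t} x) \<otimes>\<^bsub>GA\<^esub> homog A {s} x = \<zero>\<^bsub>GA\<^esub>"
proof -
  interpret G: nonassoc_algebra GA by (rule envelope_algebra)
  let ?y = "homog A {s} x" and ?z = "homog A {t} x"
  have xc: "x \<in> carrier A" using x part_carrier by blast
  have yz: "?y \<in> carrier GA" "?z \<in> carrier GA" using x by (auto intro!: homog_closed)
  let ?T = "\<lambda>u. (u \<otimes>\<^bsub>GA\<^esub> ?y) \<otimes>\<^bsub>GA\<^esub> ?z \<oplus>\<^bsub>GA\<^esub> (u \<otimes>\<^bsub>GA\<^esub> ?z) \<otimes>\<^bsub>GA\<^esub> ?y"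
  have gens: "{homog A S a | S a. finite S \<and> a \<in> part A (of_nat (card S))} \<subseteq> carrier GA"
    using homog_closed by auto
  have "u \<in> addspan GA {homog A S a | S a. finite S \<and> a \<in> part A (of_nat (card S))}"
    using u by (rule envelope_span)
  then show "?T u = \<zero>\<^bsub>GA\<^esub>"
  proof induction
    case zero
    show ?case by (simp only: G.mult_zero_left yz G.l_zero G.zero_closed)
  next
    case (add u v)
    then have uv: "u \<in> carrier GA" "v \<in> carrier GA" using G.addspan_closed[OF _ gens] by auto
    have c: "(u \<otimes>\<^bsub>GA\<^esub> ?y) \<otimes>\<^bsub>GA\<^esub> ?z \<in> carrier GA" "(u \<otimes>\<^bsub>GA\<^esub> ?z) \<otimes>\<^bsub>GA\<^esub> ?y \<in> carrier GA"
      "(v \<otimes>\<^bsub>GA\<^esub> ?y) \<otimes>\<^bsub>GA\<^esub> ?z \<in> carrier GA" "(v \<otimes>\<^bsub>GA\<^esub> ?z) \<otimes>\<^bsub>GA\<^esub> ?y \<in> carrier GA"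
      using uv yz by (auto intro!: G.mult_closed)
    have "?T (u \<oplus>\<^bsub>GA\<^esub> v) = ?T u \<oplus>\<^bsub>GA\<^esub> ?T v"
      using uv yz c by (simp only: G.mult_add_left G.mult_closed G.a_ac G.a_closed)
    then show ?case unfolding add.IH by (simp only: G.l_zero G.zero_closed)
  next
    case (gen u)
    then obtain S b where S: "finite S" "b \<in> part A (of_nat (card S))" and ub: "u = homog A S b" by blast
    have bc: "b \<in> carrier A" using S part_carrier by blast
    have bx: "(b \<otimes> x) \<otimes> x \<in> carrier A" using bc xc by (simp add: mult_closed)
    have prod: "(homog A S b \<otimes>\<^bsub>GA\<^esub> homog A {i} x) \<otimes>\<^bsub>GA\<^esub> homog A {j} x =
        (if i \<in> S \<or> j \<in> S then \<zero>\<^bsub>GA\<^esub>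
         else homog A (insert i (insert j S)) ((grassmann_sign S {i} * grassmann_sign (insert i S) {j}) \<odot> ((b \<otimes> x) \<otimes> x)))"
      if "i \<noteq> j" for i j
    proof (cases "i \<in> S")
      case True
      have jc: "homog A {j} x \<in> carrier GA" using x by (auto intro!: homog_closed)
      have "homog A S b \<otimes>\<^bsub>GA\<^esub> homog A {i} x = \<zero>\<^bsub>GA\<^esub>"
        using True S bc xc by (subst homog_mult) auto
      then show ?thesis using True by (simp only: G.mult_zero_left jc if_True simp_thms)
    next
      case False
      then have 1: "homog A S b \<otimes>\<^bsub>GA\<^esub> homog A {i} x = homog A (insert i S) (grassmann_sign S {i} \<odot> (b \<otimes> x))"
        using S bc xc by (subst homog_mult) auto
      show ?thesis
      proof (cases "j \<in> S")
        case True
        then show ?thesis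
          unfolding 1 using S bc xc by (subst homog_mult) (auto simp: mult_closed)
      next
        case j: False
        have "homog A (insert i S) (grassmann_sign S {i} \<odot> (b \<otimes> x)) \<otimes>\<^bsub>GA\<^esub> homog A {j} x =
            homog A (insert i S \<union> {j}) (grassmann_sign (insert i S) {j} \<odot> ((grassmann_sign S {i} \<odot> (b \<otimes> x)) \<otimes> x))"
          using S bc xc j that False by (subst homog_mult) (auto simp: mult_closed)
        moreover have "insert i S \<union> {j} = insert i (insert j S)" by auto
        ultimately show ?thesis
          unfolding 1 using j False bc xc by (simp add: mult_smult_left mult_closed scale_scale mult.commute)
      qed
    qed
    show ?case
    proof (cases "s \<in> S \<or> t \<in> S")
      case True
      then show ?thesis
        unfolding ub prod[OF st] prod[OF st[symmetric]] by (simp only: disj_commute if_True G.l_zero G.zero_closed)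
    next
      case False
      have "grassmann_sign (insert s S) {t} = grassmann_sign {s} {t} * (grassmann_sign S {t} :: 'f)"
        using grassmann_sign_union_left[of "{s}" S "{t}"] S False by simp
      moreover have "grassmann_sign (insert t S) {s} = grassmann_sign {t} {s} * (grassmann_sign S {s} :: 'f)"
        using grassmann_sign_union_left[of "{t}" S "{s}"] S False by simp
      moreover have "grassmann_sign {s} {t} = - (grassmann_sign {t} {s} :: 'f)"
        using grassmann_sign_swap[of "{s}" "{t}"] st by simp
      ultimately have sgn: "grassmann_sign S {s} * grassmann_sign (insert s S) {t} =
          - (grassmann_sign S {t} * grassmann_sign (insert t S) {s} :: 'f)"
        by (simp add: mult_ac)
      have "insert t (insert s S) = insert s (insert t S)" by auto
      then show ?thesis
        unfolding ub prod[OF st] prod[OF st[symmetric]] sgn using False bx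
        by (auto simp: homog_def minus_scale l_neg fun_eq_iff)
    qed
  qed
qed

context metabelian_jordan
begin

lemma opword_scale_middle:
  assumes "u \<in> carrier A" "z \<in> carrier A" "set pre \<subseteq> carrier A" "set post \<subseteq> carrier A"
  shows "opword u (pre @ (c \<odot> z) # post) = c \<odot> opword u (pre @ z # post)"
  using assms by (simp add: mult_smult_right opword_closed opword_scale mult_closed)

lemma opword_annihilated:
  assumes "z \<in> sq_annihilator" "x \<in> carrier A" "y \<in> carrier A" "set vs \<subseteq> carrier A" "z \<in> set vs"
  shows "opword (x \<otimes> y) vs = \<zero>"
proof -
  obtain pre post where vs: "vs = pre @ z # post" using assms(5) by (meson split_list)
  have pc: "set pre \<subseteq> carrier A" "set post \<subseteq> carrier A" using assms(4) vs by auto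
  have "opword (x \<otimes> y) pre \<otimes> z = \<zero>"
  proof (cases pre rule: rev_cases)
    case Nil
    then show ?thesis using assms by (simp add: sq_annihilator_def)
  next
    case (snoc pre' p)
    then have "opword (x \<otimes> y) pre' \<in> carrier A" "p \<in> carrier A"
      using assms pc by (auto intro!: opword_closed mult_closed)
    then show ?thesis using assms(1) by (simp add: sq_annihilator_def snoc)
  qed
  then show ?thesis using pc by (simp add: vs opword_zero)
qed

end

lemma (in nonassoc_algebra) addspan_mult_right:
  assumes "x \<in> addspan A X" "X \<subseteq> carrier A" "c \<in> carrier A"
  shows "x \<otimes> c \<in> addspan A ((\<lambda>x. x \<otimes> c) ` X)"
  using assms(1)
proof induction
  case zero
  show ?case using assms(3) by (simp add: addspan.zero)
next
  case (add x y)
  then show ?case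
    using addspan_closed[OF _ assms(2)] assms(3) by (simp add: mult_add_left addspan.add)
qed (auto intro: addspan.gen)

lemma (in nonassoc_algebra) addspan_zero: "x \<in> addspan A X \<Longrightarrow> X \<subseteq> {\<zero>} \<Longrightarrow> x = \<zero>"
  by (induction rule: addspan.induct) auto

lemma addspan_mono: "x \<in> addspan A X \<Longrightarrow> X \<subseteq> Y \<Longrightarrow> x \<in> addspan A Y"
  by (induction rule: addspan.induct) (auto intro: addspan.intros)

text \<open>The orders in which the letters of the operators occur in the expansion of \<^const>\<open>pairs_poly\<close>.\<close>

fun pair_orders :: "nat \<Rightarrow> nat list set" where
  "pair_orders 0 = {[]}"
| "pair_orders (Suc k) = (\<lambda>vs. vs @ [2 * k + 2, 2 * k + 3]) ` pair_orders k \<union> (\<lambda>vs. vs @ [2 * k + 3, 2 * k + 2]) ` pair_orders k"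

lemma pair_orders_length: "vs \<in> pair_orders k \<Longrightarrow> length vs = 2 * k"
  by (induction k arbitrary: vs) auto

lemma pair_orders_nth:
  "\<lbrakk>vs \<in> pair_orders k; i < k\<rbrakk> \<Longrightarrow> {vs ! (2 * i), vs ! (2 * i + 1)} = {2 * i + 2, 2 * i + 3}"
proof (induction k arbitrary: vs)
  case (Suc k)
  then obtain ws where ws: "ws \<in> pair_orders k" "vs = ws @ [2 * k + 2, 2 * k + 3] \<or> vs = ws @ [2 * k + 3, 2 * k + 2]" by auto
  have len: "length ws = 2 * k" using pair_orders_length[OF ws(1)] .
  show ?case
  proof (cases "i = k")
    case True
    have e: "(ws @ [x, y]) ! (2 * i) = x" "(ws @ [x, y]) ! (2 * i + 1) = y" for x y
      using nth_append_length_plus[of ws "[x, y]" 0] nth_append_length_plus[of ws "[x, y]" 1] len True by simp_all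
    from ws(2) show ?thesis
    proof
      assume vs: "vs = ws @ [2 * k + 2, 2 * k + 3]"
      show ?thesis unfolding vs e unfolding True ..
    next
      assume vs: "vs = ws @ [2 * k + 3, 2 * k + 2]"
      show ?thesis unfolding vs e unfolding True by (rule insert_commute)
    qed
  next
    case False
    then have i: "i < k" "2 * i < length ws" "2 * i + 1 < length ws" using Suc.prems(2) len by auto
    have "vs ! (2 * i) = ws ! (2 * i)" "vs ! (2 * i + 1) = ws ! (2 * i + 1)"
      using ws(2) i by (elim disjE; simp only: nth_append if_True)+
    then show ?thesis using Suc.IH[OF ws(1) i(1)] by simp
  qed
qed simp

lemma pair_orders_set: "vs \<in> pair_orders k \<Longrightarrow> set vs = {2..<2 * k + 2}"
  by (induction k arbitrary: vs) auto

lemma (in metabelian_jordan) pairs_poly_span: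
  assumes a: "\<And>v. a v \<in> carrier A"
  shows "npoly_value A a (pairs_poly k) \<in> addspan A ((\<lambda>vs. opword (a 0 \<otimes> a 1) (map a vs)) ` pair_orders k)"
proof (induction k)
  case 0
  then show ?case using a by (auto simp: npoly_value_times npoly_value_var intro!: addspan.gen)
next
  case (Suc k)
  let ?W = "\<lambda>k. (\<lambda>vs. opword (a 0 \<otimes> a 1) (map a vs)) ` pair_orders k" and ?u = "npoly_value A a (pairs_poly k)"
  have W: "?W k \<subseteq> carrier A" using a by (auto intro!: opword_closed mult_closed)
  have *: "(?u \<otimes> a y) \<otimes> a z \<in> addspan A (?W (Suc k))"
    if "(y, z) = (2 * k + 2, 2 * k + 3) \<or> (y, z) = (2 * k + 3, 2 * k + 2)" for y z
  proof -
    have "(?u \<otimes> a y) \<otimes> a z \<in> addspan A ((\<lambda>x. x \<otimes> a z) ` (\<lambda>x. x \<otimes> a y) ` ?W k)"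
      using Suc.IH W a mult_closed by (intro addspan_mult_right) auto
    then show ?thesis
    proof (rule addspan_mono, intro subsetI)
      fix x assume "x \<in> (\<lambda>x. x \<otimes> a z) ` (\<lambda>x. x \<otimes> a y) ` ?W k"
      then obtain vs where vs: "vs \<in> pair_orders k" and x: "x = opword (a 0 \<otimes> a 1) (map a (vs @ [y, z]))" by auto
      have "vs @ [y, z] \<in> pair_orders (Suc k)" using vs that by auto
      then show "x \<in> ?W (Suc k)" unfolding x by (rule imageI)
    qed
  qed
  show ?case
    unfolding pairs_poly.simps npoly_value_add[of a, OF a] npoly_value_times[of a, OF a] npoly_value_var[of a, OF a]
    by (intro addspan.add *) auto
qed

lemma list_split_two:
  assumes "i < j" "j < length vs"
  shows "\<exists>pre mid post. vs = pre @ vs ! i # mid @ vs ! j # post \<and> length pre = i \<and> length mid = j - i - 1"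
proof -
  define D where "D = drop (Suc i) vs"
  let ?n = "j - i - 1"
  have n: "?n < length D" "D ! ?n = vs ! j" using assms by (simp_all add: D_def)
  have "vs = take i vs @ vs ! i # D" unfolding D_def using assms by (intro id_take_nth_drop) simp
  also have "D = take ?n D @ vs ! j # drop (Suc ?n) D" using id_take_nth_drop[OF n(1)] unfolding n(2) .
  finally have "vs = take i vs @ vs ! i # take ?n D @ vs ! j # drop (Suc ?n) D" .
  moreover have "length (take i vs) = i" "length (take ?n D) = ?n" using assms n(1) by auto
  ultimately show ?thesis by blast
qed


subsection \<open>An identity of superalgebras with at most one odd generator\<close>

text \<open>By multilinearity each variable may be assumed to be the coset of a monomial. A monomial of degree greater than
1 acts as 0 on the square of the algebra, so letters of operators may be assumed to be generators. Even
variables are substituted with Grassmann word 1, hence two occurrences of an even generator give proportional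
operators, and a word with these at positions of the same parity is 0.\<close>

lemma pairs_poly_satisfied:
  assumes s: "s \<le> 1" and m: "2 * r < m"
  shows "satisfies_super (free_variety_superalgebra jordan_metabelian r s ::
    ('f::field_char_0, (nat + nat, 'f) npoly set) superalg) (pairs_poly m)"
proof -
  let ?Fr = "free_superalgebra r s :: ('f, (nat + nat, 'f) npoly) superalg"
  let ?I = "verbal_ideal jordan_metabelian ?Fr"
  let ?F = "free_variety_superalgebra jordan_metabelian r s :: ('f, (nat + nat, 'f) npoly set) superalg"
  let ?K = "grassmann_envelope ?F"
  interpret Fr: superalgebra ?Fr by (rule free_superalgebra)
  have F: "variety_superalgebra jordan_metabelian ?F" by (rule free_variety_superalgebra_in_variety)
  interpret F: superalgebra ?F using F by (simp add: variety_superalgebra_def)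
  interpret K: metabelian_jordan ?K using F by (rule envelope_metabelian_jordan)
  define cos where "cos g = ?I +>\<^bsub>?Fr\<^esub> g" for g :: "(nat + nat, 'f) npoly"
  have hom: "algebra_hom ?Fr ?F cos"
    unfolding free_variety_superalgebra_def cos_def by (rule Fr.quotient_hom[OF verbal_ideal_graded])
  have part_F: "part ?F i = cos ` part ?Fr i" for i
    unfolding free_variety_superalgebra_def cos_def by (rule Fr.quotient_simps(6)[OF verbal_ideal_graded])
  let ?mon = "\<lambda>w c. cos (Poly_Mapping.single w c)"
  have mon_part: "?mon w c \<in> part ?F (word_parity w)" if "on_letters r s w" for w c
    unfolding part_F using that by (intro imageI) (auto simp: npolys_on_def split: if_splits)
  have mon_scale: "?mon w c = c \<odot>\<^bsub>?F\<^esub> ?mon w 1" if "on_letters r s w" for w c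
  proof -
    have "Poly_Mapping.single w 1 \<in> carrier ?Fr" using that by (auto simp: npolys_on_def split: if_splits)
    then have "cos (c \<odot>\<^bsub>?Fr\<^esub> Poly_Mapping.single w 1) = c \<odot>\<^bsub>?F\<^esub> ?mon w 1"
      using hom unfolding algebra_hom_def by blast
    then show ?thesis by (simp add: npoly_scale_single)
  qed
  show ?thesis
    unfolding satisfies_super_def
  proof (intro allI impI)
    fix p :: "nat \<Rightarrow> bit" and a assume a: "\<forall>v. a v \<in> part ?F (p v)"
    let ?V = "{..<2 * m + 2}"
    let ?Q = "\<lambda>v. {homog ?F (odd_set p v) (?mon w c) | w c. on_letters r s w \<and> word_parity w = p v}"
    have homog_part: "homog ?F (odd_set p v) x \<in> carrier ?K" if "x \<in> part ?F (p v)" for v x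
      using that by (intro F.homog_closed) simp_all
    have Qc: "?Q v \<subseteq> carrier ?K" for v
    proof
      fix x assume "x \<in> ?Q v"
      then obtain w c where w: "on_letters r s w" "word_parity w = p v" and x: "x = homog ?F (odd_set p v) (?mon w c)" by blast
      show "x \<in> carrier ?K" unfolding x using mon_part[OF w(1), of c] w(2) by (intro homog_part) simp
    qed
    show "npoly_value ?F a (superization p (pairs_poly m)) = \<zero>\<^bsub>?F\<^esub>"
    proof (rule F.homog_superidentity[where V = ?V])
      show "distinct (letters w) \<and> set (letters w) = ?V" if "w \<in> Poly_Mapping.keys (pairs_poly m :: (nat, 'f) npoly)" for w
        using that by (rule pairs_poly_multilinear)
      show "a v \<in> part ?F (p v)" for v using a by blast
      show "npoly_value ?K (\<lambda>v. homog ?F (odd_set p v) (a v)) (pairs_poly m) = \<zero>\<^bsub>?K\<^esub>"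
      proof (rule K.multilinear_zero_on_span[where V = ?V and Q = ?Q])
        show "distinct (letters w) \<and> set (letters w) = ?V" if "w \<in> Poly_Mapping.keys (pairs_poly m :: (nat, 'f) npoly)" for w
          using that by (rule pairs_poly_multilinear)
        show "?Q v \<subseteq> carrier ?K" for v by (rule Qc)
        show "homog ?F (odd_set p v) (a v) \<in> carrier ?K" for v using a by (intro homog_part) blast
        show "homog ?F (odd_set p v) (a v) \<in> addspan ?K (?Q v)" for v
        proof -
          obtain g where g: "g \<in> part ?Fr (p v)" and av: "a v = cos g" using a unfolding part_F by blast
          have "homog ?F (odd_set p v) (cos g) \<in> addspan ?K (?Q v)" using g
          proof (induction g rule: update_induct)
            case const
            have "cos 0 = \<zero>\<^bsub>?F\<^esub>" using hom unfolding algebra_hom_def by simp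
            then have "homog ?F (odd_set p v) (cos 0) = \<zero>\<^bsub>?K\<^esub>" by (simp only: F.homog_zero)
            then show ?case by (simp only: addspan.zero)
          next
            case (update g w c)
            have e: "Poly_Mapping.update w c g = g + Poly_Mapping.single w c"
              using update.hyps(1)
              by (intro poly_mapping_eqI) (auto simp: lookup_update lookup_add lookup_single in_keys_iff when_def)
            have keys: "Poly_Mapping.keys (Poly_Mapping.update w c g) = insert w (Poly_Mapping.keys g)"
              using update.hyps(2) by (auto simp: in_keys_iff lookup_update split: if_splits)
            have g: "g \<in> part ?Fr (p v)" and w: "on_letters r s w" "word_parity w = p v"
              using update.prems keys by (auto simp: npolys_on_def)
            have wc: "Poly_Mapping.single w c \<in> part ?Fr (p v)"
              using w by (auto simp: npolys_on_def split: if_splits)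
            have "cos (Poly_Mapping.update w c g) = cos g \<oplus>\<^bsub>?F\<^esub> ?mon w c"
              unfolding e using hom Fr.part_carrier[OF g] Fr.part_carrier[OF wc] unfolding algebra_hom_def by simp
            moreover have "cos g \<in> carrier ?F" "?mon w c \<in> carrier ?F"
              using g wc F.part_carrier unfolding part_F by blast+
            ultimately have "homog ?F (odd_set p v) (cos (Poly_Mapping.update w c g)) =
                homog ?F (odd_set p v) (cos g) \<oplus>\<^bsub>?K\<^esub> homog ?F (odd_set p v) (?mon w c)"
              by (simp only: F.homog_add)
            moreover have "homog ?F (odd_set p v) (?mon w c) \<in> addspan ?K (?Q v)"
              using w by (intro addspan.gen) blast
            ultimately show ?case using update.IH[OF g] by (simp only: addspan.add)
          qed
          then show ?thesis unfolding av .
        qed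
        fix b :: "nat \<Rightarrow> nat set \<Rightarrow> (nat + nat, 'f) npoly set"
        assume bc: "\<And>v. b v \<in> carrier ?K" and bQ: "\<And>v. v \<in> ?V \<Longrightarrow> b v \<in> ?Q v"
        have "\<exists>w c. on_letters r s w \<and> word_parity w = p v \<and> b v = homog ?F (odd_set p v) (?mon w c)" if "v \<in> ?V" for v
          using bQ[OF that] by blast
        then obtain w c where w: "\<And>v. v \<in> ?V \<Longrightarrow> on_letters r s (w v)"
          and wp: "\<And>v. v \<in> ?V \<Longrightarrow> word_parity (w v) = p v"
          and bv: "\<And>v. v \<in> ?V \<Longrightarrow> b v = homog ?F (odd_set p v) (?mon (w v) (c v))"
          by metis
        have bs: "b v = c v \<odot>\<^bsub>?K\<^esub> homog ?F (odd_set p v) (?mon (w v) 1)" if "v \<in> ?V" for v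
          unfolding bv[OF that] mon_scale[OF w[OF that], of "c v"]
          using mon_part[OF w[OF that], of 1] F.part_carrier by (intro F.homog_scale) blast
        have bset: "set (map b vs) \<subseteq> carrier ?K" for vs using bc by auto
        show "npoly_value ?K b (pairs_poly m) = \<zero>\<^bsub>?K\<^esub>"
        proof (cases "\<exists>i<m. w (2 * i + 2) = Gen (Inr 0) \<and> w (2 * i + 3) = Gen (Inr 0)")
          case True
          then obtain i where i: "i < m" "w (2 * i + 2) = Gen (Inr 0)" "w (2 * i + 3) = Gen (Inr 0)" by blast
          let ?y = "2 * i + 2" and ?z = "2 * i + 3" and ?x = "?mon (Gen (Inr 0)) 1"
          have yz: "?y \<in> ?V" "?z \<in> ?V" using i(1) by auto
          have x: "?x \<in> part ?F 1" using mon_part[of "Gen (Inr 0)" 1] w[OF yz(1)] i(2) by simp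
          have "p ?y = 1" "p ?z = 1" using wp[OF yz(1)] wp[OF yz(2)] i by simp_all
          then have os: "odd_set p ?y = {?y}" "odd_set p ?z = {?z}" by (simp_all add: odd_set_def)
          have by': "b ?y = c ?y \<odot>\<^bsub>?K\<^esub> homog ?F {?y} ?x" and bz: "b ?z = c ?z \<odot>\<^bsub>?K\<^esub> homog ?F {?z} ?x"
            using bs[OF yz(1)] bs[OF yz(2)] by (simp_all only: os i)
          have hx: "homog ?F {v} ?x \<in> carrier ?K" for v using x by (intro F.homog_closed) simp_all
          have step: "npoly_value ?K b (pairs_poly (Suc k)) =
              (npoly_value ?K b (pairs_poly k) \<otimes>\<^bsub>?K\<^esub> b (2 * k + 2)) \<otimes>\<^bsub>?K\<^esub> b (2 * k + 3) \<oplus>\<^bsub>?K\<^esub>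
              (npoly_value ?K b (pairs_poly k) \<otimes>\<^bsub>?K\<^esub> b (2 * k + 3)) \<otimes>\<^bsub>?K\<^esub> b (2 * k + 2)" for k
            unfolding pairs_poly.simps K.npoly_value_add[of b, OF bc] K.npoly_value_times[of b, OF bc] K.npoly_value_var[of b, OF bc] ..
          let ?u = "npoly_value ?K b (pairs_poly i)"
          let ?hy = "homog ?F {?y} ?x" and ?hz = "homog ?F {?z} ?x"
          have uc: "?u \<in> carrier ?K" using bc by (rule K.npoly_value_closed)
          have pc: "(?u \<otimes>\<^bsub>?K\<^esub> ?hy) \<otimes>\<^bsub>?K\<^esub> ?hz \<in> carrier ?K" "(?u \<otimes>\<^bsub>?K\<^esub> ?hz) \<otimes>\<^bsub>?K\<^esub> ?hy \<in> carrier ?K"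
            by (intro K.mult_closed uc hx)+
          have "npoly_value ?K b (pairs_poly (Suc i)) = (c ?y * c ?z) \<odot>\<^bsub>?K\<^esub>
             ((?u \<otimes>\<^bsub>?K\<^esub> ?hy) \<otimes>\<^bsub>?K\<^esub> ?hz \<oplus>\<^bsub>?K\<^esub> (?u \<otimes>\<^bsub>?K\<^esub> ?hz) \<otimes>\<^bsub>?K\<^esub> ?hy)"
            unfolding step by' bz
            by (simp only: K.mult_smult_left K.mult_smult_right K.mult_closed K.scale_closed K.scale_scale uc hx pc K.scale_add mult.commute)
          also have "\<dots> = \<zero>\<^bsub>?K\<^esub>"
            using F.odd_operators_anticommute[OF x, of ?y ?z ?u] uc by (simp only: K.scale_zero)
          finally have i0: "npoly_value ?K b (pairs_poly (Suc i)) = \<zero>\<^bsub>?K\<^esub>" .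
          have "npoly_value ?K b (pairs_poly (Suc i + d)) = \<zero>\<^bsub>?K\<^esub>" for d
          proof (induction d)
            case 0
            then show ?case using i0 by simp
          next
            case (Suc d)
            then show ?case unfolding add_Suc_right step Suc.IH
              by (simp only: K.mult_zero_left bc K.l_zero K.zero_closed)
          qed
          \<comment> \<open>Once the value is 0, all further operators keep it 0.\<close>
          from this[of "m - Suc i"] show ?thesis using i(1) by simp
        next
          case no_odd_pair: False
          have "K.opword (b 0 \<otimes>\<^bsub>?K\<^esub> b 1) (map b vs) = \<zero>\<^bsub>?K\<^esub>" if vs: "vs \<in> pair_orders m" for vs
          proof (cases "\<exists>v\<in>{2..<2 * m + 2}. \<exists>t t'. w v = Times t t'")
            case True
            then obtain v t t' where v: "v \<in> {2..<2 * m + 2}" and wv: "w v = Times t t'" by blast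
            have vV: "v \<in> ?V" using v by simp
            have tt: "on_letters r s t" "on_letters r s t'" using w[OF vV] wv by auto
            have "b v \<in> K.sq_annihilator"
              unfolding K.sq_annihilator_def
            proof (intro CollectI conjI ballI bc)
              fix k l assume kl: "k \<in> carrier ?K" "l \<in> carrier ?K"
              have "?mon (w v) (c v) = ?mon t (c v) \<otimes>\<^bsub>?F\<^esub> ?mon t' 1"
              proof -
                have "Poly_Mapping.single t (c v) \<in> carrier ?Fr" "Poly_Mapping.single t' 1 \<in> carrier ?Fr"
                  using tt by (auto simp: npolys_on_def split: if_splits)
                then have "cos (Poly_Mapping.single t (c v) \<otimes>\<^bsub>?Fr\<^esub> Poly_Mapping.single t' 1) = ?mon t (c v) \<otimes>\<^bsub>?F\<^esub> ?mon t' 1"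
                  using hom unfolding algebra_hom_def by blast
                then show ?thesis by (simp add: npoly_times_single wv)
              qed
              note mon = this
              have met: "satisfies_super ?F metabelian_poly" using F by (simp only: variety_superalgebra_iff)
              have ann: "(x \<otimes>\<^bsub>?F\<^esub> y) \<otimes>\<^bsub>?F\<^esub> ?mon (w v) (c v) = \<zero>\<^bsub>?F\<^esub>" if "x \<in> carrier ?F" "y \<in> carrier ?F" for x y
                unfolding mon
                by (rule F.super_metabelian[OF met that F.part_carrier[OF mon_part[OF tt(1)]] F.part_carrier[OF mon_part[OF tt(2)]]])
              show "(k \<otimes>\<^bsub>?K\<^esub> l) \<otimes>\<^bsub>?K\<^esub> b v = \<zero>\<^bsub>?K\<^esub>"
                unfolding bv[OF vV]
              proof (rule F.homog_annihilates[OF _ finite_odd_set ann kl])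
                show "?mon (w v) (c v) \<in> part ?F (of_nat (card (odd_set p v)))"
                  using mon_part[OF w[OF vV], of "c v"] wp[OF vV] by simp
              qed
            qed
            moreover have "b v \<in> set (map b vs)" using v pair_orders_set[OF vs] by simp
            ultimately show ?thesis using bc bset by (intro K.opword_annihilated) auto
          next
            case no_product: False
            have "\<exists>j i. j \<in> {2 * k, 2 * k + 1} \<and> i < r \<and> w (vs ! j) = Gen (Inl i)" if k: "k < m" for k
            proof -
              have gen: "(\<exists>i<r. w v = Gen (Inl i)) \<or> w v = Gen (Inr 0)" if "v \<in> {2 * k + 2, 2 * k + 3}" for v
              proof -
                have v: "v \<in> ?V" "v \<in> {2..<2 * m + 2}" using that k by auto
                obtain l where l: "w v = Gen l" using no_product v(2) by (cases "w v") blast+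
                have "l \<in> Inl ` {..<r} \<union> Inr ` {..<s}" using w[OF v(1)] unfolding l by simp
                then show ?thesis unfolding l using s by auto
              qed
              have "w (2 * k + 2) \<noteq> Gen (Inr 0) \<or> w (2 * k + 3) \<noteq> Gen (Inr 0)" using no_odd_pair k by blast
              then obtain v where v: "v \<in> {2 * k + 2, 2 * k + 3}" "w v \<noteq> Gen (Inr 0)" by blast
              then obtain i where i: "i < r" "w v = Gen (Inl i)" using gen[OF v(1)] by blast
              have "v \<in> {vs ! (2 * k), vs ! (2 * k + 1)}" unfolding pair_orders_nth[OF vs k] by (rule v(1))
              then consider "v = vs ! (2 * k)" | "v = vs ! (2 * k + 1)" by blast
              then show ?thesis
              proof cases
                case 1
                show ?thesis by (intro exI[of _ "2 * k"] exI[of _ i]) (use i 1 in simp)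
              next
                case 2
                show ?thesis by (intro exI[of _ "2 * k + 1"] exI[of _ i]) (use i 2 in simp)
              qed
            qed
            then obtain j i where j: "\<And>k. k < m \<Longrightarrow> j k \<in> {2 * k, 2 * k + 1}" and i: "\<And>k. k < m \<Longrightarrow> i k < r"
              and wj: "\<And>k. k < m \<Longrightarrow> w (vs ! j k) = Gen (Inl (i k))" by metis
            \<comment> \<open>\<open>r\<close> generators and two parities of positions for \<open>m > 2 r\<close> pairs\<close>
            have "\<not> inj_on (\<lambda>k. (i k, j k mod 2)) {..<m}"
            proof
              assume "inj_on (\<lambda>k. (i k, j k mod 2)) {..<m}"
              moreover have "(\<lambda>k. (i k, j k mod 2)) ` {..<m} \<subseteq> {..<r} \<times> {..<2}" using i by auto
              ultimately have "card {..<m} \<le> card ({..<r} \<times> {..<2 :: nat})" by (rule card_inj_on_le) simp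
              then show False using m by simp
            qed
            then obtain k k' where k: "k < k'" "k' < m" "i k = i k'" "j k mod 2 = j k' mod 2"
              unfolding inj_on_def by (metis (no_types, lifting) lessThan_iff linorder_neqE_nat prod.inject)
            have km: "k < m" using k by simp
            have jk: "j k < j k'" using j[OF km] j[OF k(2)] k(1) by auto
            have jl: "j k' < length vs" using j[OF k(2)] k(2) pair_orders_length[OF vs] by auto
            have odd: "odd (j k' - j k - 1)" using jk k(4) by presburger
            obtain pre mid post where split: "vs = pre @ vs ! j k # mid @ vs ! j k' # post" "length mid = j k' - j k - 1"
              using list_split_two[OF jk jl] by blast
            let ?e = "homog ?F {} (?mon (Gen (Inl (i k))) 1)"
            have mem: "vs ! j k \<in> ?V" "vs ! j k' \<in> ?V"
              using pair_orders_set[OF vs] nth_mem[OF jl] nth_mem[of "j k" vs] jk jl by auto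
            have even: "odd_set p v = {}" if "v \<in> ?V" "w v = Gen (Inl l)" for v l
              using wp[OF that(1)] that(2) by (simp add: odd_set_def)
            have b1: "b (vs ! j k) = c (vs ! j k) \<odot>\<^bsub>?K\<^esub> ?e"
              using bs[OF mem(1)] even[OF mem(1) wj[OF km]] wj[OF km] by (simp only:)
            have b2: "b (vs ! j k') = c (vs ! j k') \<odot>\<^bsub>?K\<^esub> ?e"
              using bs[OF mem(2)] even[OF mem(2) wj[OF k(2)]] wj[OF k(2)] k(3) by (simp only:)
            have ec: "?e \<in> carrier ?K"
              using mon_part[OF w[OF mem(1)], of 1] wj[OF km] by (intro F.homog_closed) simp_all
            let ?u = "b 0 \<otimes>\<^bsub>?K\<^esub> b 1"
            have u: "?u \<in> carrier ?K" "?u \<in> K.sq_annihilator" using bc by (auto intro: K.mult_closed K.product_annihilator)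
            have "K.opword ?u (map b vs) =
              K.opword ?u (map b pre @ (c (vs ! j k) \<odot>\<^bsub>?K\<^esub> ?e) # map b mid @ (c (vs ! j k') \<odot>\<^bsub>?K\<^esub> ?e) # map b post)"
              by (subst split(1)) (simp only: map_append list.map b1 b2)
            also have "\<dots> = c (vs ! j k) \<odot>\<^bsub>?K\<^esub> K.opword ?u (map b pre @ ?e # map b mid @ (c (vs ! j k') \<odot>\<^bsub>?K\<^esub> ?e) # map b post)"
              using u(1) ec bset K.scale_closed[OF ec] by (intro K.opword_scale_middle) (auto simp del: envelope_simps)
            also have "K.opword ?u (map b pre @ ?e # map b mid @ (c (vs ! j k') \<odot>\<^bsub>?K\<^esub> ?e) # map b post) =
              c (vs ! j k') \<odot>\<^bsub>?K\<^esub> K.opword ?u ((map b pre @ ?e # map b mid) @ ?e # map b post)"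
              using K.opword_scale_middle[of ?u ?e "map b pre @ ?e # map b mid" "map b post"] u(1) ec bset bc by (auto simp del: envelope_simps)
            also have "K.opword ?u ((map b pre @ ?e # map b mid) @ ?e # map b post) = \<zero>\<^bsub>?K\<^esub>"
              using K.operators_repeat[of "map b mid" ?u "map b pre" ?e "map b post"] u(2) ec bc odd split(2)
              by (auto simp del: envelope_simps)
            finally show ?thesis by (simp only: K.scale_zero)
          qed
          then have "(\<lambda>vs. K.opword (b 0 \<otimes>\<^bsub>?K\<^esub> b 1) (map b vs)) ` pair_orders m \<subseteq> {\<zero>\<^bsub>?K\<^esub>}" by blast
          with K.pairs_poly_span[of b m, OF bc] show ?thesis by (rule K.addspan_zero)
        qed
      qed
    qed
  qed
qed

section \<open>The basic spectrum\<close>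

text \<open>The pair \<open>(0, 0)\<close> is treated apart: its class consists of the zero algebras by definition.\<close>

lemma rank_supervariety_one_odd:
  fixes e :: "'f::field_char_0 \<Rightarrow> 'u"
  assumes e: "inj e" and s: "s \<le> 1"
  shows "(rank_supervariety jordan_metabelian r s :: ('f, 'u) superalg set) \<noteq> variety_superalgebras jordan_metabelian"
proof
  let ?B = "alternating_superalgebra :: ('f, nat \<Rightarrow> 'f) superalg"
  assume eq: "(rank_supervariety jordan_metabelian r s :: ('f, 'u) superalg set) = variety_superalgebras jordan_metabelian"
  obtain \<phi> :: "(nat \<Rightarrow> 'f) \<Rightarrow> 'f" where "inj_on \<phi> (carrier ?B)"
    using finite_support_encoding by auto
  then have h: "inj_on (e \<circ> \<phi>) (carrier ?B)"
    using e by (simp add: comp_inj_on inj_on_subset)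
  let ?T = "transport (e \<circ> \<phi>) ?B"
  have "variety_superalgebra jordan_metabelian ?T"
    using alternating_superalgebra_variety[where 'f = 'f] transport_superalgebra[OF alternating_superalgebra h]
    by (simp add: variety_superalgebra_iff transport_satisfies_super_iff[OF alternating_superalgebra h])
  then have T: "?T \<in> rank_supervariety jordan_metabelian r s"
    unfolding eq by (simp add: variety_superalgebras_def)
  show False
  proof (cases "(r, s) = (0, 0)")
    case True
    have b: "basis 0 \<in> carrier ?B" "(\<lambda>_. 0) \<in> carrier ?B" by simp_all
    have "carrier ?T = {zero ?T}" using T True by (simp add: rank_supervariety_def)
    moreover have "(e \<circ> \<phi>) (basis 0) \<in> carrier ?T" using b(1) by (simp only: transport_simps imageI)
    ultimately have "(e \<circ> \<phi>) (basis 0) = (e \<circ> \<phi>) (\<lambda>_. 0)" by simp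
    then have "basis 0 = (\<lambda>_. 0 :: 'f)" using inj_onD[OF h _ b] by blast
    then have "basis 0 0 = (0 :: 'f)" by (rule fun_cong)
    then show False by (simp add: basis_def)
  next
    case False
    then have "satisfies_super ?T (pairs_poly (2 * r + 1))"
      using T pairs_poly_satisfied[OF s, of r "2 * r + 1", where 'f = 'f] multilinear_pairs_poly[of "2 * r + 1"]
      by (auto simp: rank_supervariety_def generated_supervariety_def)
    then show False
      using pairs_poly_not_satisfied transport_satisfies_super_iff[OF alternating_superalgebra h] by blast
  qed
qed

text \<open>Pairs with \<open>s \<le> 1\<close> do not give the whole variety of superalgebras, and all other pairs lie above \<open>(0, 2)\<close>, which does.\<close>

theorem corollary3p1:
  fixes e :: "'f::field_char_0 \<Rightarrow> 'u"
  assumes "inj e"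
  shows "basic_spectrum TYPE('u) (jordan_metabelian :: (nat, 'f) npoly set) = {(0, 2)}"
proof -
  have ranks: "(rank_supervariety jordan_metabelian r s :: ('f, 'u) superalg set) \<noteq> variety_superalgebras jordan_metabelian"
    if "s \<le> 1" for r s
    using assms that by (rule rank_supervariety_one_odd)
  have "basic_superrank TYPE('u) (jordan_metabelian :: (nat, 'f) npoly set) 0 2"
    unfolding basic_superrank_def
  proof (intro conjI allI impI rank_supervariety_0_2)
    fix r s :: nat assume "(r, s) \<noteq> (0, 2)" "r \<le> 0" "s \<le> 2"
    then have "s \<le> 1" by auto
    then show "(rank_supervariety jordan_metabelian r s :: ('f, 'u) superalg set) \<noteq> variety_superalgebras jordan_metabelian"
      by (rule ranks)
  qed
  moreover have "(r, s) = (0, 2)" if basic: "basic_superrank TYPE('u) (jordan_metabelian :: (nat, 'f) npoly set) r s" for r s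
  proof (rule ccontr)
    assume ne: "(r, s) \<noteq> (0, 2)"
    have eq: "(rank_supervariety jordan_metabelian r s :: ('f, 'u) superalg set) = variety_superalgebras jordan_metabelian"
      using basic unfolding basic_superrank_def by (rule conjunct1)
    have minimal: "(rank_supervariety jordan_metabelian r' s' :: ('f, 'u) superalg set) \<noteq> variety_superalgebras jordan_metabelian"
      if "(r', s') \<noteq> (r, s)" "r' \<le> r" "s' \<le> s" for r' s'
      using basic[unfolded basic_superrank_def, THEN conjunct2, rule_format, OF that] .
    have "2 \<le> s"
    proof (rule ccontr)
      assume "\<not> 2 \<le> s"
      then have "s \<le> 1" by simp
      from ranks[OF this] eq show False by (rule notE)
    qed
    from minimal[OF ne[symmetric] le0 this] rank_supervariety_0_2 show False by (rule notE)
  qed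
  ultimately show ?thesis unfolding basic_spectrum_def by blast
qed

end
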